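(* Let $(X,\rho,\mu)$ be a space of homogeneous type (with the standing assumptions listed in the context), $q\in(1,\infty)$, and $\gamma\in[0,1)$. Assume that $\omega\in A^+_q(\gamma)$. Then there exist two positive constants $\kappa$ and $C$ such that, for any parabolic rectangle $P$, $$\left(⨍_{P^-}\omega^{\kappa+1}\right)^{\frac1{\kappa+1}}\le C\,⨍_{P^+}\omega$$ and $$\left[⨍_{P^+}\omega^{(1-q')(\kappa+1)}\right]^{\frac1{\kappa+1}}\le C\,⨍_{P^-}\omega^{1-q'} .$$
   Context: Setting. $(X,\rho)$ is a quasi-metric space: $\rho:X\times X\to[0,\infty)$, $\rho(x,y)=0$ iff $x=y$, $\rho(x,y)=\rho(y,x)$, and $\rho(x,y)\le K_0[\rho(x,z)+\rho(z,y)]$ for all $x,y,z\in X$, with a constant $K_0\in[1,\infty)$. Balls are $B(x,r)=\{y\in X:\rho(x,y)<r\}$. $\mu$ is a nonnegative measure on a $\sigma$-algebra containing the balls which is doubling: $\mu(B(x,2r))\le C_\mu\mu(B(x,r))$ for all $x\in X$, $r\in(0,\infty)$; then $(X,\rho,\mu)$ is called a space of homogeneous type. Standing assumptions: (a) for each $x$ the balls $\{B(x,r)\}_{r>0}$ form a basis of open neighborhoods of $x$; (b) $\mu$ is Borel regular (open sets are measurable and every $A\subset X$ lies in a Borel set $E$ with $\mu(A)=\mu(E)$); (c) $0<\mu(B(x,r))<\infty$ for all balls; (d) $\operatorname{diam}(X)=\infty$ and $\mu(\{x\})=0$ for all $x$; (e) monotone geodesic property: there is a constant $\widetilde K>0$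 such that for all $s\in(0,\infty)$ and $x,y\in X$ with $\rho(x,y)\ge s$ there are $m\in\mathbb N$ and points $x_0=x,x_1,\dots,x_m=y$ with $\rho(x_i,x_{i+1})\le\widetilde K s$ and $\rho(x_{i+1},x_m)\le\rho(x_i,x_m)-s$ for $i=0,\dots,m-1$. Fix $p\in(1,\infty)$. $X\times\mathbb R$ carries the quasi-metric $d((x,t),(y,s))=\max\{\rho(x,y),|t-s|^{1/p}\}$ and the product measure $\lambda=\mu\times m$, $m$ being Lebesgue measure on $\mathbb R$; the same basic assumptions (a)-(d) are made for $(X\times\mathbb R,d,\lambda)$. All integrals are with respect to $\lambda$, and $⨍_E f:=\frac1{\lambda(E)}\int_E f$ denotes the average. Parabolic cylinders. For $x\in X$, $t\in\mathbb R$, $l\in(0,\infty)$, $\gamma\in[0,1)$ put $R=R(x,t,l)=B(x,l)\times(t-l^p,t+l^p)$, $R^-(\gamma)=B(x,l)\times(t-l^p,t-\gamma l^p)$, $R^+(\gamma)=B(x,l)\times(t+\gamma l^p,t+l^p)$. Weights. A weight is a real-valued, $\lambda$-almost everywhere positive, locally integrable function on $X\times\mathbb R$ (integrable on some cylinder $R(x,t,r)$ around each point). For $q\in(1,\infty)$, with $1/q+1/q'=1$, and $\gamma\in[0,1)$, a weight $\omega$ belongs to $A^+_q(\gamma)$ if $\sup_{R}\left[⨍_{R^-(\gamma)}\omega\right]\left[⨍_{R^+(\gamma)}\omega^{1-q'}\right]^{q-1}<\infty$, the supremum being over all parabolic cylinders $R(x,t,l)$. Adjacent dyadic systems and parabolic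 rectangles. Fix $\delta\in(0,1)$ with $96K_0^6\delta\le1$ and constants $0<c_0\le C_0<\infty$ with $12K_0^3C_0\delta\le c_0$; let $c_1=(3K_0^2)^{-1}c_0$, $C_1=2K_0C_0$. Fix (they exist by a theorem of Hytönen and Kairema) $K\in\mathbb N$ and, for $\tau\in\{1,\dots,K\}$, points $\{z^{k,\tau}_\alpha\}$ and families $\mathfrak D^\tau=\{Q^{k,\tau}_\alpha: k\in\mathbb Z,\alpha\in I_{k,\tau}\}$ of subsets of $X$ (dyadic cubes) such that for each $\tau$: $\rho(z^{k,\tau}_\alpha,z^{k,\tau}_\beta)\ge c_0\delta^k$ for $\alpha\ne\beta$ and $\min_\alpha\rho(x,z^{k,\tau}_\alpha)<C_0\delta^k$ for all $x\in X$; if $l\ge k$, then either $Q^{l,\tau}_\beta\subset Q^{k,\tau}_\alpha$ or they are disjoint; for each $k$, $X$ is the disjoint union of $Q^{k,\tau}_\alpha$, $\alpha\in I_{k,\tau}$; $B(z^{k,\tau}_\alpha,c_1\delta^k)\subset Q^{k,\tau}_\alpha\subset B(z^{k,\tau}_\alpha,C_1\delta^k)$; if $l\ge k$ and $Q^{l,\tau}_\beta\subset Q^{k,\tau}_\alpha$, then $B(z^{l,\tau}_\beta,C_1\delta^l)\subset B(z^{k,\tau}_\alpha,C_1\delta^k)$; moreover there is a constant $C_*>0$ such that every ball $B(x,r)$ is contained in some $Q^{k,\tau}_\alpha$ (for some $\tau$) with $\operatorname{diam}(Q^{k,\tau}_\alpha)\le C_*r$. A parabolic rectangle is $P=P(\tau,k,\alpha,t)=Q^{k,\tau}_\alpha\times(t-\delta^{kp},t+\delta^{kp})$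 (with $\tau\in\{1,\dots,K\}$, $k\in\mathbb Z$, $\alpha\in I_{k,\tau}$, $t\in\mathbb R$), and $P^-=Q^{k,\tau}_\alpha\times(t-\delta^{kp},t)$, $P^+=Q^{k,\tau}_\alpha\times(t,t+\delta^{kp})$. *)

theory Defs
  imports "HOL-Analysis.Analysis"
begin

section \<open>Quasi-metric spaces and spaces of homogeneous type\<close>

text \<open>The underlying set of a space is always the whole type.\<close>

definition qball :: "('a \<Rightarrow> 'a \<Rightarrow> real) \<Rightarrow> 'a \<Rightarrow> real \<Rightarrow> 'a set" where
  "qball \<rho> x r = {y. \<rho> x y < r}"

definition qdiam :: "('a \<Rightarrow> 'a \<Rightarrow> real) \<Rightarrow> 'a set \<Rightarrow> ennreal" where
  "qdiam \<rho> A = (SUP x\<in>A. SUP y\<in>A. ennreal (\<rho> x y))"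

definition qtopology :: "('a \<Rightarrow> 'a \<Rightarrow> real) \<Rightarrow> 'a topology" where
  "qtopology \<rho> = topology (\<lambda>U. \<forall>x\<in>U. \<exists>r>0. qball \<rho> x r \<subseteq> U)"

lemma openin_qtopology:
  "openin (qtopology \<rho>) U \<longleftrightarrow> (\<forall>x\<in>U. \<exists>r>0. qball \<rho> x r \<subseteq> U)"
proof -
  have "\<exists>r>0. qball \<rho> x r \<subseteq> S \<inter> T"
    if "\<exists>r>0. qball \<rho> x r \<subseteq> S" "\<exists>r>0. qball \<rho> x r \<subseteq> T" for x and S T :: "'a set"
  proof -
    from that obtain r s where "r > 0" "qball \<rho> x r \<subseteq> S" "s > 0" "qball \<rho> x s \<subseteq> T"
      by blast
    then show ?thesis
      by (intro exI[of _ "min r s"]) (auto simp: qball_def)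
  qed
  then have "istopology (\<lambda>U. \<forall>x\<in>U. \<exists>r>0. qball \<rho> x r \<subseteq> U)"
    unfolding istopology_def by (auto 0 3 simp: Ball_def) (meson Union_upper subset_trans)+
  then show ?thesis
    unfolding qtopology_def by (simp add: topology_inverse')
qed

definition qborel_sets :: "('a \<Rightarrow> 'a \<Rightarrow> real) \<Rightarrow> 'a set set" where
  "qborel_sets \<rho> = sigma_sets UNIV {U. openin (qtopology \<rho>) U}"

text \<open>
  In a quasi-metric space balls need not be open, so the first condition is a genuine
  restriction.  In the third one, the measure of an arbitrary set is its outer measure.
\<close>

definition basic_assumptions :: "('a \<Rightarrow> 'a \<Rightarrow> real) \<Rightarrow> 'a measure \<Rightarrow> bool" where
  "basic_assumptions \<rho> M \<longleftrightarrow>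
    (\<forall>x. (\<forall>r>0. openin (qtopology \<rho>) (qball \<rho> x r)) \<and>
         (\<forall>U. openin (qtopology \<rho>) U \<and> x \<in> U \<longrightarrow> (\<exists>r>0. qball \<rho> x r \<subseteq> U))) \<and>
    (\<forall>U. openin (qtopology \<rho>) U \<longrightarrow> U \<in> sets M) \<and>
    (\<forall>A. \<exists>E\<in>qborel_sets \<rho>. A \<subseteq> E \<and> outer_measure_of M A = emeasure M E) \<and>
    (\<forall>x. \<forall>r>0. 0 < emeasure M (qball \<rho> x r) \<and> emeasure M (qball \<rho> x r) < \<infinity>) \<and>
    qdiam \<rho> UNIV = \<infinity> \<and>
    (\<forall>x. emeasure M {x} = 0)"

definition monotone_geodesic :: "('a \<Rightarrow> 'a \<Rightarrow> real) \<Rightarrow> bool" where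
  "monotone_geodesic \<rho> \<longleftrightarrow>
    (\<exists>K>0. \<forall>s>0. \<forall>x y. s \<le> \<rho> x y \<longrightarrow>
      (\<exists>(m::nat) \<xi>. \<xi> 0 = x \<and> \<xi> m = y \<and>
        (\<forall>i<m. \<rho> (\<xi> i) (\<xi> (Suc i)) \<le> K * s \<and>
               \<rho> (\<xi> (Suc i)) (\<xi> m) \<le> \<rho> (\<xi> i) (\<xi> m) - s)))"

locale quasi_metric =
  fixes \<rho> :: "'a \<Rightarrow> 'a \<Rightarrow> real" and K\<^sub>0 :: real
  assumes K0_ge_1: "1 \<le> K\<^sub>0"
    and nonneg: "0 \<le> \<rho> x y"
    and eq_0_iff: "\<rho> x y = 0 \<longleftrightarrow> x = y"
    and sym: "\<rho> x y = \<rho> y x"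
    and quasi_triangle: "\<rho> x y \<le> K\<^sub>0 * (\<rho> x z + \<rho> z y)"

locale homogeneous_type = quasi_metric \<rho> K\<^sub>0
  for \<rho> :: "'a \<Rightarrow> 'a \<Rightarrow> real" and K\<^sub>0 :: real +
  fixes \<mu> :: "'a measure"
  assumes space_eq: "space \<mu> = UNIV"
    and qball_measurable: "0 < r \<Longrightarrow> qball \<rho> x r \<in> sets \<mu>"
    and doubling: "\<exists>C::real. \<forall>x. \<forall>r>0.
          emeasure \<mu> (qball \<rho> x (2 * r)) \<le> ennreal C * emeasure \<mu> (qball \<rho> x r)"


section \<open>The parabolic product space\<close>

definition par_dist :: "('a \<Rightarrow> 'a \<Rightarrow> real) \<Rightarrow> real \<Rightarrow> 'a \<times> real \<Rightarrow> 'a \<times> real \<Rightarrow> real" where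
  "par_dist \<rho> p = (\<lambda>(x, t) (y, s). max (\<rho> x y) (\<bar>t - s\<bar> powr (1 / p)))"

definition par_measure :: "'a measure \<Rightarrow> ('a \<times> real) measure" where
  "par_measure \<mu> = \<mu> \<Otimes>\<^sub>M lebesgue"

definition cyl :: "('a \<Rightarrow> 'a \<Rightarrow> real) \<Rightarrow> real \<Rightarrow> 'a \<Rightarrow> real \<Rightarrow> real \<Rightarrow> ('a \<times> real) set" where
  "cyl \<rho> p x t l = qball \<rho> x l \<times> {t - l powr p<..<t + l powr p}"

definition cyl_minus ::
    "('a \<Rightarrow> 'a \<Rightarrow> real) \<Rightarrow> real \<Rightarrow> real \<Rightarrow> 'a \<Rightarrow> real \<Rightarrow> real \<Rightarrow> ('a \<times> real) set" where
  "cyl_minus \<rho> p \<gamma> x t l = qball \<rho> x l \<times> {t - l powr p<..<t - \<gamma> * l powr p}"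

definition cyl_plus ::
    "('a \<Rightarrow> 'a \<Rightarrow> real) \<Rightarrow> real \<Rightarrow> real \<Rightarrow> 'a \<Rightarrow> real \<Rightarrow> real \<Rightarrow> ('a \<times> real) set" where
  "cyl_plus \<rho> p \<gamma> x t l = qball \<rho> x l \<times> {t + \<gamma> * l powr p<..<t + l powr p}"


section \<open>Averages and weights\<close>

definition avg :: "'b measure \<Rightarrow> 'b set \<Rightarrow> ('b \<Rightarrow> real) \<Rightarrow> ennreal" where
  "avg M E f = (\<integral>\<^sup>+z\<in>E. ennreal (f z) \<partial>M) / emeasure M E"

text \<open>Real powers of extended nonnegative numbers; only used for exponents \<open>a > 0\<close>.\<close>

definition epowr :: "ennreal \<Rightarrow> real \<Rightarrow> ennreal" where
  "epowr x a = (if x = \<infinity> then \<infinity> else ennreal (enn2real x powr a))"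

definition conj_exponent :: "real \<Rightarrow> real" where
  "conj_exponent q = q / (q - 1)"

lemma conj_exponent: "1 < q \<Longrightarrow> 1 / q + 1 / conj_exponent q = 1"
  by (simp add: conj_exponent_def field_simps)

definition weight ::
    "('a \<Rightarrow> 'a \<Rightarrow> real) \<Rightarrow> 'a measure \<Rightarrow> real \<Rightarrow> ('a \<times> real \<Rightarrow> real) \<Rightarrow> bool" where
  "weight \<rho> \<mu> p \<omega> \<longleftrightarrow>
    \<omega> \<in> borel_measurable (par_measure \<mu>) \<and>
    (AE z in par_measure \<mu>. 0 < \<omega> z) \<and>
    (\<forall>x t. \<exists>r>0. set_integrable (par_measure \<mu>) (cyl \<rho> p x t r) \<omega>)"

definition A_plus ::
    "('a \<Rightarrow> 'a \<Rightarrow> real) \<Rightarrow> 'a measure \<Rightarrow> real \<Rightarrow> real \<Rightarrow> real \<Rightarrow> ('a \<times> real \<Rightarrow> real) set" where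
  "A_plus \<rho> \<mu> p q \<gamma> = {\<omega>. weight \<rho> \<mu> p \<omega> \<and>
    (SUP (x, t, l) \<in> UNIV \<times> UNIV \<times> {0<..}.
       avg (par_measure \<mu>) (cyl_minus \<rho> p \<gamma> x t l) \<omega> *
       epowr (avg (par_measure \<mu>) (cyl_plus \<rho> p \<gamma> x t l)
                (\<lambda>z. \<omega> z powr (1 - conj_exponent q))) (q - 1)) < \<infinity>}"


section \<open>Adjacent dyadic systems and parabolic rectangles\<close>

text \<open>
  \<open>Idx \<tau> k\<close> is the index set of the cubes \<open>Q \<tau> k \<alpha>\<close> of generation \<open>k\<close> in the \<open>\<tau>\<close>-th
  system, and \<open>z \<tau> k \<alpha>\<close> is the centre of \<open>Q \<tau> k \<alpha>\<close>.  Measurability of the cubes is required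
  explicitly because averages over them are taken: the remaining conditions do not imply it
  when the measure is not complete.
\<close>

locale adjacent_dyadic = quasi_metric \<rho> K\<^sub>0
  for \<rho> :: "'a \<Rightarrow> 'a \<Rightarrow> real" and K\<^sub>0 :: real +
  fixes \<mu> :: "'a measure"
    and \<delta> c\<^sub>0 C\<^sub>0 :: real
    and K :: nat
    and Idx :: "nat \<Rightarrow> int \<Rightarrow> 'i set"
    and z :: "nat \<Rightarrow> int \<Rightarrow> 'i \<Rightarrow> 'a"
    and Q :: "nat \<Rightarrow> int \<Rightarrow> 'i \<Rightarrow> 'a set"
  assumes delta: "0 < \<delta>" "\<delta> < 1" "96 * K\<^sub>0 ^ 6 * \<delta> \<le> 1"
    and c0_C0: "0 < c\<^sub>0" "c\<^sub>0 \<le> C\<^sub>0" "12 * K\<^sub>0 ^ 3 * C\<^sub>0 * \<delta> \<le> c\<^sub>0"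
    and cubes_measurable: "\<lbrakk>\<tau> \<in> {1..K}; \<alpha> \<in> Idx \<tau> k\<rbrakk> \<Longrightarrow> Q \<tau> k \<alpha> \<in> sets \<mu>"
    and points_separated: "\<lbrakk>\<tau> \<in> {1..K}; \<alpha> \<in> Idx \<tau> k; \<beta> \<in> Idx \<tau> k; \<alpha> \<noteq> \<beta>\<rbrakk> \<Longrightarrow>
          c\<^sub>0 * \<delta> powi k \<le> \<rho> (z \<tau> k \<alpha>) (z \<tau> k \<beta>)"
    and points_dense: "\<tau> \<in> {1..K} \<Longrightarrow> \<exists>\<alpha>\<in>Idx \<tau> k. \<rho> x (z \<tau> k \<alpha>) < C\<^sub>0 * \<delta> powi k"
    and nested: "\<lbrakk>\<tau> \<in> {1..K}; k \<le> l; \<alpha> \<in> Idx \<tau> k; \<beta> \<in> Idx \<tau> l\<rbrakk> \<Longrightarrow>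
          Q \<tau> l \<beta> \<subseteq> Q \<tau> k \<alpha> \<or> Q \<tau> l \<beta> \<inter> Q \<tau> k \<alpha> = {}"
    and cover: "\<tau> \<in> {1..K} \<Longrightarrow> (\<Union>\<alpha>\<in>Idx \<tau> k. Q \<tau> k \<alpha>) = UNIV"
    and disjoint: "\<tau> \<in> {1..K} \<Longrightarrow> disjoint_family_on (Q \<tau> k) (Idx \<tau> k)"
    and inner_ball: "\<lbrakk>\<tau> \<in> {1..K}; \<alpha> \<in> Idx \<tau> k\<rbrakk> \<Longrightarrow>
          qball \<rho> (z \<tau> k \<alpha>) (c\<^sub>0 / (3 * K\<^sub>0\<^sup>2) * \<delta> powi k) \<subseteq> Q \<tau> k \<alpha>"
    and outer_ball: "\<lbrakk>\<tau> \<in> {1..K}; \<alpha> \<in> Idx \<tau> k\<rbrakk> \<Longrightarrow>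
          Q \<tau> k \<alpha> \<subseteq> qball \<rho> (z \<tau> k \<alpha>) (2 * K\<^sub>0 * C\<^sub>0 * \<delta> powi k)"
    and nested_balls: "\<lbrakk>\<tau> \<in> {1..K}; k \<le> l; \<alpha> \<in> Idx \<tau> k; \<beta> \<in> Idx \<tau> l; Q \<tau> l \<beta> \<subseteq> Q \<tau> k \<alpha>\<rbrakk> \<Longrightarrow>
          qball \<rho> (z \<tau> l \<beta>) (2 * K\<^sub>0 * C\<^sub>0 * \<delta> powi l)
            \<subseteq> qball \<rho> (z \<tau> k \<alpha>) (2 * K\<^sub>0 * C\<^sub>0 * \<delta> powi k)"
    and balls_in_cubes: "\<exists>C>0. \<forall>x. \<forall>r>0. \<exists>\<tau>\<in>{1..K}. \<exists>k. \<exists>\<alpha>\<in>Idx \<tau> k.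
          qball \<rho> x r \<subseteq> Q \<tau> k \<alpha> \<and> qdiam \<rho> (Q \<tau> k \<alpha>) \<le> ennreal (C * r)"

text \<open>Lower and upper half of the parabolic rectangle over a cube \<open>S\<close> of generation \<open>k\<close>,
  centred at time \<open>t\<close>.\<close>

definition rect_minus :: "real \<Rightarrow> real \<Rightarrow> int \<Rightarrow> 'a set \<Rightarrow> real \<Rightarrow> ('a \<times> real) set" where
  "rect_minus \<delta> p k S t = S \<times> {t - \<delta> powr (of_int k * p)<..<t}"

definition rect_plus :: "real \<Rightarrow> real \<Rightarrow> int \<Rightarrow> 'a set \<Rightarrow> real \<Rightarrow> ('a \<times> real) set" where
  "rect_plus \<delta> p k S t = S \<times> {t<..<t + \<delta> powr (of_int k * p)}"

end

theory Submission
  imports Defs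
begin

text \<open>
  If the average of a weight \<open>w\<close> over a lower half cylinder exceeds \<open>s\<close>, the condition \<open>A_plus\<close>
  and Chebyshev's inequality for the dual weight show that \<open>w > \<beta> * s\<close> on most of the upper half
  cylinder; with time reversed, the same holds for the dual weight.  Both inequalities follow
  from this property alone.  First, a Vitali covering by cylinders of nearly maximal radius turns
  it into a good-lambda inequality between slightly different regions, and integrating the
  latter against \<open>\<kappa> * s powr (\<kappa> - 1)\<close> with \<open>\<kappa>\<close> small gives a reverse inequality on cylinders
  with a larger cylinder on the right.  Second, the property compares the mass of a small
  cylinder with that of a neighbouring one a little later in time.  Chaining along monotone
  geodesics reaches the upper half of the rectangle: \<open>n\<close> steps of length \<open>1 / n\<close> take a time of
  order \<open>n powr (1 - p)\<close>, which is arbitrarily small because \<open>p > 1\<close>.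
\<close>

section \<open>Vitali coverings in doubling quasi-metric spaces\<close>

text \<open>The two halves of a rectangle touch, whereas the weight condition leaves a gap when
  \<open>\<gamma> > 0\<close> and moves every estimate in one direction of time. The local reverse
  inequality does not respect this direction: its larger cylinder on the right reaches into the past
  as well as into the future. This is harmless because its radius is a small multiple of that of the
  rectangle, so that the chain can still carry all of its mass into the half on the right.
  \<open>shift_dense\<close> asks for every proportion \<open>\<theta>\<close> because its two uses
  differ. The good-lambda part is content with 1/2; a step of the chain needs the exceptional set to
  be smaller than a cylinder that fills only a fixed small share of the shifted one. Integrability
  over whole rectangles is not known beforehand for the weight and its dual. Hence powers are
  truncated before anything is absorbed, and infinite mass on the right is treated as a separate
  case.\<close>

lemma vitali_selection:
  fixes B :: "'i \<Rightarrow> 'b set" and r :: "'i \<Rightarrow> real"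
  assumes pos: "\<And>i. i \<in> I \<Longrightarrow> 0 < r i" and bdd: "\<And>i. i \<in> I \<Longrightarrow> r i \<le> R"
    and ne: "\<And>i. i \<in> I \<Longrightarrow> B i \<noteq> {}"
  obtains J where "J \<subseteq> I" "disjoint_family_on B J"
    "\<And>i. i \<in> I \<Longrightarrow> \<exists>j\<in>J. B i \<inter> B j \<noteq> {} \<and> r i \<le> 2 * r j"
proof -
  define ok where "ok J i \<longleftrightarrow> (\<exists>j\<in>J. B i \<inter> B j \<noteq> {} \<and> r i \<le> 2 * r j)" for J i
  \<comment> \<open>Plain maximality among disjoint families would not control radii, so the family
    must dominate every index that it meets. A maximal member of \<open>F\<close> then meets every
    index: otherwise a missed index whose radius exceeds half the supremum of the missed radii could
    be added. Hence the factor 2.\<close>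
  define F where "F = {J. J \<subseteq> I \<and> disjoint_family_on B J \<and>
    (\<forall>i\<in>I. \<forall>j\<in>J. B i \<inter> B j \<noteq> {} \<longrightarrow> ok J i)}"
  have ok_mono: "ok J i \<Longrightarrow> J \<subseteq> J' \<Longrightarrow> ok J' i" for J J' i
    unfolding ok_def by blast
  have "\<exists>M\<in>F. \<forall>X\<in>F. M \<subseteq> X \<longrightarrow> X = M"
  proof (rule subset_Zorn')
    fix \<C> assume C: "subset.chain F \<C>"
    then have sub: "\<C> \<subseteq> F" and ch: "\<And>X Y. X \<in> \<C> \<Longrightarrow> Y \<in> \<C> \<Longrightarrow> X \<subseteq> Y \<or> Y \<subseteq> X"
      by (auto simp: subset.chain_def)
    have "B i \<inter> B j = {}" if ij: "i \<in> \<Union>\<C>" "j \<in> \<Union>\<C>" "i \<noteq> j" for i j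
    proof -
      from ij obtain X Y where "X \<in> \<C>" "Y \<in> \<C>" "i \<in> X" "j \<in> Y" by blast
      with ch obtain Z where "Z \<in> \<C>" "i \<in> Z" "j \<in> Z" by blast
      with sub ij(3) show ?thesis by (auto simp: F_def disjoint_family_on_def)
    qed
    moreover have "ok (\<Union>\<C>) i" if i: "i \<in> I" and j: "j \<in> \<Union>\<C>" and m: "B i \<inter> B j \<noteq> {}" for i j
    proof -
      from j obtain X where X: "X \<in> \<C>" "j \<in> X" by blast
      then have "ok X i" using sub i m by (auto simp: F_def)
      then show ?thesis using X ok_mono by blast
    qed
    moreover have "\<Union>\<C> \<subseteq> I" using sub unfolding F_def by blast
    ultimately show "\<Union>\<C> \<in> F"
      unfolding F_def disjoint_family_on_def by (simp only: mem_Collect_eq) blast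
  qed
  then obtain J where J: "J \<in> F" and max: "\<And>X. X \<in> F \<Longrightarrow> J \<subseteq> X \<Longrightarrow> X = J" by blast
  define I' where "I' = {i\<in>I. \<forall>j\<in>J. B i \<inter> B j = {}}"
  have "I' = {}"
  proof (rule ccontr)
    assume ne': "I' \<noteq> {}"
    have bdd': "bdd_above (r ` I')" using bdd by (auto simp: I'_def bdd_above_def)
    obtain i1 where i1: "i1 \<in> I'" using ne' by blast
    then have "r i1 \<le> Sup (r ` I')" using bdd' by (intro cSup_upper) auto
    then have "Sup (r ` I') / 2 < Sup (r ` I')" using pos[of i1] i1 by (auto simp: I'_def)
    then obtain i0 where i0: "i0 \<in> I'" "Sup (r ` I') / 2 < r i0"
      using less_cSupD[of "r ` I'" "Sup (r ` I') / 2"] ne' by auto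
    have le: "r i \<le> 2 * r i0" if "i \<in> I'" for i
      using cSup_upper[of "r i" "r ` I'"] that bdd' i0(2) by auto
    have "insert i0 J \<in> F"
    proof -
      have "insert i0 J \<subseteq> I" using i0 J by (auto simp: I'_def F_def)
      moreover have "disjoint_family_on B (insert i0 J)"
        using J i0 by (auto simp: F_def I'_def disjoint_family_on_def)
      moreover have "ok (insert i0 J) i" if i: "i \<in> I" "j \<in> insert i0 J" "B i \<inter> B j \<noteq> {}" for i j
      proof (cases "i \<in> I'")
        case True
        then have "B i \<inter> B i0 \<noteq> {}" using i by (auto simp: I'_def)
        then show ?thesis using le[OF True] by (auto simp: ok_def)
      next
        case False
        then have "ok J i" using i J by (auto simp: I'_def F_def)
        then show ?thesis using ok_mono by blast
      qed
      ultimately show ?thesis unfolding F_def by blast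
    qed
    then have "i0 \<in> J" using max by blast
    then show False using i0 ne[of i0] by (auto simp: I'_def)
  qed
  then have "ok J i" if "i \<in> I" for i
    using that J by (auto simp: I'_def F_def)
  then show ?thesis using J that[of J] by (auto simp: F_def ok_def)
qed

lemma emeasure_UN_le_nn_integral:
  assumes "countable J" "\<And>j. j \<in> J \<Longrightarrow> X j \<in> sets N"
  shows "emeasure N (\<Union>j\<in>J. X j) \<le> (\<integral>\<^sup>+j. emeasure N (X j) \<partial>count_space J)"
proof -
  have "emeasure N (\<Union>j\<in>J. X j) = (\<integral>\<^sup>+x. indicator (\<Union>j\<in>J. X j) x \<partial>N)"
    using assms by (subst nn_integral_indicator) auto
  also have "\<dots> \<le> (\<integral>\<^sup>+x. \<integral>\<^sup>+j. indicator (X j) x \<partial>count_space J \<partial>N)"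
  proof (rule nn_integral_mono)
    fix x
    show "indicator (\<Union>j\<in>J. X j) x \<le> (\<integral>\<^sup>+j. indicator (X j) x \<partial>count_space J)"
    proof (cases "x \<in> (\<Union>j\<in>J. X j)")
      case True
      then obtain j where j: "j \<in> J" "x \<in> X j" by blast
      have "(indicator (X j) x :: ennreal) * emeasure (count_space J) {j} \<le> (\<integral>\<^sup>+i. indicator (X i) x \<partial>count_space J)"
        using j by (subst nn_integral_cmult_indicator[symmetric])
          (auto intro!: nn_integral_mono simp: indicator_def)
      then show ?thesis using j True by simp
    qed simp
  qed
  also have "\<dots> = (\<integral>\<^sup>+j. \<integral>\<^sup>+x. indicator (X j) x \<partial>N \<partial>count_space J)"
    using assms by (intro nn_integral_count_space_nn_integral) auto
  also have "\<dots> = (\<integral>\<^sup>+j. emeasure N (X j) \<partial>count_space J)"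
    using assms by (intro nn_integral_cong) auto
  finally show ?thesis .
qed

text \<open>The Vitali selection runs over an arbitrary index set; countability, which subadditivity
  and additivity of measures need, comes from here. Finitely many of the disjoint sets have total
  measure at most that of \<open>V\<close>, so their positive measures are summable.\<close>

lemma countable_disjoint_positive:
  assumes disj: "disjoint_family_on X J" and meas: "\<And>j. j \<in> J \<Longrightarrow> X j \<in> sets N"
    and pos: "\<And>j. j \<in> J \<Longrightarrow> 0 < emeasure N (X j)"
    and V: "V \<in> sets N" "emeasure N V < \<infinity>" "\<And>j. j \<in> J \<Longrightarrow> X j \<subseteq> V"
  shows "countable J"
proof -
  have fin: "emeasure N (X j) < \<infinity>" if "j \<in> J" for j
    using V that by (meson emeasure_mono le_less_trans)
  have "(\<lambda>j. measure N (X j)) summable_on J"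
  proof (rule nonneg_bdd_above_summable_on)
    show "bdd_above (sum (\<lambda>j. measure N (X j)) ` {F. F \<subseteq> J \<and> finite F})"
    proof (rule bdd_aboveI2)
      fix F assume "F \<in> {F. F \<subseteq> J \<and> finite F}"
      then have F: "F \<subseteq> J" "finite F" by auto
      have "(\<Sum>j\<in>F. measure N (X j)) = measure N (\<Union>j\<in>F. X j)"
        using F disj meas fin
        by (intro measure_finite_Union[symmetric]) (auto simp: disjoint_family_on_def less_top subset_eq)
      also have "\<dots> \<le> measure N V"
        using F V meas by (intro measure_mono_fmeasurable) (auto simp: fmeasurable_def subset_eq)
      finally show "(\<Sum>j\<in>F. measure N (X j)) \<le> measure N V" .
    qed
  qed simp
  then have "countable {j\<in>J. measure N (X j) \<noteq> 0}" by (rule summable_countable_real)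
  moreover have "{j\<in>J. measure N (X j) \<noteq> 0} = J"
    using pos fin by (auto simp: measure_def enn2real_eq_0_iff less_top[symmetric]) (metis less_irrefl top.not_eq_extremum)+
  ultimately show ?thesis by simp
qed

text \<open>A point of the first ball is within \<open>4 * K\<^sub>0 * s\<close> of a common point,
  which is within \<open>s\<close> of \<open>y\<close>. The quasi-triangle inequality gives
  \<open>K\<^sub>0 * (s + 4 * K\<^sub>0 * s)\<close>, rounded to the dilation factor
  \<open>5 * K\<^sub>0\<^sup>2\<close> of all coverings below.\<close>

lemma (in quasi_metric) engulf:
  assumes "qball \<rho> x r \<inter> qball \<rho> y s \<noteq> {}" "r \<le> 2 * s"
  shows "qball \<rho> x r \<subseteq> qball \<rho> y (5 * K\<^sub>0\<^sup>2 * s)"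
proof
  fix u assume u: "u \<in> qball \<rho> x r"
  from assms obtain v where v: "\<rho> x v < r" "\<rho> y v < s" by (auto simp: qball_def)
  have K: "0 < K\<^sub>0" using K0_ge_1 by simp
  have "\<rho> v u \<le> K\<^sub>0 * (\<rho> v x + \<rho> x u)" by (rule quasi_triangle)
  also have "\<dots> < K\<^sub>0 * (4 * s)"
    using u v assms(2) sym[of v x] K by (intro mult_strict_left_mono) (auto simp: qball_def)
  finally have "\<rho> v u < K\<^sub>0 * (4 * s)" .
  moreover have "s \<le> K\<^sub>0 * s" using K0_ge_1 v nonneg[of y v] by (simp add: mult_le_cancel_right1)
  ultimately have "\<rho> y v + \<rho> v u < 5 * (K\<^sub>0 * s)" using v by linarith
  then have "K\<^sub>0 * (\<rho> y v + \<rho> v u) < K\<^sub>0 * (5 * (K\<^sub>0 * s))"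
    using K by (rule mult_strict_left_mono)
  with quasi_triangle[of y u v] have "\<rho> y u < K\<^sub>0 * (5 * (K\<^sub>0 * s))" by linarith
  then show "u \<in> qball \<rho> y (5 * K\<^sub>0\<^sup>2 * s)"
    by (simp add: qball_def power2_eq_square algebra_simps)
qed

lemma (in quasi_metric) centre_in_qball: "0 < r \<Longrightarrow> x \<in> qball \<rho> x r"
  using eq_0_iff[of x x] by (simp add: qball_def)

text \<open>Separated from the parabolic setting so that the same facts serve the base space, for
  its doubling constants, and the product with its parabolic quasi-metric, for the coverings.
  \<open>D\<close> is an arbitrary real number, hence the \<open>max 1 D\<close> in the iterated
  bound.\<close>

locale regular_doubling = quasi_metric \<rho> K\<^sub>0
  for \<rho> :: "'a \<Rightarrow> 'a \<Rightarrow> real" and K\<^sub>0 :: real +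
  fixes M :: "'a measure" and D :: real
  assumes space_UNIV: "space M = UNIV"
    and open_qball: "0 < r \<Longrightarrow> openin (qtopology \<rho>) (qball \<rho> x r)"
    and open_sets: "openin (qtopology \<rho>) U \<Longrightarrow> U \<in> sets M"
    and borel_regular: "\<exists>E\<in>qborel_sets \<rho>. A \<subseteq> E \<and> outer_measure_of M A = emeasure M E"
    and qball_pos: "0 < r \<Longrightarrow> 0 < emeasure M (qball \<rho> x r)"
    and qball_finite: "0 < r \<Longrightarrow> emeasure M (qball \<rho> x r) < \<infinity>"
    and doubling2: "0 < r \<Longrightarrow> emeasure M (qball \<rho> x (2 * r)) \<le> ennreal D * emeasure M (qball \<rho> x r)"
begin

lemma qball_sets [measurable]: "qball \<rho> x r \<in> sets M"
proof (cases "0 < r")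
  case True then show ?thesis using open_qball open_sets by blast
next
  case False
  then have "qball \<rho> x r = {}" using nonneg[of x] by (auto simp: qball_def) (meson le_less_trans not_less)
  then show ?thesis by simp
qed

lemma qball_mono: "r \<le> s \<Longrightarrow> qball \<rho> x r \<subseteq> qball \<rho> x s"
  by (auto simp: qball_def)

lemma doubling_power:
  "0 < r \<Longrightarrow> emeasure M (qball \<rho> x (2 ^ n * r)) \<le> ennreal (max 1 D ^ n) * emeasure M (qball \<rho> x r)"
proof (induction n)
  case (Suc n)
  have "emeasure M (qball \<rho> x (2 * (2 ^ n * r))) \<le> ennreal D * emeasure M (qball \<rho> x (2 ^ n * r))"
    using Suc by (intro doubling2) simp
  also have "\<dots> \<le> ennreal (max 1 D) * (ennreal (max 1 D ^ n) * emeasure M (qball \<rho> x r))"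
    using Suc by (intro mult_mono) (auto intro: ennreal_leI)
  also have "\<dots> = ennreal (max 1 D ^ Suc n) * emeasure M (qball \<rho> x r)"
    by (simp add: ennreal_mult mult.assoc)
  finally show ?case by (simp add: mult.assoc)
qed simp

lemma doubling_factor:
  obtains C where "1 \<le> C"
    "\<And>x r. 0 < r \<Longrightarrow> emeasure M (qball \<rho> x (A * r)) \<le> ennreal C * emeasure M (qball \<rho> x r)"
proof -
  obtain n where n: "A \<le> 2 ^ n" using real_arch_pow[of 2 A] by (auto intro: less_imp_le)
  show ?thesis
  proof (rule that[of "max 1 D ^ n"])
    show "1 \<le> max 1 D ^ n" by (rule one_le_power) simp
    fix x and r :: real assume r: "0 < r"
    have "emeasure M (qball \<rho> x (A * r)) \<le> emeasure M (qball \<rho> x (2 ^ n * r))"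
      using n r by (intro emeasure_mono qball_mono) auto
    also have "\<dots> \<le> ennreal (max 1 D ^ n) * emeasure M (qball \<rho> x r)"
      by (rule doubling_power[OF r])
    finally show "emeasure M (qball \<rho> x (A * r)) \<le> ennreal (max 1 D ^ n) * emeasure M (qball \<rho> x r)" .
  qed
qed

text \<open>The common covering step. The hypothesis compares a dilated ball on the left with an
  undilated one on the right; the dilated selected balls cover, while the undilated ones are
  disjoint, so the right sides add up without overlap. \<open>W\<close> is a level set in the
  good-lambda inequality and the whole space elsewhere.\<close>

lemma vitali_compare:
  fixes I :: "('a \<times> real) set"
  assumes I: "\<And>x r. (x, r) \<in> I \<Longrightarrow> 0 < r \<and> r \<le> R \<and> qball \<rho> x r \<subseteq> V"
    and V: "V \<in> sets M" "emeasure M V < \<infinity>" and W: "W \<in> sets M"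
    and sets_\<nu>: "sets \<nu> = sets M"
    and cmp: "\<And>x r. (x, r) \<in> I \<Longrightarrow>
      emeasure \<nu> (qball \<rho> x (5 * K\<^sub>0\<^sup>2 * r)) \<le> k * emeasure M (W \<inter> qball \<rho> x r)"
    and E: "E \<subseteq> (\<Union>(x, r)\<in>I. qball \<rho> x r)"
  shows "emeasure \<nu> E \<le> k * emeasure M (W \<inter> V)"
proof -
  let ?B = "\<lambda>i. qball \<rho> (fst i) (snd i)" and ?B' = "\<lambda>i. qball \<rho> (fst i) (5 * K\<^sub>0\<^sup>2 * snd i)"
  have "?B i \<noteq> {}" if "i \<in> I" for i
    using I[of "fst i" "snd i"] that centre_in_qball[of "snd i" "fst i"] by auto
  moreover have "0 < snd i" "snd i \<le> R" if "i \<in> I" for i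
    using I[of "fst i" "snd i"] that by auto
  ultimately obtain J where J: "J \<subseteq> I" "disjoint_family_on ?B J"
    and sel: "\<And>i. i \<in> I \<Longrightarrow> \<exists>j\<in>J. ?B i \<inter> ?B j \<noteq> {} \<and> snd i \<le> 2 * snd j"
    using vitali_selection[of I snd R ?B] by blast
  have JI: "0 < snd j" "?B j \<subseteq> V" if "j \<in> J" for j
    using I[of "fst j" "snd j"] J that by auto
  have cJ: "countable J"
    using J V JI qball_pos by (intro countable_disjoint_positive[OF J(2), of M V]) auto
  have disj: "disjoint_family_on (\<lambda>j. W \<inter> ?B j) J"
    using J(2) unfolding disjoint_family_on_def by blast
  have "E \<subseteq> (\<Union>j\<in>J. ?B' j)"
  proof
    fix x assume "x \<in> E"
    then obtain i where i: "i \<in> I" "x \<in> ?B i" using E by auto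
    then obtain j where "j \<in> J" "?B i \<inter> ?B j \<noteq> {}" "snd i \<le> 2 * snd j" using sel by blast
    then show "x \<in> (\<Union>j\<in>J. ?B' j)" using engulf i by blast
  qed
  then have "emeasure \<nu> E \<le> emeasure \<nu> (\<Union>j\<in>J. ?B' j)"
    using cJ sets_\<nu> by (intro emeasure_mono) auto
  also have "\<dots> \<le> (\<integral>\<^sup>+j. emeasure \<nu> (?B' j) \<partial>count_space J)"
    using cJ sets_\<nu> by (intro emeasure_UN_le_nn_integral) auto
  also have "\<dots> \<le> (\<integral>\<^sup>+j. k * emeasure M (W \<inter> ?B j) \<partial>count_space J)"
    using cmp J by (intro nn_integral_mono) auto
  also have "\<dots> = k * (\<integral>\<^sup>+j. emeasure M (W \<inter> ?B j) \<partial>count_space J)"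
    by (rule nn_integral_cmult) simp
  also have "(\<integral>\<^sup>+j. emeasure M (W \<inter> ?B j) \<partial>count_space J) = emeasure M (\<Union>j\<in>J. W \<inter> ?B j)"
    using disj W by (intro emeasure_UN_countable[symmetric] cJ) auto
  also have "k * \<dots> \<le> k * emeasure M (W \<inter> V)"
    using JI(2) W V by (intro mult_left_mono emeasure_mono) (blast | simp)+
  finally show ?thesis .
qed

lemma open_Union_qballs:
  assumes "\<And>x. x \<in> S \<Longrightarrow> 0 < f x"
  shows "openin (qtopology \<rho>) (\<Union>x\<in>S. qball \<rho> x (f x))"
  using assms open_qball by (intro openin_Union) auto

end

section \<open>Outer regularity and null sets\<close>

context regular_doubling
begin

text \<open>Induction over the Borel sigma-algebra: the sets squeezed between a closed and an open
  set with small difference inside \<open>V\<close> form a sigma-algebra containing the open sets.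
  The finite measure of \<open>V\<close> provides continuity from above, used for open sets and for
  countable unions.\<close>

lemma borel_sandwich:
  assumes "A \<in> qborel_sets \<rho>" "0 < e" "V \<in> sets M" "emeasure M V < \<infinity>"
  obtains F U where "openin (qtopology \<rho>) (- F)" "openin (qtopology \<rho>) U" "F \<subseteq> A" "A \<subseteq> U"
    "emeasure M ((U - F) \<inter> V) < ennreal e"
proof -
  let ?op = "openin (qtopology \<rho>)"
  let ?P = "\<lambda>A e. \<exists>F U. ?op (- F) \<and> ?op U \<and> F \<subseteq> A \<and> A \<subseteq> U \<and> emeasure M ((U - F) \<inter> V) < ennreal e"
  have op_empty: "?op {}" "?op UNIV" by (auto simp: openin_qtopology intro!: exI[of _ "1::real"])
  have closed_sets: "F \<in> sets M" if "?op (- F)" for F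
    using open_sets[OF that] sets.compl_sets[of "- F" M] by (simp add: space_UNIV Compl_eq_Diff_UNIV double_diff)
  have small: "\<exists>n::nat. emeasure M (S n \<inter> V) < e"
    if "\<And>n. S n \<in> sets M" "decseq S" "emeasure M ((\<Inter>n. S n) \<inter> V) < e" for S and e :: ennreal
  proof -
    have "emeasure M (S n \<inter> V) \<noteq> \<infinity>" for n
      using emeasure_mono[of "S n \<inter> V" V M] assms(3,4) by (auto simp: less_top[symmetric] top_unique)
    moreover have dec: "decseq (\<lambda>n. S n \<inter> V)"
      using that(2) unfolding decseq_def by blast
    ultimately have "(\<lambda>n. emeasure M (S n \<inter> V)) \<longlonglongrightarrow> emeasure M (\<Inter>n. S n \<inter> V)"
      using that(1) dec assms(3) by (intro Lim_emeasure_decseq) auto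
    then have "\<forall>\<^sub>F n in sequentially. emeasure M (S n \<inter> V) < e"
      using that(3) by (intro order_tendstoD(2)) auto
    then show ?thesis by (auto simp: eventually_sequentially)
  qed
  have "\<forall>e>0. ?P A e"
    using assms(1) unfolding qborel_sets_def
  proof (induction rule: sigma_sets.induct)
    case (Basic A)
    then have A: "?op A" by simp
    show ?case
    proof (intro allI impI)
      fix e :: real assume e: "0 < e"
      \<comment> \<open>An open set has to be exhausted by closed ones. \<open>G n\<close> is open
        because balls are, so its complement is closed, and \<open>A \<inter> G n\<close> decreases
        to the empty set because each point of \<open>A\<close> has a ball inside
        \<open>A\<close>.\<close>
      define G where "G n = (\<Union>y\<in>- A. qball \<rho> y (1 / real (Suc n)))" for n
      have G: "?op (G n)" for n unfolding G_def by (rule open_Union_qballs) simp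
      have dec: "decseq G"
        unfolding G_def decseq_def
        by (intro allI impI UN_mono subset_refl qball_mono divide_left_mono) auto
      have "(\<Inter>n. A \<inter> G n) = {}"
      proof (rule ccontr)
        assume "\<not> ?thesis"
        then obtain x where x: "x \<in> A" "\<And>n. x \<in> G n" by auto
        obtain r where r: "r > 0" "qball \<rho> x r \<subseteq> A" using A x openin_qtopology by metis
        obtain n where n: "1 / real (Suc n) < r" using reals_Archimedean[OF r(1)] by (auto simp: inverse_eq_divide)
        obtain y where "y \<notin> A" "\<rho> y x < 1 / real (Suc n)" using x(2)[of n] by (auto simp: G_def qball_def)
        then have "y \<in> qball \<rho> x r" using n sym[of x y] unfolding qball_def by simp
        then show False using r \<open>y \<notin> A\<close> by blast
      qed
      moreover have "decseq (\<lambda>n. A \<inter> G n)" using dec unfolding decseq_def by blast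
      ultimately obtain n where n: "emeasure M ((A \<inter> G n) \<inter> V) < ennreal e"
        using small[of "\<lambda>n. A \<inter> G n" "ennreal e"] G A open_sets e by auto
      have "x \<in> G n" if "x \<notin> A" for x
        using that centre_in_qball[of "1 / real (Suc n)" x] unfolding G_def by auto
      then have "- G n \<subseteq> A" by blast
      then show "?P A e"
        using A G[of n] n by (intro exI[of _ "- G n"] exI[of _ A]) (simp add: Diff_Compl)
    qed
  next
    case Empty
    show ?case using op_empty by (intro allI impI exI[of _ "{}"]) auto
  next
    case (Compl A)
    show ?case
    proof (intro allI impI)
      fix e :: real assume "0 < e"
      with Compl obtain F U where "?op (- F)" "?op U" "F \<subseteq> A" "A \<subseteq> U" "emeasure M ((U - F) \<inter> V) < e"
        by blast
      then show "?P (UNIV - A) e"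
        by (intro exI[of _ "- U"] exI[of _ "- F"]) (auto simp: Diff_Compl Int_commute Diff_eq)
    qed
  next
    case (Union A)
    show ?case
    proof (intro allI impI)
      fix e :: real assume e: "0 < e"
      \<comment> \<open>The errors add up to \<open>e / 2\<close>. This leaves room for a strict
        bound by \<open>e\<close> once the union of the closed sets is cut off at a finite stage, as
        it must be to remain closed.\<close>
      have "\<forall>n. ?P (A n) (e / 2 * (1 / 2) ^ Suc n)" using Union.IH e by simp
      then obtain F U where FU: "\<And>n. ?op (- F n)" "\<And>n. ?op (U n)" "\<And>n. F n \<subseteq> A n" "\<And>n. A n \<subseteq> U n"
        "\<And>n. emeasure M ((U n - F n) \<inter> V) < ennreal (e / 2 * (1 / 2) ^ Suc n)" by metis
      have meas: "F n \<in> sets M" "U n \<in> sets M" for n using FU closed_sets open_sets by blast+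
      define S where "S n = (\<Union>i. U i) - (\<Union>i\<le>n. F i)" for n
      have sub: "(\<Inter>n. S n) \<inter> V \<subseteq> (\<Union>i. (U i - F i) \<inter> V)"
      proof
        fix x assume x: "x \<in> (\<Inter>n. S n) \<inter> V"
        then obtain i where i: "x \<in> U i" by (auto simp: S_def)
        have "x \<in> S i" using x by blast
        then show "x \<in> (\<Union>i. (U i - F i) \<inter> V)" using i x by (auto simp: S_def)
      qed
      have "emeasure M ((\<Inter>n. S n) \<inter> V) \<le> emeasure M (\<Union>i. (U i - F i) \<inter> V)"
        using meas assms(3) sub by (intro emeasure_mono) auto
      also have "\<dots> \<le> (\<Sum>i. emeasure M ((U i - F i) \<inter> V))"
        using meas assms(3) by (intro emeasure_subadditive_countably) auto
      also have "\<dots> \<le> (\<Sum>i. ennreal (e / 2 * (1 / 2) ^ Suc i))"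
        by (intro suminf_le less_imp_le[OF FU(5)] summableI)
      also have "\<dots> = ennreal (e / 2)"
        using sums_mult[OF power_half_series, of "e / 2"] e
        by (intro suminf_ennreal_eq) auto
      also have "\<dots> < ennreal e" using e by (intro ennreal_lessI) auto
      finally have "emeasure M ((\<Inter>n. S n) \<inter> V) < ennreal e" .
      moreover have "S n \<in> sets M" for n using meas by (auto simp: S_def)
      moreover have "decseq S" unfolding S_def decseq_def by fastforce
      ultimately obtain n where n: "emeasure M (S n \<inter> V) < ennreal e"
        using small[of S "ennreal e"] by blast
      have "?op (- (\<Union>i\<le>n. F i))"
        using FU(1) op_empty by (auto simp: Compl_UN intro!: openin_INT2)
      moreover have "?op (\<Union>i. U i)" using FU(2) by (intro openin_Union) auto
      ultimately show "?P (\<Union>(range A)) e"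
        using n FU(3,4) unfolding S_def
        by (intro exI[of _ "\<Union>i\<le>n. F i"] exI[of _ "\<Union>i. U i"]) blast
    qed
  qed
  then show ?thesis using that assms(2) by blast
qed

text \<open>The sigma-algebra of \<open>M\<close> may be larger than the Borel one. Borel regularity
  replaces \<open>N\<close> by a Borel superset of the same measure, to which the sandwich
  applies.\<close>

lemma outer_regular:
  assumes N: "N \<in> sets M" "N \<subseteq> V" and V: "openin (qtopology \<rho>) V" "emeasure M V < \<infinity>" and e: "0 < e"
  obtains U where "openin (qtopology \<rho>) U" "N \<subseteq> U" "U \<subseteq> V" "emeasure M U \<le> emeasure M N + ennreal e"
proof -
  obtain E where E: "E \<in> qborel_sets \<rho>" "N \<subseteq> E" "outer_measure_of M N = emeasure M E"
    using borel_regular by blast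
  obtain F U where FU: "openin (qtopology \<rho>) (- F)" "openin (qtopology \<rho>) U" "F \<subseteq> E" "E \<subseteq> U"
    "emeasure M ((U - F) \<inter> V) < ennreal e"
    using borel_sandwich[OF E(1) e open_sets[OF V(1)] V(2)] by metis
  have E': "E \<in> sets M"
  proof -
    have "sigma_sets (space M) {U. openin (qtopology \<rho>) U} \<subseteq> sets M"
      using open_sets by (intro sets.sigma_sets_subset) auto
    then show ?thesis using E(1) by (auto simp: qborel_sets_def space_UNIV)
  qed
  have F': "F \<in> sets M"
    using open_sets[OF FU(1)] sets.compl_sets[of "- F" M] by (simp add: space_UNIV Compl_eq_Diff_UNIV double_diff)
  have "emeasure M (U \<inter> V) \<le> emeasure M (E \<union> ((U - F) \<inter> V))"
    using E' F' FU V open_sets by (intro emeasure_mono) auto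
  also have "\<dots> \<le> emeasure M E + emeasure M ((U - F) \<inter> V)"
    using E' F' FU V open_sets by (intro emeasure_subadditive) auto
  also have "\<dots> \<le> emeasure M N + ennreal e"
    using E(3) N FU(5) outer_measure_of_eq[OF N(1)] by (intro add_mono) auto
  finally show ?thesis
    using that[of "U \<inter> V"] FU E N V by (auto intro: openin_Int)
qed

text \<open>Replaces the Lebesgue differentiation theorem, at the price of the constant \<open>2 * C\<close>.\<close>

lemma null_if_averages_small:
  assumes N: "N \<in> sets M" "N \<subseteq> V" and V: "openin (qtopology \<rho>) V" "emeasure M V < \<infinity>"
    and w: "w \<in> borel_measurable M"
    and C: "1 \<le> C" "\<And>x r. 0 < r \<Longrightarrow> emeasure M (qball \<rho> x (5 * K\<^sub>0\<^sup>2 * r)) \<le> ennreal C * emeasure M (qball \<rho> x r)"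
    and R: "0 < R" and l: "0 < l"
    and avg: "\<And>x r. x \<in> N \<Longrightarrow> 0 < r \<Longrightarrow> r < R \<Longrightarrow>
      emeasure (density M w) (qball \<rho> x r) \<le> ennreal l * emeasure M (qball \<rho> x r)"
    and big: "\<And>x. x \<in> N \<Longrightarrow> ennreal (2 * C * l) \<le> w x"
  shows "emeasure M N = 0"
proof -
  let ?\<nu> = "density M w"
  have fin: "emeasure M N < \<infinity>" using emeasure_mono[OF N(2) open_sets[OF V(1)]] V(2) by (rule le_less_trans)
  have K: "0 < 5 * K\<^sub>0\<^sup>2" "1 \<le> 5 * K\<^sub>0\<^sup>2" using one_le_power[OF K0_ge_1, of 2] by auto
  have Cl: "0 < C * l" using C l by simp
  \<comment> \<open>A covering by balls inside an almost optimal open set \<open>U\<close> bounds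
    the mass of \<open>N\<close> by \<open>C * l\<close> times the measure of \<open>U\<close>,
    while \<open>w\<close> is at least \<open>2 * C * l\<close> on \<open>N\<close>. After division
    by \<open>C * l\<close> the factor 2 forces measure zero as \<open>e\<close> tends to 0.\<close>
  have main: "2 * emeasure M N \<le> emeasure M N + ennreal e" if e: "0 < e" for e
  proof -
    obtain U where U: "openin (qtopology \<rho>) U" "N \<subseteq> U" "U \<subseteq> V" "emeasure M U \<le> emeasure M N + ennreal e"
      using outer_regular[OF N V e] by blast
    \<comment> \<open>The dilated radius has to stay below \<open>R\<close>, since it is the dilated
      ball whose average is estimated.\<close>
    define I where "I = {(x, r). x \<in> N \<and> 0 < r \<and> 5 * K\<^sub>0\<^sup>2 * r < R \<and> qball \<rho> x r \<subseteq> U}"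
    have "emeasure ?\<nu> N \<le> ennreal (C * l) * emeasure M (UNIV \<inter> U)"
    proof (rule vitali_compare)
      fix x r assume "(x, r) \<in> I"
      then have xr: "x \<in> N" "0 < r" "5 * K\<^sub>0\<^sup>2 * r < R" "qball \<rho> x r \<subseteq> U" by (auto simp: I_def)
      have "1 * r \<le> 5 * K\<^sub>0\<^sup>2 * r" using K xr by (intro mult_right_mono) auto
      then have "r \<le> R" using xr by linarith
      then show "0 < r \<and> r \<le> R \<and> qball \<rho> x r \<subseteq> U" using xr by blast
      have "emeasure ?\<nu> (qball \<rho> x (5 * K\<^sub>0\<^sup>2 * r)) \<le> ennreal l * emeasure M (qball \<rho> x (5 * K\<^sub>0\<^sup>2 * r))"
        using xr K by (intro avg) auto
      also have "\<dots> \<le> ennreal l * (ennreal C * emeasure M (qball \<rho> x r))"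
        using C xr by (intro mult_left_mono) auto
      also have "\<dots> = ennreal (C * l) * emeasure M (UNIV \<inter> qball \<rho> x r)"
        using C l by (simp add: ennreal_mult ac_simps)
      finally show "emeasure ?\<nu> (qball \<rho> x (5 * K\<^sub>0\<^sup>2 * r)) \<le> ennreal (C * l) * emeasure M (UNIV \<inter> qball \<rho> x r)" .
    next
      show "U \<in> sets M" using U open_sets by blast
      show "emeasure M U < \<infinity>" using U(4) fin by (auto simp: ennreal_add_less_top intro: le_less_trans)
      show "UNIV \<in> sets M" using sets.top[of M] space_UNIV by simp
      show "N \<subseteq> (\<Union>(x, r)\<in>I. qball \<rho> x r)"
      proof
        fix x assume x: "x \<in> N"
        obtain r where r: "0 < r" "qball \<rho> x r \<subseteq> U" using U x openin_qtopology by (metis subsetD)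
        define s where "s = min r (R / (10 * K\<^sub>0\<^sup>2))"
        have "0 < s" "s \<le> r" using r R K by (auto simp: s_def)
        moreover have "5 * K\<^sub>0\<^sup>2 * s < R"
        proof -
          have "5 * K\<^sub>0\<^sup>2 * s \<le> 5 * K\<^sub>0\<^sup>2 * (R / (10 * K\<^sub>0\<^sup>2))"
            using K unfolding s_def by (intro mult_left_mono) auto
          also have "\<dots> < R" using K R by (simp add: field_simps)
          finally show ?thesis .
        qed
        ultimately have "(x, s) \<in> I" using x r qball_mono[of s r x] by (auto simp: I_def)
        then show "x \<in> (\<Union>(x, r)\<in>I. qball \<rho> x r)" using centre_in_qball[of s x] \<open>0 < s\<close> by blast
      qed
    qed simp
    moreover have "ennreal (2 * C * l) * emeasure M N \<le> emeasure ?\<nu> N"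
    proof -
      have "ennreal (2 * C * l) * emeasure M N = (\<integral>\<^sup>+x. ennreal (2 * C * l) * indicator N x \<partial>M)"
        using N by (simp add: nn_integral_cmult_indicator)
      also have "\<dots> \<le> (\<integral>\<^sup>+x. w x * indicator N x \<partial>M)"
        using big by (intro nn_integral_mono) (auto simp: indicator_def)
      also have "\<dots> = emeasure ?\<nu> N" using N w by (simp add: emeasure_density)
      finally show ?thesis .
    qed
    ultimately have "ennreal (2 * C * l) * emeasure M N \<le> ennreal (C * l) * emeasure M U"
      by simp
    also have "\<dots> \<le> ennreal (C * l) * (emeasure M N + ennreal e)"
      using U(4) by (rule mult_left_mono) simp
    finally have "ennreal (2 * C * l) * emeasure M N \<le> ennreal (C * l) * (emeasure M N + ennreal e)" .
    moreover have "ennreal (2 * C * l) = ennreal (C * l) * 2"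
      using ennreal_mult[of "C * l" 2] Cl by (simp add: mult_ac)
    ultimately have "ennreal (C * l) * (2 * emeasure M N) \<le> ennreal (C * l) * (emeasure M N + ennreal e)"
      by (simp add: mult.assoc)
    moreover have "ennreal (C * l) \<noteq> 0" "ennreal (C * l) \<noteq> top" using Cl by auto
    ultimately show ?thesis by (simp only: ennreal_mult_le_mult_iff simp_thms)
  qed
  obtain m where m: "emeasure M N = ennreal m" "0 \<le> m" using fin by (cases "emeasure M N") auto
  have "m \<le> 0 + e" if "0 < e" for e
  proof -
    have "ennreal (2 * m) = 2 * ennreal m" using ennreal_mult[of 2 m] m by simp
    also have "\<dots> \<le> ennreal (m + e)" using main[OF that] m that by simp
    finally have "2 * m \<le> m + e" using m that by (subst (asm) ennreal_le_iff) auto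
    then show ?thesis by simp
  qed
  then have "m \<le> 0" by (rule field_le_epsilon)
  then show ?thesis using m by simp
qed

end

section \<open>The good-lambda inequality\<close>

text \<open>Iterating \<open>n\<close> times leaves partial sums of \<open>P * (t * q) ^ i\<close>
  and the remainder \<open>t ^ n * f n\<close>. The sums are at most \<open>2 * P\<close>; the
  uniform bound \<open>B\<close> sends the remainder to 0 and leaves no trace in the
  conclusion.\<close>

lemma geometric_absorption:
  fixes f :: "nat \<Rightarrow> real"
  assumes step: "\<And>i. f i \<le> P * q ^ i + t * f (Suc i)" and bdd: "\<And>i. f i \<le> B"
    and "1 \<le> q" "0 \<le> t" "t * q \<le> 1 / 2" "0 \<le> P" "0 \<le> B"
  shows "f 0 \<le> 2 * P"
proof -
  have t: "t \<le> 1 / 2" using assms mult_left_mono[of 1 q t] by simp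
  have "f 0 \<le> 2 * P * (1 - (1 / 2) ^ n) + t ^ n * f n" for n
  proof (induction n)
    case (Suc n)
    have "t ^ n * f n \<le> t ^ n * (P * q ^ n + t * f (Suc n))"
      using step assms by (intro mult_left_mono) auto
    also have "\<dots> = P * (t * q) ^ n + t ^ Suc n * f (Suc n)"
      by (simp add: algebra_simps power_mult_distrib)
    also have "P * (t * q) ^ n \<le> P * (1 / 2) ^ n"
      using assms by (intro mult_left_mono power_mono) auto
    finally have "t ^ n * f n \<le> P * (1 / 2) ^ n + t ^ Suc n * f (Suc n)" by simp
    then show ?case using Suc by (simp add: algebra_simps)
  qed simp
  moreover have "t ^ n * f n \<le> (1 / 2) ^ n * B" for n
  proof -
    have "t ^ n * f n \<le> t ^ n * B" using bdd assms by (intro mult_left_mono) auto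
    also have "\<dots> \<le> (1 / 2) ^ n * B" using t assms by (intro mult_right_mono power_mono) auto
    finally show ?thesis .
  qed
  ultimately have "f 0 \<le> 2 * P * (1 - (1 / 2) ^ n) + (1 / 2) ^ n * B" for n
    by (meson add_left_mono order.trans)
  moreover have "(\<lambda>n. 2 * P * (1 - (1 / 2) ^ n) + (1 / 2) ^ n * B) \<longlonglongrightarrow> 2 * P * (1 - 0) + 0 * B"
    by (intro tendsto_intros LIMSEQ_power_zero) auto
  ultimately show ?thesis by (intro LIMSEQ_le_const) auto
qed

text \<open>Integration against \<open>\<kappa> * s powr (\<kappa> - 1)\<close> over
  \<open>{s0..N}\<close> yields the power \<open>\<kappa>\<close> of the truncated weight on the
  left. On the right the extra factor \<open>s\<close> from the hypothesis means that
  \<open>\<kappa>\<close> is not cancelled, so the coefficient of the last integral becomes small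
  with \<open>\<kappa>\<close>. The cut at \<open>N\<close> makes the later absorption
  legitimate.\<close>

lemma (in sigma_finite_measure) layer_cake_step:
  fixes w :: "'a \<Rightarrow> real"
  assumes w[measurable]: "w \<in> borel_measurable M" and w0: "\<And>x. 0 \<le> w x"
    and G[measurable]: "G \<in> sets M" "G' \<in> sets M"
    and pos: "0 < s0" "0 < a" "0 < b" "b \<le> 1" "0 < \<kappa>" "\<kappa> \<le> 1" "0 < N"
    and step: "\<And>s. s0 \<le> s \<Longrightarrow>
      emeasure (density M w) ({x\<in>space M. s \<le> w x} \<inter> G) \<le> ennreal (a * s) * emeasure M ({x\<in>space M. b * s < w x} \<inter> G')"
  shows "(\<integral>\<^sup>+x\<in>G. ennreal (w x * min (w x) N powr \<kappa>) \<partial>M) \<le>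
    ennreal (s0 powr \<kappa>) * emeasure (density M w) G +
    ennreal (\<kappa> * a / b\<^sup>2) * (\<integral>\<^sup>+x\<in>G'. ennreal (w x * min (w x) N powr \<kappa>) \<partial>M)"
proof -
  interpret pair_sigma_finite lborel M
    by (simp add: pair_sigma_finite_def lborel.sigma_finite_measure_axioms sigma_finite_measure_axioms)
  let ?k = "\<lambda>s. ennreal (\<kappa> * s powr (\<kappa> - 1)) * indicator {s0..N} s"
  have low: "ennreal (w x * min (w x) N powr \<kappa>) \<le>
      ennreal (s0 powr \<kappa>) * ennreal (w x) + (\<integral>\<^sup>+s. ?k s * (ennreal (w x) * indicator {x\<in>space M. s \<le> w x} x) \<partial>lborel)"
    if x: "x \<in> space M" for x
  proof (cases "min (w x) N \<le> s0")
    case True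
    then have "min (w x) N powr \<kappa> \<le> s0 powr \<kappa>" using w0[of x] pos by (intro powr_mono2) auto
    then have "ennreal (w x * min (w x) N powr \<kappa>) \<le> ennreal (s0 powr \<kappa>) * ennreal (w x)"
      using w0[of x] by (subst ennreal_mult[symmetric]) (auto intro!: ennreal_leI mult_mono simp: mult.commute)
    then show ?thesis by (rule order.trans) simp
  next
    case False
    define u where "u = min (w x) N"
    have u: "s0 < u" using False unfolding u_def by linarith
    have "ennreal (u powr \<kappa> - s0 powr \<kappa>) = (\<integral>\<^sup>+s. ennreal (\<kappa> * s powr (\<kappa> - 1)) * indicator {s0..u} s \<partial>lborel)"
      using pos u
      by (intro nn_integral_FTC_Icc[symmetric]) (auto intro!: derivative_eq_intros simp: has_real_derivative_iff_has_vector_derivative[symmetric])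
    also have "\<dots> \<le> (\<integral>\<^sup>+s. ?k s * indicator {x\<in>space M. s \<le> w x} x \<partial>lborel)"
      using x by (intro nn_integral_mono) (auto simp: u_def indicator_def)
    finally have "ennreal (w x) * ennreal (u powr \<kappa> - s0 powr \<kappa>) \<le> ennreal (w x) * \<dots>"
      by (rule mult_left_mono) simp
    also have "\<dots> = (\<integral>\<^sup>+s. ?k s * (ennreal (w x) * indicator {x\<in>space M. s \<le> w x} x) \<partial>lborel)"
      using x by (subst nn_integral_cmult[symmetric]) (auto intro!: nn_integral_cong simp: ac_simps)
    finally have *: "ennreal (w x) * ennreal (u powr \<kappa> - s0 powr \<kappa>) \<le> \<dots>" .
    have "s0 powr \<kappa> \<le> u powr \<kappa>" using u pos by (intro powr_mono2) auto
    then have "ennreal (s0 powr \<kappa> * w x + w x * (u powr \<kappa> - s0 powr \<kappa>)) =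
        ennreal (s0 powr \<kappa>) * ennreal (w x) + ennreal (w x) * ennreal (u powr \<kappa> - s0 powr \<kappa>)"
      using w0[of x] by (subst ennreal_plus) (auto simp: ennreal_mult)
    moreover have "s0 powr \<kappa> * w x + w x * (u powr \<kappa> - s0 powr \<kappa>) = w x * u powr \<kappa>"
      by (simp add: algebra_simps)
    ultimately have "ennreal (w x * u powr \<kappa>) =
        ennreal (s0 powr \<kappa>) * ennreal (w x) + ennreal (w x) * ennreal (u powr \<kappa> - s0 powr \<kappa>)" by simp
    with * show ?thesis by (simp add: u_def add_left_mono)
  qed
  have high: "(\<integral>\<^sup>+s. ?k s * (ennreal (a * s) * indicator {x\<in>space M. b * s < w x} x) \<partial>lborel)
      \<le> ennreal (\<kappa> * a / b\<^sup>2) * ennreal (w x * min (w x) N powr \<kappa>)" for x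
  proof -
    \<comment> \<open>The integrand lives on \<open>{0..T}\<close> and is at most
      \<open>\<kappa> * a * T powr \<kappa>\<close> there. \<open>T\<close> is bounded by
      \<open>w x / b\<close> and, because \<open>b <= 1\<close>, also by
      \<open>min (w x) N / b\<close>; one bound goes into each factor of
      \<open>T powr \<kappa> * T\<close>. With \<open>b powr \<kappa> >= b\<close> this produces
      \<open>b\<^sup>2\<close>.\<close>
    define T where "T = min N (w x / b)"
    have T': "0 \<le> T" "T \<le> w x / b" "T \<le> N"
      using pos w0[of x] by (auto simp: T_def)
    moreover have "T * b \<le> N * 1" using T' pos by (intro mult_mono) auto
    ultimately have T: "0 \<le> T" "T \<le> w x / b" "T \<le> min (w x) N / b"
      using pos by (auto simp: pos_le_divide_eq)
    have "(\<integral>\<^sup>+s. ?k s * (ennreal (a * s) * indicator {x\<in>space M. b * s < w x} x) \<partial>lborel)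
        \<le> (\<integral>\<^sup>+s. ennreal (\<kappa> * a * T powr \<kappa>) * indicator {0..T} s \<partial>lborel)"
    proof (rule nn_integral_mono)
      fix s
      show "?k s * (ennreal (a * s) * indicator {x\<in>space M. b * s < w x} x) \<le> ennreal (\<kappa> * a * T powr \<kappa>) * indicator {0..T} s"
      proof (cases "s0 \<le> s \<and> s \<le> N \<and> b * s < w x")
        case True
        then have s: "0 < s" "s \<le> T" using pos by (auto simp: T_def field_simps)
        have "?k s * (ennreal (a * s) * indicator {x\<in>space M. b * s < w x} x) \<le> ennreal (\<kappa> * s powr (\<kappa> - 1)) * ennreal (a * s)"
          by (auto simp: indicator_def)
        also have "\<dots> = ennreal (\<kappa> * a * s powr \<kappa>)"
          using pos s by (simp add: ennreal_mult[symmetric] powr_diff)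
        also have "\<dots> \<le> ennreal (\<kappa> * a * T powr \<kappa>)"
          using pos s by (intro ennreal_leI mult_left_mono powr_mono2) auto
        finally show ?thesis using s by simp
      qed (auto simp: indicator_def)
    qed
    also have "\<dots> = ennreal (\<kappa> * a * T powr \<kappa> * T)"
      using T pos by (simp add: nn_integral_cmult_indicator ennreal_mult)
    also have "\<dots> \<le> ennreal (\<kappa> * a / b\<^sup>2 * (w x * min (w x) N powr \<kappa>))"
    proof (rule ennreal_leI)
      have "T powr \<kappa> \<le> (min (w x) N / b) powr \<kappa>" using T pos by (intro powr_mono2) auto
      also have "\<dots> = min (w x) N powr \<kappa> / b powr \<kappa>" using w0[of x] pos by (intro powr_divide) 
      also have "\<dots> \<le> min (w x) N powr \<kappa> / b"
        using pos powr_mono'[of \<kappa> 1 b] by (intro divide_left_mono) auto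
      finally have "T powr \<kappa> * T \<le> (min (w x) N powr \<kappa> / b) * (w x / b)"
        using T pos by (intro mult_mono) auto
      then have "\<kappa> * a * (T powr \<kappa> * T) \<le> \<kappa> * a * ((min (w x) N powr \<kappa> / b) * (w x / b))"
        using pos by (intro mult_left_mono) auto
      then show "\<kappa> * a * T powr \<kappa> * T \<le> \<kappa> * a / b\<^sup>2 * (w x * min (w x) N powr \<kappa>)"
        by (simp add: power2_eq_square mult_ac)
    qed
    also have "\<dots> = ennreal (\<kappa> * a / b\<^sup>2) * ennreal (w x * min (w x) N powr \<kappa>)"
      using pos w0 by (intro ennreal_mult) auto
    finally show ?thesis .
  qed
  have "(\<integral>\<^sup>+x\<in>G. ennreal (w x * min (w x) N powr \<kappa>) \<partial>M) \<le>
    (\<integral>\<^sup>+x. ennreal (s0 powr \<kappa>) * (ennreal (w x) * indicator G x) +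
      (\<integral>\<^sup>+s. ?k s * (ennreal (w x) * indicator ({x\<in>space M. s \<le> w x} \<inter> G) x) \<partial>lborel) \<partial>M)"
    using low by (intro nn_integral_mono) (auto simp: indicator_def)
  also have "\<dots> = ennreal (s0 powr \<kappa>) * emeasure (density M w) G +
     (\<integral>\<^sup>+x. \<integral>\<^sup>+s. ?k s * (ennreal (w x) * indicator ({x\<in>space M. s \<le> w x} \<inter> G) x) \<partial>lborel \<partial>M)"
    by (subst nn_integral_add) (auto simp: nn_integral_cmult emeasure_density)
  also have "(\<integral>\<^sup>+x. \<integral>\<^sup>+s. ?k s * (ennreal (w x) * indicator ({x\<in>space M. s \<le> w x} \<inter> G) x) \<partial>lborel \<partial>M) =
     (\<integral>\<^sup>+s. \<integral>\<^sup>+x. ?k s * (ennreal (w x) * indicator ({x\<in>space M. s \<le> w x} \<inter> G) x) \<partial>M \<partial>lborel)"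
    by (rule Fubini') measurable
  also have "\<dots> = (\<integral>\<^sup>+s. ?k s * emeasure (density M w) ({x\<in>space M. s \<le> w x} \<inter> G) \<partial>lborel)"
    by (intro nn_integral_cong) (simp add: nn_integral_cmult emeasure_density)
  also have "\<dots> \<le> (\<integral>\<^sup>+s. ?k s * (ennreal (a * s) * emeasure M ({x\<in>space M. b * s < w x} \<inter> G')) \<partial>lborel)"
    using step by (intro nn_integral_mono) (auto simp: indicator_def intro!: mult_left_mono)
  also have "\<dots> = (\<integral>\<^sup>+s. \<integral>\<^sup>+x. ?k s * (ennreal (a * s) * indicator ({x\<in>space M. b * s < w x} \<inter> G') x) \<partial>M \<partial>lborel)"
    by (intro nn_integral_cong) (simp add: nn_integral_cmult)
  also have "\<dots> = (\<integral>\<^sup>+x. \<integral>\<^sup>+s. ?k s * (ennreal (a * s) * indicator ({x\<in>space M. b * s < w x} \<inter> G') x) \<partial>lborel \<partial>M)"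
    by (rule Fubini'[symmetric]) measurable
  also have "\<dots> \<le> (\<integral>\<^sup>+x. ennreal (\<kappa> * a / b\<^sup>2) * (ennreal (w x * min (w x) N powr \<kappa>) * indicator G' x) \<partial>M)"
  proof (rule nn_integral_mono)
    fix x
    show "(\<integral>\<^sup>+s. ?k s * (ennreal (a * s) * indicator ({x\<in>space M. b * s < w x} \<inter> G') x) \<partial>lborel)
      \<le> ennreal (\<kappa> * a / b\<^sup>2) * (ennreal (w x * min (w x) N powr \<kappa>) * indicator G' x)"
      using high[of x] by (cases "x \<in> G'") (simp_all add: indicator_inter_arith)
  qed
  also have "\<dots> = ennreal (\<kappa> * a / b\<^sup>2) * (\<integral>\<^sup>+x\<in>G'. ennreal (w x * min (w x) N powr \<kappa>) \<partial>M)"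
    by (simp add: nn_integral_cmult)
  finally show ?thesis by (simp add: add_left_mono)
qed

context regular_doubling
begin

text \<open>A point of \<open>G\<close> with \<open>w >= 2 * C * l\<close> either sees only averages
  at most \<open>l\<close> on small balls, which happens on a null set, or has an almost maximal
  radius \<open>s < r0\<close> with average above \<open>l\<close>. At \<open>s\<close> the density
  hypothesis applies, at the dilated radius the average is again at most \<open>l\<close>; together
  these are the per-ball inequality of the covering lemma.\<close>

lemma good_lambda:
  fixes w :: "'a \<Rightarrow> real"
  assumes w[measurable]: "w \<in> borel_measurable M" and pos: "1 \<le> \<Lambda>" "0 < c" "0 < l" "0 < r0"
    and star: "\<And>x r. 0 < r \<Longrightarrow>
      ennreal l * emeasure M (qball \<rho> x r) < emeasure (density M w) (qball \<rho> x r) \<Longrightarrow>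
      ennreal c * emeasure M (qball \<rho> x r) \<le> emeasure M ({y. b * l < w y} \<inter> qball \<rho> x (\<Lambda> * r))"
    and C: "1 \<le> C" "\<And>x r. 0 < r \<Longrightarrow> emeasure M (qball \<rho> x (5 * K\<^sub>0\<^sup>2 * r)) \<le> ennreal C * emeasure M (qball \<rho> x r)"
    and C': "1 \<le> C'" "\<And>x r. 0 < r \<Longrightarrow> emeasure M (qball \<rho> x (5 * K\<^sub>0\<^sup>2 * \<Lambda> * r)) \<le> ennreal C' * emeasure M (qball \<rho> x r)"
    and G: "G \<in> sets M"
    and G': "openin (qtopology \<rho>) G'" "emeasure M G' < \<infinity>" "\<And>x. x \<in> G \<Longrightarrow> qball \<rho> x (\<Lambda> * r0) \<subseteq> G'"
    and avg: "\<And>x r. x \<in> G \<Longrightarrow> r0 \<le> r \<Longrightarrow> r \<le> 5 * K\<^sub>0\<^sup>2 * \<Lambda> * r0 \<Longrightarrow>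
      emeasure (density M w) (qball \<rho> x r) \<le> ennreal l * emeasure M (qball \<rho> x r)"
  shows "emeasure (density M w) ({y. 2 * C * l \<le> w y} \<inter> G) \<le> ennreal (C' / c * l) * emeasure M ({y. b * l < w y} \<inter> G')"
proof -
  let ?\<nu> = "density M w" and ?t = "5 * K\<^sub>0\<^sup>2 * \<Lambda>"
  have "1 \<le> K\<^sub>0\<^sup>2" using one_le_power[OF K0_ge_1, of 2] by auto
  \<comment> \<open>This 2 matches the factor in \<open>J\<close>: the dilated radius
    \<open>?t * s\<close> is at least \<open>2 * s\<close>, from where on averages are at most
    \<open>l\<close>, and it stays below \<open>?t * r0\<close>, where the information ends.\<close>
  then have t: "2 \<le> ?t" using mult_mono[of 1 "K\<^sub>0\<^sup>2" 1 \<Lambda>] pos by auto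
  have [measurable]: "{y. a < w y} \<in> sets M" "{y. a \<le> w y} \<in> sets M" for a
    using measurable_sets[OF w, of "{a<..}"] measurable_sets[OF w, of "{a..}"]
    by (simp_all add: space_UNIV vimage_def)
  define J where "J = {(x, s). x \<in> G \<and> 0 < s \<and> s < r0 \<and>
    ennreal l * emeasure M (qball \<rho> x s) < emeasure ?\<nu> (qball \<rho> x s) \<and>
    (\<forall>s'. 2 * s \<le> s' \<and> s' \<le> ?t * r0 \<longrightarrow> emeasure ?\<nu> (qball \<rho> x s') \<le> ennreal l * emeasure M (qball \<rho> x s'))}"
  \<comment> \<open>The covering uses the radii \<open>\<Lambda> * s\<close>, because a substantial
    part of \<open>{y. b * l < w y}\<close> is known to lie only in that larger ball.\<close>
  define I where "I = (\<lambda>(x, s). (x, \<Lambda> * s)) ` J"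
  define U where "U = (\<Union>(x, r)\<in>I. qball \<rho> x r)"
  have U: "emeasure ?\<nu> U \<le> ennreal (C' / c * l) * emeasure M ({y. b * l < w y} \<inter> G')"
  proof (rule vitali_compare)
    fix x r assume "(x, r) \<in> I"
    then obtain s where "(x, s) \<in> J" and r: "r = \<Lambda> * s" by (auto simp: I_def)
    then have s: "x \<in> G" "0 < s" "s < r0" "ennreal l * emeasure M (qball \<rho> x s) < emeasure ?\<nu> (qball \<rho> x s)"
      "\<And>s'. 2 * s \<le> s' \<Longrightarrow> s' \<le> ?t * r0 \<Longrightarrow> emeasure ?\<nu> (qball \<rho> x s') \<le> ennreal l * emeasure M (qball \<rho> x s')"
      by (auto simp: J_def)
    have "\<Lambda> * s \<le> \<Lambda> * r0" using s pos by (intro mult_left_mono) auto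
    then show "0 < r \<and> r \<le> \<Lambda> * r0 \<and> qball \<rho> x r \<subseteq> G'"
      using s pos G'(3)[of x] qball_mono[of r "\<Lambda> * r0" x] by (auto simp: r)
    have "emeasure ?\<nu> (qball \<rho> x (?t * s)) \<le> ennreal l * emeasure M (qball \<rho> x (?t * s))"
      using s t pos by (intro s(5) mult_right_mono mult_left_mono) auto
    also have "\<dots> \<le> ennreal l * (ennreal C' * emeasure M (qball \<rho> x s))"
      using C' s by (intro mult_left_mono) auto
    also have "\<dots> = ennreal (C' / c * l) * (ennreal c * emeasure M (qball \<rho> x s))"
      unfolding mult.assoc[symmetric] using C' pos by (simp add: ennreal_mult[symmetric] mult.commute[of l])
    also have "\<dots> \<le> ennreal (C' / c * l) * emeasure M ({y. b * l < w y} \<inter> qball \<rho> x r)"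
      unfolding r using s star[of s x] by (intro mult_left_mono) auto
    finally show "emeasure ?\<nu> (qball \<rho> x (5 * K\<^sub>0\<^sup>2 * r)) \<le> \<dots>" by (simp add: r mult.assoc)
  next
    show "G' \<in> sets M" using G' open_sets by blast
  qed (use G' in \<open>auto simp: U_def\<close>)
  have U_sets[measurable]: "U \<in> sets M"
    unfolding U_def I_def J_def using open_qball pos
    by (intro open_sets openin_Union) auto
  define N where "N = ({y. 2 * C * l \<le> w y} \<inter> G) - U"
  have N_sets[measurable]: "N \<in> sets M" using G by (simp add: N_def)
  have "emeasure M N = 0"
  proof (rule null_if_averages_small[where V = G' and R = r0 and l = l and C = C and w = w])
    show "N \<subseteq> G'" using G'(3) pos centre_in_qball[of "\<Lambda> * r0"] by (auto simp: N_def)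
  next
    fix x r assume x: "x \<in> N" and r: "0 < r" "r < r0"
    show "emeasure ?\<nu> (qball \<rho> x r) \<le> ennreal l * emeasure M (qball \<rho> x r)"
    proof (rule ccontr)
      assume "\<not> ?thesis"
      then have bad: "ennreal l * emeasure M (qball \<rho> x r) < emeasure ?\<nu> (qball \<rho> x r)" by simp
      define S where "S = {s. 0 < s \<and> s < r0 \<and> ennreal l * emeasure M (qball \<rho> x s) < emeasure ?\<nu> (qball \<rho> x s)}"
      have S: "r \<in> S" "bdd_above S" using bad r by (auto simp: S_def bdd_above_def intro!: exI[of _ r0])
      have "r \<le> Sup S" using S by (rule cSup_upper)
      then have "Sup S / 2 < Sup S" using r by simp
      then obtain s where s: "s \<in> S" "Sup S / 2 < s" using less_cSupD[of S "Sup S / 2"] S by auto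
      have xG: "x \<in> G" using x by (simp add: N_def)
      have "emeasure ?\<nu> (qball \<rho> x s') \<le> ennreal l * emeasure M (qball \<rho> x s')"
        if s': "2 * s \<le> s'" "s' \<le> ?t * r0" for s'
      proof (cases "s' < r0")
        case True
        have "s' \<notin> S" using cSup_upper[OF _ S(2), of s'] s s' by auto
        then show ?thesis using True s s' by (auto simp: S_def not_less)
      next
        case False
        then show ?thesis using avg[OF xG] s' by simp
      qed
      then have "(x, s) \<in> J" using xG s by (auto simp: J_def S_def)
      then have "x \<in> U" using centre_in_qball[of "\<Lambda> * s" x] s pos by (force simp: U_def I_def S_def)
      then show False using x by (simp add: N_def)
    qed
  next
    fix x assume "x \<in> N"
    then show "ennreal (2 * C * l) \<le> ennreal (w x)" by (auto simp: N_def intro: ennreal_leI)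
  qed (use C G' pos in auto)
  then have "N \<in> null_sets M" using N_sets by auto
  then have "N \<in> null_sets ?\<nu>"
    using absolutely_continuousI_density[of "\<lambda>x. ennreal (w x)" M] by (auto simp: absolutely_continuous_def)
  then have "emeasure ?\<nu> N = 0" by auto
  have "emeasure ?\<nu> ({y. 2 * C * l \<le> w y} \<inter> G) \<le> emeasure ?\<nu> (U \<union> N)"
    using G by (intro emeasure_mono) (auto simp: N_def)
  also have "\<dots> \<le> emeasure ?\<nu> U + emeasure ?\<nu> N" by (intro emeasure_subadditive) auto
  finally show ?thesis using U \<open>emeasure ?\<nu> N = 0\<close> by simp
qed

end

section \<open>Self-improvement of integrability\<close>

context regular_doubling
begin

lemma sigma_finite: "sigma_finite_measure M"
proof
  fix x :: 'a
  have "\<exists>n. y \<in> qball \<rho> x (real (Suc n))" for y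
  proof -
    obtain n where "\<rho> x y < real n" using reals_Archimedean2 by blast
    then show ?thesis by (intro exI[of _ n]) (simp add: qball_def)
  qed
  then show "\<exists>A. countable A \<and> A \<subseteq> sets M \<and> \<Union>A = space M \<and> (\<forall>a\<in>A. emeasure M a \<noteq> \<infinity>)"
    using qball_finite[of "real (Suc n)" x for n]
    by (intro exI[of _ "range (\<lambda>n. qball \<rho> x (real (Suc n)))"]) (auto simp: space_UNIV less_top)
qed

lemma reverse_holder:
  fixes w :: "'a \<Rightarrow> real"
  assumes w[measurable]: "w \<in> borel_measurable M" and w0: "\<And>x. 0 \<le> w x"
    and pos: "1 \<le> \<Lambda>" "0 < c" "0 < b" "b \<le> 1"
    and star: "\<And>x r l. 0 < r \<Longrightarrow> 0 < l \<Longrightarrow>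
      ennreal l * emeasure M (qball \<rho> x r) < emeasure (density M w) (qball \<rho> x r) \<Longrightarrow>
      ennreal c * emeasure M (qball \<rho> x r) \<le> emeasure M ({y. b * l < w y} \<inter> qball \<rho> x (\<Lambda> * r))"
  shows "\<exists>\<kappa>\<^sub>0>0. \<forall>\<kappa>. 0 < \<kappa> \<longrightarrow> \<kappa> \<le> \<kappa>\<^sub>0 \<longrightarrow> (\<exists>C>0. \<forall>x R X. 0 < R \<longrightarrow> 0 < X \<longrightarrow>
    emeasure (density M w) (qball \<rho> x (8 * K\<^sub>0 ^ 3 * R)) \<le> ennreal X * emeasure M (qball \<rho> x R) \<longrightarrow>
    (\<integral>\<^sup>+y\<in>qball \<rho> x R. ennreal (w y powr (\<kappa> + 1)) \<partial>M) \<le> ennreal (C * X powr (\<kappa> + 1)) * emeasure M (qball \<rho> x R))"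
proof -
  interpret sigma_finite_measure M by (rule sigma_finite)
  let ?\<nu> = "density M w" and ?t = "5 * K\<^sub>0\<^sup>2"
  have K: "0 < K\<^sub>0" "1 \<le> K\<^sub>0" using K0_ge_1 by auto
  have "1 \<le> K\<^sub>0\<^sup>2" using one_le_power[OF K0_ge_1, of 2] by auto
  obtain C where C: "1 \<le> C" "\<And>x r. 0 < r \<Longrightarrow> emeasure M (qball \<rho> x (?t * r)) \<le> ennreal C * emeasure M (qball \<rho> x r)"
    using doubling_factor by metis
  obtain C' where C': "1 \<le> C'" "\<And>x r. 0 < r \<Longrightarrow> emeasure M (qball \<rho> x (?t * \<Lambda> * r)) \<le> ennreal C' * emeasure M (qball \<rho> x r)"
    using doubling_factor by metis
  obtain Da where Da: "1 \<le> Da" "\<And>x r. 0 < r \<Longrightarrow> emeasure M (qball \<rho> x (4 * K\<^sub>0 ^ 3 * \<Lambda> * r)) \<le> ennreal Da * emeasure M (qball \<rho> x r)"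
    using doubling_factor by metis
  obtain Dq where Dq: "1 \<le> Dq" "\<And>x r. 0 < r \<Longrightarrow> emeasure M (qball \<rho> x (2 * K\<^sub>0 * r)) \<le> ennreal Dq * emeasure M (qball \<rho> x r)"
    using doubling_factor by metis
  have Dqn: "emeasure M (qball \<rho> x ((2 * K\<^sub>0) ^ n * r)) \<le> ennreal (Dq ^ n) * emeasure M (qball \<rho> x r)" if r: "0 < r" for x r n
  proof (induction n)
    case (Suc n)
    have "emeasure M (qball \<rho> x (2 * K\<^sub>0 * ((2 * K\<^sub>0) ^ n * r))) \<le> ennreal Dq * emeasure M (qball \<rho> x ((2 * K\<^sub>0) ^ n * r))"
      using r K by (intro Dq) auto
    also have "\<dots> \<le> ennreal Dq * (ennreal (Dq ^ n) * emeasure M (qball \<rho> x r))"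
      using Suc by (intro mult_left_mono) auto
    also have "\<dots> = ennreal (Dq ^ Suc n) * emeasure M (qball \<rho> x r)"
      using Dq by (simp add: ennreal_mult mult.assoc)
    finally show ?case by (simp add: mult.assoc)
  qed simp
  \<comment> \<open>The good-lambda inequality speaks of \<open>w >= 2 * C * l\<close>; in terms of
    \<open>s = 2 * C * l\<close> its constants become \<open>a\<close> and
    \<open>b'\<close>.\<close>
  define a where "a = C' / c / (2 * C)"
  define b' where "b' = b / (2 * C)"
  have ab: "0 < a" "0 < b'" "b' \<le> 1" using C C' pos by (auto simp: a_def b'_def)
  \<comment> \<open>Absorption needs
    \<open>\<kappa> * a / b'\<^sup>2 * Dq powr \<kappa> <= 1 / 2\<close>; for
    \<open>\<kappa> <= 1\<close> the last factor is at most \<open>Dq\<close>.\<close>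
  define \<kappa>0 where "\<kappa>0 = min 1 (b'\<^sup>2 / (2 * a * Dq))"
  have \<kappa>0: "0 < \<kappa>0" "\<kappa>0 \<le> 1" "\<kappa>0 \<le> b'\<^sup>2 / (2 * a * Dq)" using ab Dq by (auto simp: \<kappa>0_def)
  show ?thesis
  proof (rule exI[of _ \<kappa>0], intro conjI allI impI)
    fix \<kappa> :: real assume \<kappa>: "0 < \<kappa>" "\<kappa> \<le> \<kappa>0"
    show "\<exists>C>0. \<forall>x R X. 0 < R \<longrightarrow> 0 < X \<longrightarrow>
      emeasure ?\<nu> (qball \<rho> x (8 * K\<^sub>0 ^ 3 * R)) \<le> ennreal X * emeasure M (qball \<rho> x R) \<longrightarrow>
      (\<integral>\<^sup>+y\<in>qball \<rho> x R. ennreal (w y powr (\<kappa> + 1)) \<partial>M) \<le> ennreal (C * X powr (\<kappa> + 1)) * emeasure M (qball \<rho> x R)"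
    proof (intro exI[of _ "2 * (2 * C * Da) powr \<kappa>"] conjI allI impI)
      fix z R X assume R: "0 < R" and X: "0 < X"
        and avg: "emeasure ?\<nu> (qball \<rho> z (8 * K\<^sub>0 ^ 3 * R)) \<le> ennreal X * emeasure M (qball \<rho> z R)"
      define h where "h i = R / (2 * K\<^sub>0) ^ i" for i
      have h: "0 < h i" "2 * K\<^sub>0 * h (Suc i) = h i" "h i \<le> R" for i
      proof -
        have "1 \<le> (2 * K\<^sub>0) ^ i" using K by (intro one_le_power) simp
        then show "h i \<le> R" using R divide_left_mono[of 1 "(2 * K\<^sub>0) ^ i" R] K by (simp add: h_def)
      qed (use R K in \<open>simp_all add: h_def\<close>)
      (* Neighbourhoods of balls are not balls in a quasi-metric space; the radii h i decrease fast
         enough for all the G i to stay in a fixed ball despite the factor in the triangle inequality. *)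
      define G where "G = rec_nat (qball \<rho> z R) (\<lambda>i S. \<Union>x\<in>S. qball \<rho> x (h i))"
      have G0: "G 0 = qball \<rho> z R" and GS: "G (Suc i) = (\<Union>x\<in>G i. qball \<rho> x (h i))" for i
        by (simp_all add: G_def)
      have G_open: "openin (qtopology \<rho>) (G i)" for i
        by (cases i) (use h(1) R in \<open>auto simp: G0 GS intro!: open_Union_qballs open_qball\<close>)
      \<comment> \<open>The downward induction reproduces its own bound: since
        \<open>2 * K\<^sub>0 * h (Suc i) = h i\<close>, the quasi-triangle inequality gives
        \<open>K\<^sub>0 * (h i + h i)\<close>. This fixes the ratio \<open>2 * K\<^sub>0\<close> of
        the radii.\<close>
      have reach: "\<exists>y\<in>G i. \<rho> y x \<le> 2 * K\<^sub>0 * h i" if x: "x \<in> G n" and i: "i \<le> n" for x i n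
        using i
      proof (induction i rule: inc_induct)
        case base
        then show ?case using x eq_0_iff[of x x] h[of n] K by (intro bexI[of _ x]) auto
      next
        case (step i)
        then obtain y' where y': "y' \<in> G (Suc i)" "\<rho> y' x \<le> 2 * K\<^sub>0 * h (Suc i)" by blast
        then obtain y where y: "y \<in> G i" "\<rho> y y' < h i" by (auto simp: GS qball_def)
        have "\<rho> y x \<le> K\<^sub>0 * (\<rho> y y' + \<rho> y' x)" by (rule quasi_triangle)
        also have "\<dots> \<le> K\<^sub>0 * (h i + h i)" using y y' h(2)[of i] K by (intro mult_left_mono add_mono) auto
        finally show ?case using y by (intro bexI[of _ y]) (simp_all add: mult_ac)
      qed
      have G_dist: "\<rho> z x \<le> 3 * K\<^sub>0\<^sup>2 * R" if x: "x \<in> G n" for x n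
      proof -
        obtain y where y: "\<rho> z y < R" "\<rho> y x \<le> 2 * K\<^sub>0 * R"
          using reach[OF x, of 0] by (auto simp: G0 qball_def h_def)
        have "1 * R \<le> K\<^sub>0 * R" using K R by (intro mult_right_mono) auto
        then have yR: "\<rho> z y \<le> K\<^sub>0 * R" using y by linarith
        have "\<rho> z x \<le> K\<^sub>0 * (\<rho> z y + \<rho> y x)" by (rule quasi_triangle)
        also have "\<dots> \<le> K\<^sub>0 * (K\<^sub>0 * R + 2 * K\<^sub>0 * R)"
          using y K yR by (intro mult_left_mono add_mono) auto
        finally show ?thesis by (simp add: power2_eq_square algebra_simps)
      qed
      \<comment> \<open>The constant is
        \<open>K\<^sub>0 * (3 * K\<^sub>0\<^sup>2 + 5 * K\<^sub>0\<^sup>2)\<close>: every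
        \<open>G n\<close> lies within \<open>3 * K\<^sub>0\<^sup>2 * R\<close> of the centre, and
        balls of radius up to \<open>5 * K\<^sub>0\<^sup>2 * R\<close> about its points have to be
        controlled.\<close>
      let ?V = "qball \<rho> z (8 * K\<^sub>0 ^ 3 * R)"
      have V: "qball \<rho> x r \<subseteq> ?V" if x: "x \<in> G n" and r: "r \<le> ?t * R" for x r n
      proof
        fix y assume "y \<in> qball \<rho> x r"
        then have "\<rho> x y < ?t * R" using r by (simp add: qball_def)
        then have "K\<^sub>0 * (\<rho> z x + \<rho> x y) < K\<^sub>0 * (3 * K\<^sub>0\<^sup>2 * R + ?t * R)"
          using G_dist[OF x] K by (intro mult_strict_left_mono add_le_less_mono) auto
        with quasi_triangle[of z y x] show "y \<in> ?V"
          by (simp add: qball_def power2_eq_square power3_eq_cube algebra_simps)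
      qed
      have GV: "G n \<subseteq> ?V" for n
      proof
        fix y assume y: "y \<in> G n"
        have "1 * R \<le> ?t * R" using R \<open>1 \<le> K\<^sub>0\<^sup>2\<close> by (intro mult_right_mono) auto
        then have "qball \<rho> y R \<subseteq> ?V" by (intro V[OF y]) simp
        then show "y \<in> ?V" using centre_in_qball[OF R, of y] by blast
      qed
      have V_fin: "emeasure M ?V < \<infinity>" using R K by (intro qball_finite) auto
      have B_fin: "emeasure M (qball \<rho> z R) < \<infinity>" using R by (rule qball_finite)
      have \<nu>V_fin: "emeasure ?\<nu> ?V < \<infinity>"
        using B_fin by (intro le_less_trans[OF avg]) (auto simp: ennreal_mult_less_top)
      have G_fin: "emeasure M (G n) < \<infinity>" for n
        using emeasure_mono[OF GV, of M n] V_fin by (auto intro: le_less_trans)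
      have [measurable]: "G n \<in> sets M" for n using G_open open_sets by blast
      have avg_small: "emeasure ?\<nu> (qball \<rho> x r) \<le> ennreal (X * Da * Dq ^ n) * emeasure M (qball \<rho> x r)"
        if x: "x \<in> G n" and r: "h n / \<Lambda> \<le> r" "r \<le> ?t * R" for x r n
      proof -
        have hL: "0 < h n / \<Lambda>" using h pos by auto
        have "qball \<rho> z R \<subseteq> qball \<rho> x (4 * K\<^sub>0 ^ 3 * R)"
        proof
          fix y assume "y \<in> qball \<rho> z R"
          then have y: "\<rho> z y < R" by (simp add: qball_def)
          have "1 * R \<le> K\<^sub>0\<^sup>2 * R" using R \<open>1 \<le> K\<^sub>0\<^sup>2\<close> by (intro mult_right_mono) auto
          then have "\<rho> z y < K\<^sub>0\<^sup>2 * R" using y by linarith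
          then have "K\<^sub>0 * (\<rho> x z + \<rho> z y) < K\<^sub>0 * (3 * K\<^sub>0\<^sup>2 * R + K\<^sub>0\<^sup>2 * R)"
            using G_dist[OF x] sym[of x z] K by (intro mult_strict_left_mono add_le_less_mono) auto
          with quasi_triangle[of x y z] show "y \<in> qball \<rho> x (4 * K\<^sub>0 ^ 3 * R)"
            by (simp add: qball_def power2_eq_square power3_eq_cube algebra_simps)
        qed
        moreover have "4 * K\<^sub>0 ^ 3 * \<Lambda> * (R / \<Lambda>) = 4 * K\<^sub>0 ^ 3 * R" using pos by simp
        ultimately have "emeasure M (qball \<rho> z R) \<le> emeasure M (qball \<rho> x (4 * K\<^sub>0 ^ 3 * \<Lambda> * (R / \<Lambda>)))"
          by (metis emeasure_mono qball_sets)
        also have "\<dots> \<le> ennreal Da * emeasure M (qball \<rho> x (R / \<Lambda>))"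
          using R pos by (intro Da) auto
        also have "R / \<Lambda> = (2 * K\<^sub>0) ^ n * (h n / \<Lambda>)" using K by (simp add: h_def)
        also have "ennreal Da * emeasure M (qball \<rho> x \<dots>) \<le> ennreal Da * (ennreal (Dq ^ n) * emeasure M (qball \<rho> x (h n / \<Lambda>)))"
          using hL by (intro mult_left_mono Dqn) auto
        also have "\<dots> \<le> ennreal Da * (ennreal (Dq ^ n) * emeasure M (qball \<rho> x r))"
          using r by (intro mult_left_mono emeasure_mono qball_mono) auto
        finally have *: "emeasure M (qball \<rho> z R) \<le> \<dots>" .
        have "emeasure ?\<nu> (qball \<rho> x r) \<le> emeasure ?\<nu> ?V"
          using V[OF x r(2)] by (intro emeasure_mono) auto
        also have "\<dots> \<le> ennreal X * emeasure M (qball \<rho> z R)" by (rule avg)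
        also have "\<dots> \<le> ennreal X * (ennreal Da * (ennreal (Dq ^ n) * emeasure M (qball \<rho> x r)))"
          using * by (rule mult_left_mono) simp
        also have "\<dots> = ennreal (X * Da * Dq ^ n) * emeasure M (qball \<rho> x r)"
          using X Da Dq by (simp add: ennreal_mult mult.assoc)
        finally show ?thesis .
      qed
      \<comment> \<open>Bounds the averages about points of \<open>G n\<close> down to the radius
        \<open>h n / \<Lambda>\<close>. It grows geometrically because these radii shrink by
        \<open>2 * K\<^sub>0\<close>; the power \<open>\<kappa>\<close> of it grows with ratio
        \<open>Dq powr \<kappa>\<close>, which absorption tolerates.\<close>
      define L where "L n = X * Da * Dq ^ n" for n
      have L: "0 < L n" for n using X Da Dq by (simp add: L_def)
      have good: "emeasure ?\<nu> ({y\<in>space M. s \<le> w y} \<inter> G n) \<le> ennreal (a * s) * emeasure M ({y\<in>space M. b' * s < w y} \<inter> G (Suc n))"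
        if s: "2 * C * L n \<le> s" for s n
      proof -
        define l where "l = s / (2 * C)"
        have l: "L n \<le> l" using s C(1) by (simp add: l_def field_simps)
        then have l0: "0 < l" using L[of n] by linarith
        have "emeasure ?\<nu> ({y. 2 * C * l \<le> w y} \<inter> G n) \<le> ennreal (C' / c * l) * emeasure M ({y. b * l < w y} \<inter> G (Suc n))"
        \<comment> \<open>With \<open>r0 = h n / \<Lambda>\<close> the enlarged balls have radius
          \<open>h n\<close>, exactly the step from \<open>G n\<close> to
          \<open>G (Suc n)\<close>.\<close>
        proof (rule good_lambda[where ?r0.0 = "h n / \<Lambda>" and \<Lambda> = \<Lambda>])
          fix x r assume "x \<in> G n" and r: "h n / \<Lambda> \<le> r" "r \<le> ?t * \<Lambda> * (h n / \<Lambda>)"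
          have "?t * \<Lambda> * (h n / \<Lambda>) = ?t * h n" using pos by simp
          also have "\<dots> \<le> ?t * R" using h(3)[of n] by (intro mult_left_mono) auto
          finally have "emeasure ?\<nu> (qball \<rho> x r) \<le> ennreal (L n) * emeasure M (qball \<rho> x r)"
            unfolding L_def using \<open>x \<in> G n\<close> r by (intro avg_small) auto
          also have "\<dots> \<le> ennreal l * emeasure M (qball \<rho> x r)"
            using l by (intro mult_right_mono ennreal_leI) auto
          finally show "emeasure ?\<nu> (qball \<rho> x r) \<le> ennreal l * emeasure M (qball \<rho> x r)" .
        next
          show "qball \<rho> x (\<Lambda> * (h n / \<Lambda>)) \<subseteq> G (Suc n)" if "x \<in> G n" for x
            using that pos by (auto simp: GS)
        qed (use w pos l0 h(1)[of n] star C C' G_open G_fin in auto)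
        moreover have "C' / c * l = a * s" "b * l = b' * s" "2 * C * l = s"
          using C by (auto simp: a_def b'_def l_def)
        ultimately show ?thesis by (simp add: space_UNIV)
      qed
      define \<theta> where "\<theta> = \<kappa> * a / b'\<^sup>2"
      have \<theta>: "0 \<le> \<theta>" "\<theta> * Dq powr \<kappa> \<le> 1 / 2"
      proof -
        show "0 \<le> \<theta>" using \<kappa> ab by (simp add: \<theta>_def)
        have "\<theta> \<le> b'\<^sup>2 / (2 * a * Dq) * a / b'\<^sup>2"
          unfolding \<theta>_def using \<kappa> \<kappa>0 ab by (intro divide_right_mono mult_right_mono) auto
        also have "\<dots> = 1 / (2 * Dq)" using ab by simp
        finally have "\<theta> * Dq powr \<kappa> \<le> 1 / (2 * Dq) * Dq powr 1"
          using Dq \<kappa> \<kappa>0 by (intro mult_mono powr_mono) auto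
        then show "\<theta> * Dq powr \<kappa> \<le> 1 / 2" using Dq by simp
      qed
      \<comment> \<open>Truncation bounds \<open>\<Phi> N n\<close> uniformly in \<open>n\<close>,
        as absorption requires. The estimate obtained for \<open>n = 0\<close> no longer depends on
        \<open>N\<close>, so monotone convergence removes the truncation.\<close>
      define \<Phi> where "\<Phi> N n = (\<integral>\<^sup>+y\<in>G n. ennreal (w y * min (w y) N powr \<kappa>) \<partial>M)" for N n
      obtain v where v: "emeasure ?\<nu> ?V = ennreal v" "0 \<le> v" using \<nu>V_fin by (cases "emeasure ?\<nu> ?V") auto
      have \<Phi>_bound: "\<Phi> N n \<le> ennreal (N powr \<kappa> * v)" if N: "0 < N" for N n
      proof -
        have "\<Phi> N n \<le> (\<integral>\<^sup>+y. ennreal (N powr \<kappa>) * (ennreal (w y) * indicator ?V y) \<partial>M)"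
          unfolding \<Phi>_def
        proof (rule nn_integral_mono)
          fix y
          have "min (w y) N powr \<kappa> \<le> N powr \<kappa>" using N w0[of y] \<kappa> by (intro powr_mono2) auto
          then have "ennreal (w y * min (w y) N powr \<kappa>) \<le> ennreal (N powr \<kappa>) * ennreal (w y)"
            using w0[of y] by (subst ennreal_mult[symmetric]) (auto intro!: ennreal_leI mult_right_mono simp: mult.commute[of "w y"])
          then show "ennreal (w y * min (w y) N powr \<kappa>) * indicator (G n) y \<le> ennreal (N powr \<kappa>) * (ennreal (w y) * indicator ?V y)"
            using GV[of n] by (auto simp: indicator_def)
        qed
        also have "\<dots> = ennreal (N powr \<kappa>) * emeasure ?\<nu> ?V" by (simp add: nn_integral_cmult emeasure_density)
        finally show ?thesis using v by (simp add: ennreal_mult)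
      qed
      have \<Phi>0: "\<Phi> N 0 \<le> ennreal (2 * ((2 * C * L 0) powr \<kappa> * v))" if N: "0 < N" for N
      proof -
        define f where "f n = enn2real (\<Phi> N n)" for n
        have \<Phi>f: "\<Phi> N n = ennreal (f n)" "0 \<le> f n" for n
          using \<Phi>_bound[OF N, of n] by (auto simp: f_def ennreal_enn2real_if top_unique)
        have "f 0 \<le> 2 * ((2 * C * L 0) powr \<kappa> * v)"
        proof (rule geometric_absorption)
          show "f n \<le> N powr \<kappa> * v" for n
            using \<Phi>_bound[OF N, of n] \<Phi>f[of n] v by (simp add: ennreal_le_iff)
          fix n
          have "ennreal (f n) \<le> ennreal ((2 * C * L n) powr \<kappa>) * emeasure ?\<nu> (G n) + ennreal \<theta> * ennreal (f (Suc n))"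
            unfolding \<Phi>f(1)[symmetric] \<Phi>_def \<theta>_def
            by (rule layer_cake_step) (use w w0 L[of n] C ab \<kappa> \<kappa>0 N good in auto)
          also have "\<dots> \<le> ennreal ((2 * C * L n) powr \<kappa>) * ennreal v + ennreal \<theta> * ennreal (f (Suc n))"
            using GV[of n] unfolding v(1)[symmetric] by (intro add_right_mono mult_left_mono emeasure_mono) auto
          also have "\<dots> = ennreal ((2 * C * L n) powr \<kappa> * v + \<theta> * f (Suc n))"
            using v \<theta> \<Phi>f by (simp add: ennreal_mult)
          finally have "f n \<le> (2 * C * L n) powr \<kappa> * v + \<theta> * f (Suc n)"
            using v \<theta> \<Phi>f by (subst (asm) ennreal_le_iff) auto
          also have "2 * C * L n = 2 * C * L 0 * Dq ^ n" by (simp add: L_def)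
          also have "\<dots> powr \<kappa> = (2 * C * L 0) powr \<kappa> * (Dq powr \<kappa>) ^ n"
            using C L[of 0] Dq by (simp add: powr_mult powr_power powr_realpow[symmetric] powr_powr mult.commute)
          finally show "f n \<le> (2 * C * L 0) powr \<kappa> * v * (Dq powr \<kappa>) ^ n + \<theta> * f (Suc n)"
            by (simp add: mult_ac)
        qed (use \<theta> v Dq \<kappa> in \<open>auto intro: ge_one_powr_ge_zero\<close>)
        then show ?thesis unfolding \<Phi>f(1) by (rule ennreal_leI)
      qed
      have "(\<integral>\<^sup>+y\<in>qball \<rho> z R. ennreal (w y powr (\<kappa> + 1)) \<partial>M)
        = (\<integral>\<^sup>+y. (SUP n. ennreal (w y * min (w y) (real (Suc n)) powr \<kappa>) * indicator (G 0) y) \<partial>M)"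
      proof (rule nn_integral_cong)
        fix y
        have "(SUP n. ennreal (w y * min (w y) (real (Suc n)) powr \<kappa>)) = ennreal (w y powr (\<kappa> + 1))"
        proof (rule antisym)
          have le: "w y * u powr \<kappa> \<le> w y powr (\<kappa> + 1)" if "u \<le> w y" "0 \<le> u" for u
          proof -
            have "w y * u powr \<kappa> \<le> w y * w y powr \<kappa>" using that \<kappa> w0[of y] by (intro mult_left_mono powr_mono2) auto
            then show ?thesis using w0[of y] by (cases "w y = 0") (auto simp: powr_add mult.commute)
          qed
          show "(SUP n. ennreal (w y * min (w y) (real (Suc n)) powr \<kappa>)) \<le> ennreal (w y powr (\<kappa> + 1))"
            using w0[of y] by (intro SUP_least ennreal_leI le) auto
          obtain n where n: "w y < real n" using reals_Archimedean2 by blast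
          have "ennreal (w y powr (\<kappa> + 1)) = ennreal (w y * min (w y) (real (Suc n)) powr \<kappa>)"
            using n w0[of y] by (cases "w y = 0") (auto simp: powr_add mult.commute min_def)
          then show "ennreal (w y powr (\<kappa> + 1)) \<le> (SUP n. ennreal (w y * min (w y) (real (Suc n)) powr \<kappa>))"
            by (intro SUP_upper2[of n]) simp_all
        qed
        then show "ennreal (w y powr (\<kappa> + 1)) * indicator (qball \<rho> z R) y =
            (SUP n. ennreal (w y * min (w y) (real (Suc n)) powr \<kappa>) * indicator (G 0) y)"
          by (cases "y \<in> qball \<rho> z R") (simp_all add: G0)
      qed
      also have "\<dots> = (SUP n. \<Phi> (real (Suc n)) 0)"
        unfolding \<Phi>_def
        using w0 \<kappa> by (intro nn_integral_monotone_convergence_SUP)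
          (auto simp: incseq_def le_fun_def intro!: mult_right_mono ennreal_leI mult_left_mono powr_mono2)
      also have "\<dots> \<le> ennreal (2 * ((2 * C * L 0) powr \<kappa> * v))"
        by (intro SUP_least \<Phi>0) simp
      also have "\<dots> = ennreal (2 * (2 * C * L 0) powr \<kappa>) * emeasure ?\<nu> ?V"
        using v by (simp add: ennreal_mult[symmetric] mult_ac)
      also have "\<dots> \<le> ennreal (2 * (2 * C * L 0) powr \<kappa>) * (ennreal X * emeasure M (qball \<rho> z R))"
        by (intro mult_left_mono avg) simp
      also have "\<dots> = ennreal (2 * (2 * C * L 0) powr \<kappa> * X) * emeasure M (qball \<rho> z R)"
        using X by (simp add: ennreal_mult mult.assoc)
      also have "2 * (2 * C * L 0) powr \<kappa> * X = 2 * (2 * C * Da) powr \<kappa> * X powr (\<kappa> + 1)"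
      proof -
        have "2 * C * L 0 = (2 * C * Da) * X" by (simp add: L_def)
        then have "(2 * C * L 0) powr \<kappa> = (2 * C * Da) powr \<kappa> * X powr \<kappa>"
          using C Da X by (simp only: powr_mult)
        then show ?thesis using X by (simp add: powr_add)
      qed
      finally show "(\<integral>\<^sup>+y\<in>qball \<rho> z R. ennreal (w y powr (\<kappa> + 1)) \<partial>M)
        \<le> ennreal (2 * (2 * C * Da) powr \<kappa> * X powr (\<kappa> + 1)) * emeasure M (qball \<rho> z R)" .
    qed (use C Da in auto)
  qed (rule \<kappa>0)
qed

end

section \<open>The parabolic product space\<close>

lemma sigma_finite_lebesgue: "sigma_finite_measure (lebesgue :: real measure)"
proof
  have "x \<in> (\<Union>n. {- real n..real n})" for x :: real
    using real_arch_simple[of "\<bar>x\<bar>"] by (auto simp: abs_le_iff minus_le_iff)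
  then show "\<exists>A::real set set. countable A \<and> A \<subseteq> sets lebesgue \<and> \<Union>A = space lebesgue \<and>
      (\<forall>a\<in>A. emeasure lebesgue a \<noteq> \<infinity>)"
    by (intro exI[of _ "range (\<lambda>n. {- real n..real n})"]) auto
qed

lemma ennreal_between:
  assumes "a < (b :: ennreal)"
  obtains y where "0 < y" "a < ennreal y" "ennreal y < b"
proof -
  obtain c where c: "a < c" "c < b" using dense assms by blast
  then obtain y where "c = ennreal y" "0 \<le> y" by (cases c) auto
  then show ?thesis using that[of y] c by (cases "y = 0") auto
qed

text \<open>Radius and half-height are independent: half-height \<open>l powr p\<close> gives the
  balls of \<open>par_dist\<close>, while the half cylinders of the weight condition are flatter and
  have a shifted centre.\<close>

definition tbox :: "('a \<Rightarrow> 'a \<Rightarrow> real) \<Rightarrow> 'a \<Rightarrow> real \<Rightarrow> real \<Rightarrow> real \<Rightarrow> ('a \<times> real) set" where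
  "tbox \<rho> x l \<tau> h = qball \<rho> x l \<times> {\<tau> - h<..<\<tau> + h}"

locale parabolic = homogeneous_type \<rho> K\<^sub>0 \<mu>
  for \<rho> :: "'a \<Rightarrow> 'a \<Rightarrow> real" and K\<^sub>0 :: real and \<mu> :: "'a measure" +
  fixes p :: real
  assumes basic: "basic_assumptions \<rho> \<mu>" and p_gt_1: "1 < p"
    and basic_par: "basic_assumptions (par_dist \<rho> p) (par_measure \<mu>)"
begin

abbreviation "M \<equiv> par_measure \<mu>"

lemma emeasure_Times_interval:
  assumes "B \<in> sets \<mu>" "u \<le> v"
  shows "emeasure M (B \<times> {u<..<v}) = emeasure \<mu> B * ennreal (v - u)"
proof -
  interpret sigma_finite_measure "lebesgue :: real measure" by (rule sigma_finite_lebesgue)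
  show ?thesis using assms unfolding par_measure_def by (subst emeasure_pair_measure_Times) auto
qed

lemma sets_Times_interval [measurable]: "B \<in> sets \<mu> \<Longrightarrow> B \<times> {u<..<v} \<in> sets M"
  unfolding par_measure_def by (intro pair_measureI) auto

lemma space_M: "space M = UNIV"
  using space_eq by (simp add: par_measure_def space_pair_measure)

lemma regular_doubling_base: "\<exists>D. regular_doubling \<rho> K\<^sub>0 \<mu> D"
proof -
  obtain D :: real where "\<forall>x. \<forall>r>0. emeasure \<mu> (qball \<rho> x (2 * r)) \<le> ennreal D * emeasure \<mu> (qball \<rho> x r)"
    using doubling by blast
  then have "regular_doubling \<rho> K\<^sub>0 \<mu> D"
    using space_eq basic unfolding basic_assumptions_def by unfold_locales auto
  then show ?thesis ..
qed

lemma mu_sets [measurable]: "qball \<rho> x r \<in> sets \<mu>"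
proof -
  obtain D where "regular_doubling \<rho> K\<^sub>0 \<mu> D" using regular_doubling_base by blast
  then show ?thesis by (rule regular_doubling.qball_sets)
qed

lemma mu_pos: "0 < r \<Longrightarrow> 0 < emeasure \<mu> (qball \<rho> x r)"
  and mu_finite: "0 < r \<Longrightarrow> emeasure \<mu> (qball \<rho> x r) < \<infinity>"
  using basic unfolding basic_assumptions_def by auto

lemma mu_doubling:
  obtains C where "1 \<le> C"
    "\<And>x r. 0 < r \<Longrightarrow> emeasure \<mu> (qball \<rho> x (A * r)) \<le> ennreal C * emeasure \<mu> (qball \<rho> x r)"
proof -
  obtain D where "regular_doubling \<rho> K\<^sub>0 \<mu> D" using regular_doubling_base by blast
  from regular_doubling.doubling_factor[OF this, of A] that show ?thesis by blast
qed

lemma qball_subset: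
  assumes "\<rho> x y \<le> d" "K\<^sub>0 * (d + r) \<le> s"
  shows "qball \<rho> y r \<subseteq> qball \<rho> x s"
proof
  fix u assume "u \<in> qball \<rho> y r"
  then have "K\<^sub>0 * (\<rho> x y + \<rho> y u) < K\<^sub>0 * (d + r)"
    using assms(1) K0_ge_1 by (intro mult_strict_left_mono add_le_less_mono) (auto simp: qball_def)
  then show "u \<in> qball \<rho> x s" using quasi_triangle[of x u y] assms(2) by (simp add: qball_def)
qed

lemma tbox_sets [measurable]: "tbox \<rho> x l \<tau> h \<in> sets M"
  by (simp add: tbox_def)

lemma emeasure_tbox: "0 \<le> h \<Longrightarrow> emeasure M (tbox \<rho> x l \<tau> h) = emeasure \<mu> (qball \<rho> x l) * ennreal (2 * h)"
  by (simp add: tbox_def emeasure_Times_interval)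

lemma tbox_pos: "0 < l \<Longrightarrow> 0 < h \<Longrightarrow> 0 < emeasure M (tbox \<rho> x l \<tau> h)"
  using mu_pos[of l x] by (simp add: emeasure_tbox ennreal_zero_less_mult_iff)

lemma tbox_finite: "0 < l \<Longrightarrow> 0 \<le> h \<Longrightarrow> emeasure M (tbox \<rho> x l \<tau> h) < \<infinity>"
  using mu_finite[of l x] by (simp add: emeasure_tbox ennreal_mult_less_top)

lemma par_dist_nonneg: "0 \<le> par_dist \<rho> p y z"
  using nonneg by (cases y; cases z) (auto simp: par_dist_def intro: max.coboundedI1)

text \<open>The space part costs \<open>K\<^sub>0\<close> and the time part at most
  \<open>2 powr (1 / p) <= 2\<close>; the product of the two constants dominates both.\<close>

lemma par_dist_quasi_metric: "quasi_metric (par_dist \<rho> p) (2 * K\<^sub>0)"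
proof
  show "1 \<le> 2 * K\<^sub>0" using K0_ge_1 by simp
  fix Y Z U :: "'a \<times> real"
  obtain x t y s z u where [simp]: "Y = (x, t)" "Z = (y, s)" "U = (z, u)" by (metis prod.exhaust)
  show "0 \<le> par_dist \<rho> p Y Z" by (rule par_dist_nonneg)
  show "par_dist \<rho> p Y Z = 0 \<longleftrightarrow> Y = Z"
    using eq_0_iff[of x y] nonneg[of x y] p_gt_1
    by (auto simp: par_dist_def max_def split: if_splits)
  show "par_dist \<rho> p Y Z = par_dist \<rho> p Z Y"
    using sym[of x y] by (simp add: par_dist_def abs_minus_commute)
  have "\<rho> x y \<le> K\<^sub>0 * (\<rho> x z + \<rho> z y)" by (rule quasi_triangle)
  also have "\<dots> \<le> K\<^sub>0 * (par_dist \<rho> p Y U + par_dist \<rho> p U Z)"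
    using K0_ge_1 by (intro mult_left_mono add_mono) (auto simp: par_dist_def)
  also have "\<dots> \<le> 2 * K\<^sub>0 * (par_dist \<rho> p Y U + par_dist \<rho> p U Z)"
    using K0_ge_1 par_dist_nonneg[of Y U] par_dist_nonneg[of U Z] by (intro mult_right_mono) auto
  finally have 1: "\<rho> x y \<le> \<dots>" .
  define m where "m = max \<bar>t - u\<bar> \<bar>u - s\<bar>"
  have "\<bar>t - u\<bar> \<le> m" "\<bar>u - s\<bar> \<le> m" by (simp_all add: m_def)
  then have "\<bar>t - s\<bar> \<le> 2 * m" by linarith
  then have "\<bar>t - s\<bar> powr (1 / p) \<le> (2 * m) powr (1 / p)"
    using p_gt_1 by (intro powr_mono2) auto
  also have "\<dots> = 2 powr (1 / p) * m powr (1 / p)" by (rule powr_mult) 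
  also have "\<dots> \<le> 2 powr 1 * m powr (1 / p)"
    using p_gt_1 by (intro mult_right_mono powr_mono) auto
  finally have mt: "\<bar>t - s\<bar> powr (1 / p) \<le> 2 * m powr (1 / p)" by simp
  have "\<bar>t - u\<bar> powr (1 / p) \<le> par_dist \<rho> p Y U" "\<bar>u - s\<bar> powr (1 / p) \<le> par_dist \<rho> p U Z"
    by (simp_all add: par_dist_def)
  then have "m powr (1 / p) \<le> par_dist \<rho> p Y U + par_dist \<rho> p U Z"
    using par_dist_nonneg[of Y U] par_dist_nonneg[of U Z]
    by (cases "\<bar>t - u\<bar> \<le> \<bar>u - s\<bar>") (simp_all add: m_def)
  with mt have "\<bar>t - s\<bar> powr (1 / p) \<le> 2 * (par_dist \<rho> p Y U + par_dist \<rho> p U Z)" by simp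
  also have "\<dots> \<le> 2 * K\<^sub>0 * (par_dist \<rho> p Y U + par_dist \<rho> p U Z)"
    using K0_ge_1 par_dist_nonneg[of Y U] par_dist_nonneg[of U Z] by (intro mult_right_mono) auto
  finally show "par_dist \<rho> p Y Z \<le> 2 * K\<^sub>0 * (par_dist \<rho> p Y U + par_dist \<rho> p U Z)"
    using 1 by (simp add: par_dist_def)
qed

lemma qball_par_dist: "0 < r \<Longrightarrow> qball (par_dist \<rho> p) (x, t) r = tbox \<rho> x r t (r powr p)"
proof -
  assume r: "0 < r"
  have "\<bar>t - s\<bar> powr (1 / p) < r \<longleftrightarrow> \<bar>t - s\<bar> < r powr p" for s
  proof
    assume "\<bar>t - s\<bar> powr (1 / p) < r"
    then have "(\<bar>t - s\<bar> powr (1 / p)) powr p < r powr p"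
      using p_gt_1 by (intro powr_less_mono2) auto
    then show "\<bar>t - s\<bar> < r powr p" using p_gt_1 by (simp add: powr_powr)
  next
    assume "\<bar>t - s\<bar> < r powr p"
    then have "\<bar>t - s\<bar> powr (1 / p) < (r powr p) powr (1 / p)"
      using p_gt_1 by (intro powr_less_mono2) auto
    then show "\<bar>t - s\<bar> powr (1 / p) < r" using p_gt_1 r by (simp add: powr_powr)
  qed
  then show ?thesis by (auto simp: qball_def par_dist_def tbox_def abs_less_iff)
qed

lemma regular_doubling_par: "\<exists>D. regular_doubling (par_dist \<rho> p) (2 * K\<^sub>0) M D"
proof -
  obtain D where D: "1 \<le> D" "\<And>x r. 0 < r \<Longrightarrow> emeasure \<mu> (qball \<rho> x (2 * r)) \<le> ennreal D * emeasure \<mu> (qball \<rho> x r)"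
    using mu_doubling by metis
  interpret P: quasi_metric "par_dist \<rho> p" "2 * K\<^sub>0" by (rule par_dist_quasi_metric)
  have dbl: "emeasure M (qball (par_dist \<rho> p) Y (2 * r)) \<le> ennreal (D * 2 powr p) * emeasure M (qball (par_dist \<rho> p) Y r)"
    if r: "0 < r" for Y r
  proof -
    obtain x t where Y: "Y = (x, t)" by (cases Y)
    have "emeasure M (qball (par_dist \<rho> p) Y (2 * r)) = emeasure \<mu> (qball \<rho> x (2 * r)) * ennreal (2 * (2 * r) powr p)"
      using r by (simp add: Y qball_par_dist emeasure_tbox)
    also have "\<dots> \<le> (ennreal D * emeasure \<mu> (qball \<rho> x r)) * ennreal (2 * (2 * r) powr p)"
      using D r by (intro mult_right_mono) auto
    also have "ennreal (2 * (2 * r) powr p) = ennreal (2 powr p) * ennreal (2 * r powr p)"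
      using r by (simp add: ennreal_mult[symmetric] powr_mult)
    also have "(ennreal D * emeasure \<mu> (qball \<rho> x r)) * (ennreal (2 powr p) * ennreal (2 * r powr p))
      = ennreal (D * 2 powr p) * (emeasure \<mu> (qball \<rho> x r) * ennreal (2 * r powr p))"
    proof -
      have "ennreal (D * 2 powr p) = ennreal D * ennreal (2 powr p)" using D by (intro ennreal_mult) auto
      then show ?thesis by (simp only: mult_ac)
    qed
    finally show ?thesis using r by (simp add: Y qball_par_dist emeasure_tbox)
  qed
  have "regular_doubling (par_dist \<rho> p) (2 * K\<^sub>0) M (D * 2 powr p)"
    using basic_par dbl space_M unfolding basic_assumptions_def by unfold_locales auto
  then show ?thesis ..
qed

end

section \<open>Comparison of averages forward in time\<close>

text \<open>Each step lowers the distance to \<open>y\<close> by \<open>s\<close>, so the path has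
  at most \<open>\<rho> x y / s\<close> steps; afterwards it waits at \<open>y\<close>. Thus every
  sufficiently large number of steps is possible, and the time of arrival can dictate it. The
  summand 1 and \<open>max 1 K\<close> allow for one direct step when
  \<open>\<rho> x y < s\<close>.\<close>

lemma monotone_geodesic_path:
  assumes q: "quasi_metric \<rho> K\<^sub>0" and mg: "monotone_geodesic \<rho>"
  obtains K where "1 \<le> K" "\<And>s x y n. 0 < s \<Longrightarrow> 1 + \<rho> x y / s \<le> real n \<Longrightarrow>
    \<exists>\<xi>. \<xi> 0 = x \<and> \<xi> n = y \<and> (\<forall>i. \<rho> (\<xi> i) (\<xi> (Suc i)) \<le> K * s)"
proof -
  interpret quasi_metric \<rho> K\<^sub>0 by (rule q)
  obtain K where K: "K > 0 \<and> (\<forall>s>0. \<forall>x y. s \<le> \<rho> x y \<longrightarrow> (\<exists>(m::nat) \<xi>. \<xi> 0 = x \<and> \<xi> m = y \<and>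
        (\<forall>i<m. \<rho> (\<xi> i) (\<xi> (Suc i)) \<le> K * s \<and> \<rho> (\<xi> (Suc i)) (\<xi> m) \<le> \<rho> (\<xi> i) (\<xi> m) - s)))"
    using mg unfolding monotone_geodesic_def by (rule exE)
  show ?thesis
  proof (rule that[of "max 1 K"])
    fix s :: real and x y and n :: nat assume s: "0 < s" and n: "1 + \<rho> x y / s \<le> real n"
    have [simp]: "\<rho> u u = 0" for u using eq_0_iff by simp
    have "\<exists>m \<xi>. m \<le> n \<and> \<xi> 0 = x \<and> \<xi> m = y \<and> (\<forall>i<m. \<rho> (\<xi> i) (\<xi> (Suc i)) \<le> max 1 K * s)"
    proof (cases "s \<le> \<rho> x y")
      case True
      with K s have "\<exists>(m::nat) \<xi>. \<xi> 0 = x \<and> \<xi> m = y \<and>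
        (\<forall>i<m. \<rho> (\<xi> i) (\<xi> (Suc i)) \<le> K * s \<and> \<rho> (\<xi> (Suc i)) (\<xi> m) \<le> \<rho> (\<xi> i) (\<xi> m) - s)"
        by (elim conjE allE[of _ s] allE[of _ x] allE[of _ y]) simp
      then obtain m :: nat and \<xi> where m: "\<xi> 0 = x" "\<xi> m = y" "\<And>i. i < m \<Longrightarrow> \<rho> (\<xi> i) (\<xi> (Suc i)) \<le> K * s"
        "\<And>i. i < m \<Longrightarrow> \<rho> (\<xi> (Suc i)) (\<xi> m) \<le> \<rho> (\<xi> i) (\<xi> m) - s"
        by (elim exE conjE) simp
      have "\<rho> (\<xi> i) y \<le> \<rho> x y - real i * s" if "i \<le> m" for i
        using that
      proof (induction i)
        case (Suc i)
        then show ?case using m(2) m(4)[of i] by (simp add: algebra_simps)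
      qed (simp add: m)
      from this[of m] have "real m * s \<le> \<rho> x y" using m by simp
      then have "real m \<le> \<rho> x y / s" using s by (simp add: pos_le_divide_eq)
      then have "m \<le> n" using n by linarith
      moreover have "\<rho> (\<xi> i) (\<xi> (Suc i)) \<le> max 1 K * s" if "i < m" for i
      proof -
        have "K * s \<le> max 1 K * s" using s by (intro mult_right_mono) auto
        then show ?thesis using m(3)[OF that] by linarith
      qed
      ultimately show ?thesis using m(1,2) by blast
    next
      case False
      have "0 \<le> \<rho> x y / s" using nonneg s by simp
      then have "1 \<le> n" using n by linarith
      moreover have "1 * s \<le> max 1 K * s" using s by (intro mult_right_mono) auto
      then have "\<rho> x y \<le> max 1 K * s" using False by linarith
      ultimately show ?thesis
        by (intro exI[of _ 1] exI[of _ "\<lambda>i. if i = 0 then x else y"]) simp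
    qed
    then obtain m \<xi> where m: "m \<le> n" "\<xi> 0 = x" "\<xi> m = y" "\<And>i. i < m \<Longrightarrow> \<rho> (\<xi> i) (\<xi> (Suc i)) \<le> max 1 K * s"
      by blast
    have "0 \<le> max 1 K * s" using s by simp
    then have "\<rho> (\<xi> (min i m)) (\<xi> (min (Suc i) m)) \<le> max 1 K * s" for i
      using m(4)[of i] by (cases "i < m") (auto simp: min_def)
    then show "\<exists>\<xi>. \<xi> 0 = x \<and> \<xi> n = y \<and> (\<forall>i. \<rho> (\<xi> i) (\<xi> (Suc i)) \<le> max 1 K * s)"
      using m by (intro exI[of _ "\<lambda>i. \<xi> (min i m)"]) (simp add: min_def)
  qed simp
qed

context parabolic
begin

text \<open>The sign \<open>e\<close> is the direction of time: \<open>e = 1\<close> for \<open>\<omega>\<close> and \<open>e = -1\<close> for the dual weight.\<close>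

definition shift_dense :: "real \<Rightarrow> real \<Rightarrow> real \<Rightarrow> ('a \<times> real \<Rightarrow> real) \<Rightarrow> bool" where
  "shift_dense e a b w \<longleftrightarrow> (\<forall>\<theta>>0. \<exists>\<beta>>0. \<forall>x \<tau> l s. 0 < l \<longrightarrow> 0 < s \<longrightarrow>
     ennreal s * emeasure M (tbox \<rho> x l \<tau> (a * l powr p)) < emeasure (density M w) (tbox \<rho> x l \<tau> (a * l powr p)) \<longrightarrow>
     emeasure M ({y. w y \<le> \<beta> * s} \<inter> tbox \<rho> x l (\<tau> + e * b * l powr p) (a * l powr p))
       \<le> ennreal \<theta> * emeasure M (tbox \<rho> x l (\<tau> + e * b * l powr p) (a * l powr p)))"

text \<open>The cylinder about \<open>x\<close> of radius \<open>2 * K\<^sub>0 * K * s\<close>, once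
  shifted in time, contains the one of radius \<open>s\<close> about \<open>y\<close>, which fills
  at least the share \<open>1 / C0\<close> of it. Both boxes in the conclusion keep the height that
  belongs to the larger radius, so they have the same shape and the step can be iterated.\<close>

lemma shift_step:
  fixes w :: "'a \<times> real \<Rightarrow> real"
  assumes w[measurable]: "w \<in> borel_measurable M" and sd: "shift_dense e a b w" and a: "0 < a" and K: "1 \<le> K"
  obtains C where "1 \<le> C" "\<And>x y \<tau> s. 0 < s \<Longrightarrow> \<rho> x y \<le> K * s \<Longrightarrow>
    emeasure (density M w) (tbox \<rho> x s \<tau> (a * (2 * K\<^sub>0 * K * s) powr p)) \<le>
    ennreal C * emeasure (density M w) (tbox \<rho> y s (\<tau> + e * b * (2 * K\<^sub>0 * K * s) powr p) (a * (2 * K\<^sub>0 * K * s) powr p))"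
proof -
  let ?\<nu> = "density M w"
  define k where "k = 2 * K\<^sub>0 * K"
  have "1 * 1 \<le> K\<^sub>0 * K" using K0_ge_1 K by (intro mult_mono) auto
  then have k: "1 \<le> k" "K\<^sub>0 * (K + 1) \<le> k" using K0_ge_1 K by (auto simp: k_def algebra_simps)
  obtain C0 where C0: "1 \<le> C0" "\<And>x r. 0 < r \<Longrightarrow> emeasure \<mu> (qball \<rho> x (K\<^sub>0 * (K + k) * r)) \<le> ennreal C0 * emeasure \<mu> (qball \<rho> x r)"
    using mu_doubling by metis
  \<comment> \<open>With this exceptional proportion of the shifted cylinder, at least half of the
    small cylinder about \<open>y\<close> retains large values of \<open>w\<close>.\<close>
  have "0 < 1 / (2 * C0)" using C0 by simp
  then obtain \<beta> where \<beta>: "0 < \<beta>" and sd': "\<And>x \<tau> l s. 0 < l \<Longrightarrow> 0 < s \<Longrightarrow>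
     ennreal s * emeasure M (tbox \<rho> x l \<tau> (a * l powr p)) < emeasure ?\<nu> (tbox \<rho> x l \<tau> (a * l powr p)) \<Longrightarrow>
     emeasure M ({y. w y \<le> \<beta> * s} \<inter> tbox \<rho> x l (\<tau> + e * b * l powr p) (a * l powr p))
       \<le> ennreal (1 / (2 * C0)) * emeasure M (tbox \<rho> x l (\<tau> + e * b * l powr p) (a * l powr p))"
    using sd unfolding shift_dense_def by meson
  have [measurable]: "{y. w y \<le> c} \<in> sets M" "{y. c < w y} \<in> sets M" for c
    using measurable_sets[OF w, of "{..c}"] measurable_sets[OF w, of "{c<..}"]
    by (simp_all add: space_M vimage_def)
  define C where "C = max 1 (2 * C0 / \<beta>)"
  show ?thesis
  proof (rule that[of C])
    fix x y \<tau> and s :: real assume s: "0 < s" and xy: "\<rho> x y \<le> K * s"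
    define l where "l = k * s"
    define h where "h = a * l powr p"
    define \<tau>' where "\<tau>' = \<tau> + e * b * l powr p"
    have l: "0 < l" and sl: "s \<le> l" using s k mult_right_mono[of 1 k s] by (auto simp: l_def)
    have h: "0 < h" using a l by (simp add: h_def)
    let ?S = "tbox \<rho> x l \<tau> h" and ?S' = "tbox \<rho> x l \<tau>' h" and ?E = "tbox \<rho> y s \<tau>' h"
    have "K\<^sub>0 * (K * s + s) \<le> l" using mult_right_mono[OF k(2), of s] s by (simp add: l_def algebra_simps)
    then have ES: "?E \<subseteq> ?S'" using qball_subset[OF xy] by (auto simp: tbox_def)
    have "qball \<rho> x l \<subseteq> qball \<rho> y (K\<^sub>0 * (K + k) * s)"
      using xy sym[of x y] by (intro qball_subset[of _ _ "K * s"]) (auto simp: l_def algebra_simps)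
    then have "emeasure \<mu> (qball \<rho> x l) \<le> emeasure \<mu> (qball \<rho> y (K\<^sub>0 * (K + k) * s))"
      by (rule emeasure_mono) simp
    also have "\<dots> \<le> ennreal C0 * emeasure \<mu> (qball \<rho> y s)" by (rule C0(2)[OF s])
    finally have "emeasure \<mu> (qball \<rho> x l) * ennreal (2 * h) \<le> ennreal C0 * emeasure \<mu> (qball \<rho> y s) * ennreal (2 * h)"
      by (rule mult_right_mono) simp
    then have S'E: "emeasure M ?S' \<le> ennreal C0 * emeasure M ?E"
      using h by (simp add: emeasure_tbox mult.assoc)
    obtain m where m: "emeasure M ?S = ennreal m" "0 < m"
      using tbox_pos[OF l h, of x \<tau>] tbox_finite[OF l, of h x \<tau>] h by (cases "emeasure M ?S") auto
    have m': "emeasure M ?S' = ennreal m" using m h by (simp add: emeasure_tbox)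
    obtain n where n: "emeasure M ?E = ennreal n" "0 < n"
      using tbox_pos[OF s h, of y \<tau>'] tbox_finite[OF s, of h y \<tau>'] h by (cases "emeasure M ?E") auto
    have mn: "m \<le> C0 * n" using S'E C0 m n by (simp add: m' ennreal_mult[symmetric])
    \<comment> \<open>Shown for every level \<open>t\<close> strictly below the average; the average
      itself follows by squeezing a level in between, which also covers infinite mass.\<close>
    have main: "ennreal (t * m) \<le> ennreal C * emeasure ?\<nu> ?E" if t: "0 < t" "ennreal (t * m) < emeasure ?\<nu> ?S" for t
    proof -
      have "emeasure M ({z. w z \<le> \<beta> * t} \<inter> ?S') \<le> ennreal (1 / (2 * C0)) * emeasure M ?S'"
        using sd'[of l t x \<tau>] t l m by (simp add: h_def \<tau>'_def ennreal_mult)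
      also have "\<dots> = ennreal (1 / (2 * C0) * m)"
        using C0(1) m(2) unfolding m' by (intro ennreal_mult[symmetric]) auto
      also have "\<dots> \<le> ennreal (n / 2)"
        using mn C0(1) by (intro ennreal_leI) (simp add: field_simps)
      finally have small: "emeasure M ({z. w z \<le> \<beta> * t} \<inter> ?S') \<le> ennreal (n / 2)" .
      have "emeasure M ?E \<le> emeasure M (({z. \<beta> * t < w z} \<inter> ?E) \<union> ({z. w z \<le> \<beta> * t} \<inter> ?S'))"
        using ES by (intro emeasure_mono) auto
      also have "\<dots> \<le> emeasure M ({z. \<beta> * t < w z} \<inter> ?E) + emeasure M ({z. w z \<le> \<beta> * t} \<inter> ?S')"
        by (intro emeasure_subadditive) auto
      also have "\<dots> \<le> emeasure M ({z. \<beta> * t < w z} \<inter> ?E) + ennreal (n / 2)"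
        using small by (rule add_left_mono)
      finally have "ennreal (n / 2) + ennreal (n / 2) \<le> emeasure M ({z. \<beta> * t < w z} \<inter> ?E) + ennreal (n / 2)"
        using n by (simp flip: ennreal_plus)
      then have half: "ennreal (n / 2) \<le> emeasure M ({z. \<beta> * t < w z} \<inter> ?E)"
        by (simp add: add.commute ennreal_add_left_cancel_le)
      have "ennreal (\<beta> * t) * ennreal (n / 2) \<le> ennreal (\<beta> * t) * emeasure M ({z. \<beta> * t < w z} \<inter> ?E)"
        using half by (rule mult_left_mono) simp
      also have "\<dots> = (\<integral>\<^sup>+z. ennreal (\<beta> * t) * indicator ({z. \<beta> * t < w z} \<inter> ?E) z \<partial>M)"
        by (simp add: nn_integral_cmult_indicator)
      also have "\<dots> \<le> (\<integral>\<^sup>+z. ennreal (w z) * indicator ?E z \<partial>M)"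
        by (intro nn_integral_mono) (auto simp: indicator_def intro: ennreal_leI)
      also have "\<dots> = emeasure ?\<nu> ?E" by (simp add: emeasure_density)
      also have "ennreal (\<beta> * t) * ennreal (n / 2) = ennreal (\<beta> * t * (n / 2))"
        using \<beta> t n by (intro ennreal_mult[symmetric]) auto
      finally have *: "ennreal (\<beta> * t * (n / 2)) \<le> emeasure ?\<nu> ?E" .
      have "t * m \<le> C * (\<beta> * t * (n / 2))"
      proof -
        have "t * m \<le> t * (C0 * n)" using mn t by (intro mult_left_mono) auto
        also have "\<dots> = (2 * C0 / \<beta>) * (\<beta> * t * (n / 2))" using \<beta> by simp
        also have "\<dots> \<le> C * (\<beta> * t * (n / 2))" using \<beta> t n by (intro mult_right_mono) (auto simp: C_def)
        finally show ?thesis .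
      qed
      then have "ennreal (t * m) \<le> ennreal C * ennreal (\<beta> * t * (n / 2))"
        using \<beta> t n by (simp add: C_def flip: ennreal_mult)
      also have "\<dots> \<le> ennreal C * emeasure ?\<nu> ?E" using * by (rule mult_left_mono) simp
      finally show ?thesis .
    qed
    have "emeasure ?\<nu> ?S \<le> ennreal C * emeasure ?\<nu> ?E"
    proof (rule ccontr)
      assume "\<not> ?thesis"
      then obtain v where v: "0 < v" "ennreal C * emeasure ?\<nu> ?E < ennreal v" "ennreal v < emeasure ?\<nu> ?S"
        using ennreal_between[of "ennreal C * emeasure ?\<nu> ?E" "emeasure ?\<nu> ?S"] by (auto simp: not_le)
      then show False using main[of "v / m"] m by simp
    qed
    moreover have "tbox \<rho> x s \<tau> h \<subseteq> ?S" using sl by (auto simp: tbox_def qball_def)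
    then have "emeasure ?\<nu> (tbox \<rho> x s \<tau> h) \<le> emeasure ?\<nu> ?S"
      by (rule emeasure_mono) simp
    ultimately show "emeasure ?\<nu> (tbox \<rho> x s \<tau> (a * (2 * K\<^sub>0 * K * s) powr p)) \<le>
      ennreal C * emeasure ?\<nu> (tbox \<rho> y s (\<tau> + e * b * (2 * K\<^sub>0 * K * s) powr p) (a * (2 * K\<^sub>0 * K * s) powr p))"
      by (simp add: h_def \<tau>'_def l_def k_def)
  qed (simp add: C_def)
qed

lemma shift_chain:
  assumes C: "1 \<le> C" "\<And>x y \<tau>. \<rho> x y \<le> d \<Longrightarrow> \<phi> x \<tau> \<le> ennreal C * \<phi> y (\<tau> + g)"
    and \<xi>: "\<And>i. \<rho> (\<xi> i) (\<xi> (Suc i)) \<le> d"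
  shows "\<phi> (\<xi> 0) \<tau> \<le> ennreal (C ^ n) * \<phi> (\<xi> n) (\<tau> + real n * g)"
proof (induction n)
  case (Suc n)
  note Suc
  also have "ennreal (C ^ n) * \<phi> (\<xi> n) (\<tau> + real n * g) \<le>
      ennreal (C ^ n) * (ennreal C * \<phi> (\<xi> (Suc n)) (\<tau> + real n * g + g))"
    using C \<xi> by (intro mult_left_mono) auto
  also have "\<dots> = ennreal (C ^ Suc n) * \<phi> (\<xi> (Suc n)) (\<tau> + real (Suc n) * g)"
    using C by (simp add: ennreal_mult algebra_simps)
  finally show ?case .
qed simp

text \<open>Moving over a distance comparable to \<open>l\<close> takes about \<open>1 / \<sigma>\<close> steps of duration about
  \<open>(\<sigma> * l) powr p\<close>.  Since \<open>p > 1\<close>, the total duration is as small a fraction of \<open>l powr p\<close>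
  as needed, so no time lag is lost.\<close>

lemma shift_reach:
  fixes w :: "'a \<times> real \<Rightarrow> real"
  assumes w: "w \<in> borel_measurable M" and sd: "shift_dense e a b w" and e: "e = 1 \<or> e = -1"
    and ab: "0 < a" "a \<le> b" "a \<le> 1" and mg: "monotone_geodesic \<rho>" and c: "0 < c1" "0 < c2"
  obtains \<sigma> C where "0 < \<sigma>" "1 \<le> C" "\<sigma> \<le> c1" "\<sigma> \<le> 1"
    "\<And>x z l t \<tau>. 0 < l \<Longrightarrow> \<rho> x z \<le> c2 * l \<Longrightarrow> e * (\<tau> - t) \<le> 0 \<Longrightarrow> - (l powr p) \<le> e * (\<tau> - t) \<Longrightarrow>
      emeasure (density M w) (tbox \<rho> x (\<sigma> * l) \<tau> (a * (\<sigma> * l) powr p)) \<le>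
      ennreal C * emeasure (density M w) (qball \<rho> z (c1 * l) \<times> {s. 0 < e * (s - t) \<and> e * (s - t) < l powr p})"
proof -
  let ?\<nu> = "density M w"
  have qm: "quasi_metric \<rho> K\<^sub>0" by unfold_locales
  obtain K where K: "1 \<le> K" "\<And>s x y n. 0 < s \<Longrightarrow> 1 + \<rho> x y / s \<le> real n \<Longrightarrow>
    \<exists>\<xi>. \<xi> 0 = x \<and> \<xi> n = y \<and> (\<forall>i. \<rho> (\<xi> i) (\<xi> (Suc i)) \<le> K * s)"
    using monotone_geodesic_path[OF qm mg] by metis
  obtain Cs where Cs: "1 \<le> Cs" "\<And>x y \<tau> s. 0 < s \<Longrightarrow> \<rho> x y \<le> K * s \<Longrightarrow>
    emeasure ?\<nu> (tbox \<rho> x s \<tau> (a * (2 * K\<^sub>0 * K * s) powr p)) \<le>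
    ennreal Cs * emeasure ?\<nu> (tbox \<rho> y s (\<tau> + e * b * (2 * K\<^sub>0 * K * s) powr p) (a * (2 * K\<^sub>0 * K * s) powr p))"
    using shift_step[OF w sd ab(1) K(1)] by metis
  define k where "k = 2 * K\<^sub>0 * K"
  have "1 * 1 \<le> K\<^sub>0 * K" using K0_ge_1 K by (intro mult_mono) auto
  then have k: "1 \<le> k" by (simp add: k_def)
  have b: "0 < b" using ab by simp
  \<comment> \<open>\<open>B\<close> and \<open>\<sigma>\<close> are chosen backwards from
    \<open>g * (1 + c2) <= \<sigma> / 8\<close>, where \<open>g\<close> below is the duration of one
    step as a fraction of \<open>l powr p\<close>. As \<open>g\<close> is a multiple of
    \<open>\<sigma> powr p\<close>, this bounds \<open>\<sigma> powr (p - 1)\<close>, which can be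
    made small because \<open>p > 1\<close>.\<close>
  define B where "B = 8 * b * k powr p * (1 + c2)"
  have B: "0 < B" using b k c by (simp add: B_def)
  define \<sigma> where "\<sigma> = min (min 1 c1) ((1 / B) powr (1 / (p - 1)))"
  have \<sigma>: "0 < \<sigma>" "\<sigma> \<le> 1" "\<sigma> \<le> c1" "\<sigma> \<le> (1 / B) powr (1 / (p - 1))" using c B by (auto simp: \<sigma>_def)
  have "\<sigma> powr (p - 1) \<le> ((1 / B) powr (1 / (p - 1))) powr (p - 1)"
    using \<sigma> p_gt_1 by (intro powr_mono2) auto
  then have "\<sigma> powr (p - 1) \<le> 1 / B" using p_gt_1 B by (simp add: powr_powr)
  then have "b * k powr p * (1 + c2) * \<sigma> powr (p - 1) \<le> b * k powr p * (1 + c2) * (1 / B)"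
    using b k c by (intro mult_left_mono) auto
  also have "\<dots> = 1 / 8" using b k c by (simp add: B_def)
  finally have \<sigma>p: "b * k powr p * (1 + c2) * \<sigma> powr (p - 1) \<le> 1 / 8" .
  define g where "g = b * (k * \<sigma>) powr p"
  have g0: "0 < g" using b k \<sigma> by (simp add: g_def)
  have "\<sigma> powr p = \<sigma> powr (p - 1) * \<sigma>" using \<sigma> by (simp add: powr_diff)
  then have g_eq: "g = b * k powr p * \<sigma> powr (p - 1) * \<sigma>" using k \<sigma> by (simp add: g_def powr_mult)
  have g_c: "g * (1 + c2) \<le> \<sigma> / 8"
    using mult_right_mono[OF \<sigma>p, of \<sigma>] \<sigma> by (simp add: g_eq mult_ac)
  have "g * 1 \<le> g * (1 + c2)" using g0 c by (intro mult_left_mono) auto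
  then have g8: "g \<le> 1 / 8" using g_c \<sigma> by linarith
  define N where "N = nat \<lceil>5 / (4 * g)\<rceil>"
  show ?thesis
  proof (rule that[of \<sigma> "Cs ^ N"])
    fix x z and l t \<tau> :: real assume l: "0 < l" and xz: "\<rho> x z \<le> c2 * l"
      and \<tau>: "e * (\<tau> - t) \<le> 0" "- (l powr p) \<le> e * (\<tau> - t)"
    define L where "L = l powr p"
    have L: "0 < L" using l by (simp add: L_def)
    define u where "u = - (e * (\<tau> - t)) / L"
    have u: "0 \<le> u" "u \<le> 1" "e * (\<tau> - t) = - u * L" using \<tau> L by (auto simp: u_def L_def field_simps)
    \<comment> \<open>Time fixes the number of steps. In the direction \<open>e\<close>, the start
      lies \<open>u * L\<close> before \<open>t\<close>; \<open>n\<close> steps of duration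
      \<open>g * L\<close> end between \<open>L / 4\<close> and \<open>L / 4 + g * L\<close> after
      \<open>t\<close>. The half-height of the box is at most \<open>g * L <= L / 8\<close>, so it
      stays inside the target interval.\<close>
    define n where "n = nat \<lceil>(1 / 4 + u) / g\<rceil>"
    have "0 \<le> (1 / 4 + u) / g" using u g0 by simp
    then have n: "(1 / 4 + u) / g \<le> real n" "real n < (1 / 4 + u) / g + 1" unfolding n_def by linarith+
    have ng: "1 / 4 + u \<le> real n * g" "real n * g < 1 / 4 + u + g"
      using n g0 by (auto simp: field_simps)
    have nN: "n \<le> N"
    proof -
      have "(1 / 4 + u) / g \<le> 5 / (4 * g)" using u g0 by (simp add: field_simps)
      then show ?thesis unfolding n_def N_def by (intro nat_mono ceiling_mono)
    qed
    define s where "s = \<sigma> * l"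
    have s: "0 < s" using \<sigma> l by (simp add: s_def)
    \<comment> \<open>The same number of steps is enough to cover the distance, which is where
      \<open>g * (1 + c2) <= \<sigma> / 8\<close> enters; surplus steps are spent at
      \<open>z\<close>.\<close>
    have "1 + \<rho> x z / s \<le> 1 + c2 / \<sigma>" using xz \<sigma> l by (simp add: s_def field_simps)
    also have "\<dots> \<le> (1 + c2) / \<sigma>" using \<sigma> c by (simp add: field_simps)
    also have "\<dots> \<le> 1 / (8 * g)" using g_c g0 \<sigma> by (simp add: field_simps)
    also have "\<dots> \<le> (1 / 4 + u) / g" using g0 u by (simp add: field_simps)
    finally have "1 + \<rho> x z / s \<le> real n" using n by linarith
    then obtain \<xi> where \<xi>: "\<xi> 0 = x" "\<xi> n = z" "\<And>i. \<rho> (\<xi> i) (\<xi> (Suc i)) \<le> K * s"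
      using K(2)[OF s] by blast
    define h where "h = a * (k * s) powr p"
    have gL: "b * (k * s) powr p = g * L" using k \<sigma> l by (simp add: g_def s_def L_def powr_mult)
    have hg: "h \<le> g * L" unfolding gL[symmetric] h_def using ab by (intro mult_right_mono) auto
    have gL8: "g * L \<le> L / 8" using mult_right_mono[OF g8, of L] L by simp
    have ek: "e * b * (k * s) powr p = e * (g * L)" using gL by (simp add: mult.assoc)
    have "emeasure ?\<nu> (tbox \<rho> (\<xi> 0) s \<tau> h) \<le> ennreal (Cs ^ n) * emeasure ?\<nu> (tbox \<rho> (\<xi> n) s (\<tau> + real n * (e * (g * L))) h)"
    proof (rule shift_chain[where \<phi> = "\<lambda>x \<tau>. emeasure ?\<nu> (tbox \<rho> x s \<tau> h)"])
      fix x y \<tau> assume "\<rho> x y \<le> K * s"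
      from Cs(2)[OF s this, of \<tau>]
      show "emeasure ?\<nu> (tbox \<rho> x s \<tau> h) \<le> ennreal Cs * emeasure ?\<nu> (tbox \<rho> y s (\<tau> + e * (g * L)) h)"
        by (simp add: k_def[symmetric] h_def ek)
    qed (use Cs \<xi> in auto)
    also have "\<dots> \<le> ennreal (Cs ^ N) * emeasure ?\<nu> (qball \<rho> z (c1 * l) \<times> {s. 0 < e * (s - t) \<and> e * (s - t) < l powr p})"
    proof (intro mult_mono emeasure_mono)
      show "ennreal (Cs ^ n) \<le> ennreal (Cs ^ N)" using Cs nN by (intro ennreal_leI power_increasing) auto
      have "s \<le> c1 * l" using \<sigma> l by (simp add: s_def)
      moreover have "0 < e * (r - t) \<and> e * (r - t) < l powr p"
        if r: "\<tau> + real n * (e * (g * L)) - h < r" "r < \<tau> + real n * (e * (g * L)) + h" for r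
      proof -
        define G T U where "G = g * L" and "T = real n * (g * L)" and "U = u * L"
        have "(1 / 4 + u) * L \<le> real n * g * L" using ng L by (intro mult_right_mono) auto
        then have T1: "L / 4 + U \<le> T" by (simp add: T_def U_def algebra_simps)
        have "real n * g * L < (1 / 4 + u + g) * L" using ng L by (intro mult_strict_right_mono) auto
        then have T2: "T < L / 4 + U + G" by (simp add: G_def T_def U_def algebra_simps)
        have r': "\<tau> + e * T - h < r" "r < \<tau> + e * T + h" using r by (simp_all add: T_def mult.left_commute)
        have "h \<le> G" "G \<le> L / 8" "e * (\<tau> - t) = - U"
          using hg gL8 u(3) by (simp_all only: G_def U_def minus_mult_left)
        with e r' T1 T2 L show ?thesis unfolding L_def[symmetric] by auto
      qed
      ultimately show "tbox \<rho> (\<xi> n) s (\<tau> + real n * (e * (g * L))) h \<subseteq> qball \<rho> z (c1 * l) \<times> {s. 0 < e * (s - t) \<and> e * (s - t) < l powr p}"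
        by (auto simp: tbox_def qball_def \<xi>)
      have "{s. 0 < e * (s - t) \<and> e * (s - t) < l powr p} = (if e = 1 then {t<..<t + l powr p} else {t - l powr p<..<t})"
        using e by auto
      then show "qball \<rho> z (c1 * l) \<times> {s. 0 < e * (s - t) \<and> e * (s - t) < l powr p} \<in> sets ?\<nu>" by simp
    qed auto
    finally have "emeasure ?\<nu> (tbox \<rho> x s \<tau> h) \<le> \<dots>" by (simp add: \<xi>)
    moreover have "(\<sigma> * l) powr p \<le> (k * s) powr p"
      using k s p_gt_1 mult_right_mono[of 1 k s] by (intro powr_mono2) (auto simp: s_def)
    then have "a * (\<sigma> * l) powr p \<le> h" using ab by (simp add: h_def)
    then have "tbox \<rho> x (\<sigma> * l) \<tau> (a * (\<sigma> * l) powr p) \<subseteq> tbox \<rho> x s \<tau> h"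
      by (auto simp: tbox_def s_def)
    then have "emeasure ?\<nu> (tbox \<rho> x (\<sigma> * l) \<tau> (a * (\<sigma> * l) powr p)) \<le> emeasure ?\<nu> (tbox \<rho> x s \<tau> h)"
      by (intro emeasure_mono) auto
    ultimately show "emeasure ?\<nu> (tbox \<rho> x (\<sigma> * l) \<tau> (a * (\<sigma> * l) powr p)) \<le>
      ennreal (Cs ^ N) * emeasure ?\<nu> (qball \<rho> z (c1 * l) \<times> {s. 0 < e * (s - t) \<and> e * (s - t) < l powr p})"
      by (rule order.trans[rotated])
  qed (use \<sigma> Cs one_le_power[of Cs N] in auto)
qed

end

section \<open>The reverse inequality on half rectangles\<close>

lemma epowr_le_ennreal: "x \<le> ennreal y \<Longrightarrow> 0 \<le> y \<Longrightarrow> 0 < r \<Longrightarrow> epowr x r \<le> ennreal (y powr r)"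
  by (cases x) (auto simp: epowr_def top_unique intro!: ennreal_leI powr_mono2)

text \<open>Written with a sign so that both weights share one proof: \<open>e\<close> selects the
  half towards which \<open>shift_dense e\<close> moves mass, \<open>-e\<close> the other
  one.\<close>

definition half_interval :: "real \<Rightarrow> real \<Rightarrow> real \<Rightarrow> real set" where
  "half_interval e t L = {s. 0 < e * (s - t) \<and> e * (s - t) < L}"

lemma half_interval_eq:
  "half_interval 1 t L = {t<..<t + L}" "half_interval (-1) t L = {t - L<..<t}"
  by (auto simp: half_interval_def)

context parabolic
begin

text \<open>Balls of \<open>par_dist\<close> have half-height \<open>r powr p\<close>, the cylinders
  in \<open>shift_dense\<close> only \<open>a * l powr p\<close>. Choosing \<open>l\<close> with
  \<open>a * l powr p = r powr p\<close> gives a wider cylinder of the same height, at the price of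
  a doubling factor in the average. The direction of time is forgotten: the shifted cylinder merely
  lies in a larger concentric ball.\<close>

lemma shift_dense_imp_dense:
  fixes w :: "'a \<times> real \<Rightarrow> real"
  assumes w[measurable]: "w \<in> borel_measurable M" and sd: "shift_dense e a b w" and e: "e = 1 \<or> e = -1"
    and ab: "0 < a" "a \<le> 1" "0 \<le> b"
  obtains \<Lambda> \<beta> where "1 \<le> \<Lambda>" "0 < \<beta>" "\<beta> \<le> 1"
    "\<And>Y r s. 0 < r \<Longrightarrow> 0 < s \<Longrightarrow>
      ennreal s * emeasure M (qball (par_dist \<rho> p) Y r) < emeasure (density M w) (qball (par_dist \<rho> p) Y r) \<Longrightarrow>
      ennreal (1 / 2) * emeasure M (qball (par_dist \<rho> p) Y r)
        \<le> emeasure M ({y. \<beta> * s < w y} \<inter> qball (par_dist \<rho> p) Y (\<Lambda> * r))"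
proof -
  let ?\<nu> = "density M w"
  obtain C0 where C0: "1 \<le> C0" "\<And>x r. 0 < r \<Longrightarrow> emeasure \<mu> (qball \<rho> x ((1 / a) powr (1 / p) * r)) \<le> ennreal C0 * emeasure \<mu> (qball \<rho> x r)"
    using mu_doubling by metis
  obtain \<beta> where \<beta>: "0 < \<beta>" and sd': "\<And>x \<tau> l s. 0 < l \<Longrightarrow> 0 < s \<Longrightarrow>
     ennreal s * emeasure M (tbox \<rho> x l \<tau> (a * l powr p)) < emeasure ?\<nu> (tbox \<rho> x l \<tau> (a * l powr p)) \<Longrightarrow>
     emeasure M ({y. w y \<le> \<beta> * s} \<inter> tbox \<rho> x l (\<tau> + e * b * l powr p) (a * l powr p))
       \<le> ennreal (1 / 2) * emeasure M (tbox \<rho> x l (\<tau> + e * b * l powr p) (a * l powr p))"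
    using sd unfolding shift_dense_def by (meson half_gt_zero zero_less_one)
  have [measurable]: "{y. w y \<le> c} \<in> sets M" "{y. c < w y} \<in> sets M" for c
    using measurable_sets[OF w, of "{..c}"] measurable_sets[OF w, of "{c<..}"]
    by (simp_all add: space_M vimage_def)
  define \<beta>' where "\<beta>' = min 1 (\<beta> / C0)"
  \<comment> \<open>Chosen so that \<open>(\<Lambda> * r) powr p = (1 + a + b) * l powr p\<close>:
    room for the shift \<open>b * l powr p\<close> and the half-height \<open>a * l powr p\<close>,
    while the 1 ensures \<open>\<Lambda> * r >= l\<close>.\<close>
  define \<Lambda> where "\<Lambda> = ((1 + a + b) / a) powr (1 / p)"
  have \<Lambda>p: "\<Lambda> powr p = (1 + a + b) / a" using ab p_gt_1 by (simp add: \<Lambda>_def powr_powr)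
  show ?thesis
  proof (rule that[of \<Lambda> \<beta>'])
    show "1 \<le> \<Lambda>" using ab p_gt_1 unfolding \<Lambda>_def by (intro ge_one_powr_ge_zero) auto
    show "0 < \<beta>'" "\<beta>' \<le> 1" using \<beta> C0(1) by (auto simp: \<beta>'_def)
    fix Y :: "'a \<times> real" and r s :: real
    assume r: "0 < r" and s: "0 < s"
      and bad: "ennreal s * emeasure M (qball (par_dist \<rho> p) Y r) < emeasure ?\<nu> (qball (par_dist \<rho> p) Y r)"
    obtain x t where Y: "Y = (x, t)" by (cases Y)
    define l where "l = (1 / a) powr (1 / p) * r"
    have "1 \<le> (1 / a) powr (1 / p)" using ab p_gt_1 by (intro ge_one_powr_ge_zero) auto
    then have "1 * r \<le> l" unfolding l_def using r by (intro mult_right_mono) auto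
    then have rl: "r \<le> l" "0 < l" using r by auto
    have lp: "l powr p = r powr p / a" using ab r p_gt_1 by (simp add: l_def powr_mult powr_powr)
    then have alp: "a * l powr p = r powr p" using ab by simp
    define t' where "t' = t + e * b * l powr p"
    let ?B = "qball (par_dist \<rho> p) Y r" and ?S = "tbox \<rho> x l t (r powr p)" and ?S' = "tbox \<rho> x l t' (r powr p)"
    have B: "?B = tbox \<rho> x r t (r powr p)" using r by (simp add: Y qball_par_dist)
    have BS: "?B \<subseteq> ?S" unfolding B using rl by (auto simp: tbox_def qball_def)
    obtain m where m: "emeasure M ?B = ennreal m" "0 < m"
      using tbox_pos[OF r, of "r powr p" x t] tbox_finite[OF r, of "r powr p" x t] r
      unfolding B by (cases "emeasure M (tbox \<rho> x r t (r powr p))") auto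
    obtain n where n: "emeasure M ?S = ennreal n" "0 < n"
      using tbox_pos[OF rl(2), of "r powr p" x t] tbox_finite[OF rl(2), of "r powr p" x t] r
      by (cases "emeasure M ?S") auto
    have n': "emeasure M ?S' = ennreal n" using n by (simp add: emeasure_tbox)
    have "emeasure M ?S \<le> ennreal C0 * emeasure \<mu> (qball \<rho> x r) * ennreal (2 * r powr p)"
      using C0(2)[OF r, of x] by (simp add: emeasure_tbox l_def mult_right_mono)
    also have "\<dots> = ennreal C0 * emeasure M ?B" by (simp add: B emeasure_tbox mult.assoc)
    finally have "ennreal n \<le> ennreal (C0 * m)" using m n C0 by (simp add: ennreal_mult)
    then have nm: "n \<le> C0 * m" using C0(1) m by (subst (asm) ennreal_le_iff) auto
    have mn: "m \<le> n" using emeasure_mono[OF BS, of M] m n by simp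
    have "ennreal (s / C0) * emeasure M ?S = ennreal (s / C0 * n)"
      unfolding n(1) using s C0(1) n(2) by (intro ennreal_mult[symmetric]) auto
    also have "\<dots> \<le> ennreal (s * m)"
    proof (rule ennreal_leI)
      have "s / C0 * n \<le> s / C0 * (C0 * m)" using nm s C0(1) by (intro mult_left_mono) auto
      then show "s / C0 * n \<le> s * m" using C0(1) by simp
    qed
    also have "\<dots> = ennreal s * emeasure M ?B" using s m by (simp add: ennreal_mult)
    also note bad
    also have "emeasure ?\<nu> ?B \<le> emeasure ?\<nu> ?S" using BS by (rule emeasure_mono) simp
    finally have "emeasure M ({y. w y \<le> \<beta> * (s / C0)} \<inter> ?S') \<le> ennreal (1 / 2) * emeasure M ?S'"
      using sd'[of l "s / C0" x t] rl s C0(1) by (simp add: alp t'_def)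
    also have "\<dots> = ennreal (1 / 2 * n)"
      unfolding n' using n by (intro ennreal_mult[symmetric]) auto
    also have "\<dots> = ennreal (n / 2)" by simp
    finally have small: "emeasure M ({y. w y \<le> \<beta> * (s / C0)} \<inter> ?S') \<le> ennreal (n / 2)" .
    let ?W = "{y. \<beta> * (s / C0) < w y} \<inter> ?S'"
    have "emeasure M ?S' \<le> emeasure M (?W \<union> ({y. w y \<le> \<beta> * (s / C0)} \<inter> ?S'))"
      by (intro emeasure_mono) auto
    also have "\<dots> \<le> emeasure M ?W + emeasure M ({y. w y \<le> \<beta> * (s / C0)} \<inter> ?S')"
      by (intro emeasure_subadditive) auto
    also have "\<dots> \<le> emeasure M ?W + ennreal (n / 2)" using small by (rule add_left_mono)
    finally have "ennreal (n / 2) + ennreal (n / 2) \<le> emeasure M ?W + ennreal (n / 2)"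
      using n n' by (simp flip: ennreal_plus)
    then have half: "ennreal (n / 2) \<le> emeasure M ?W"
      by (simp add: add.commute ennreal_add_left_cancel_le)
    have "ennreal (1 / 2) * emeasure M ?B = ennreal (1 / 2 * m)"
      unfolding m(1) using m(2) by (intro ennreal_mult[symmetric]) auto
    also have "\<dots> \<le> ennreal (n / 2)" using mn by (intro ennreal_leI) simp
    also note half
    also have "emeasure M ?W \<le> emeasure M ({y. \<beta>' * s < w y} \<inter> qball (par_dist \<rho> p) Y (\<Lambda> * r))"
    proof (rule emeasure_mono)
      have "\<beta>' * s \<le> \<beta> / C0 * s" unfolding \<beta>'_def using s by (intro mult_right_mono) auto
      then have "{y. \<beta> * (s / C0) < w y} \<subseteq> {y. \<beta>' * s < w y}" by auto
      moreover have "?S' \<subseteq> qball (par_dist \<rho> p) Y (\<Lambda> * r)"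
      proof -
        have "(1 / a) powr (1 / p) \<le> \<Lambda>"
          unfolding \<Lambda>_def using ab p_gt_1 by (intro powr_mono2 divide_right_mono) auto
        then have l: "l \<le> \<Lambda> * r" unfolding l_def using r by (intro mult_right_mono) auto
        have "(\<Lambda> * r) powr p = (1 + a + b) * l powr p"
          using r \<Lambda>p ab by (simp add: powr_mult lp \<Lambda>_def) 
        also have "\<dots> = l powr p + r powr p + b * l powr p" by (simp add: alp[symmetric] algebra_simps)
        finally have "(\<Lambda> * r) powr p \<ge> r powr p + b * l powr p" by simp
        moreover have "0 \<le> b * l powr p" using ab by simp
        moreover have \<Lambda>r: "0 < \<Lambda> * r" using l rl by linarith
        ultimately show ?thesis
          using e l unfolding Y qball_par_dist[OF \<Lambda>r] by (auto simp: tbox_def t'_def qball_def)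
      qed
      ultimately show "?W \<subseteq> {y. \<beta>' * s < w y} \<inter> qball (par_dist \<rho> p) Y (\<Lambda> * r)" by blast
      have "0 < \<Lambda> * r" using r ab p_gt_1 by (simp add: \<Lambda>_def)
      then show "{y. \<beta>' * s < w y} \<inter> qball (par_dist \<rho> p) Y (\<Lambda> * r) \<in> sets M"
        by (simp add: Y qball_par_dist)
    qed
    finally show "ennreal (1 / 2) * emeasure M ?B \<le> emeasure M ({y. \<beta>' * s < w y} \<inter> qball (par_dist \<rho> p) Y (\<Lambda> * r))" .
  qed
qed

lemma half_interval_sets:
  assumes "e = 1 \<or> e = -1" "B \<in> sets \<mu>"
  shows "B \<times> half_interval e t L \<in> sets M"
    and "0 \<le> L \<Longrightarrow> emeasure M (B \<times> half_interval e t L) = emeasure \<mu> B * ennreal L"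
  using assms by (auto simp: half_interval_eq emeasure_Times_interval)

text \<open>The local inequality is applied on balls of radius \<open>\<eta> * l\<close> centred in
  the half \<open>-e\<close>; \<open>shift_reach\<close> bounds the mass of their enlargements by
  that of the half \<open>e\<close>, and a covering puts the balls together. \<open>S\<close> is
  squeezed between two balls, which is how dyadic cubes are known.\<close>

lemma reverse_holder_half:
  fixes w :: "'a \<times> real \<Rightarrow> real"
  assumes w[measurable]: "w \<in> borel_measurable M" and w0: "\<And>y. 0 \<le> w y" and wpos: "AE y in M. 0 < w y"
    and sd: "shift_dense e a b w" and e: "e = 1 \<or> e = -1"
    and ab: "0 < a" "a \<le> b" "a \<le> 1" and mg: "monotone_geodesic \<rho>" and c: "0 < c1" "0 < c2"
  shows "\<exists>\<kappa>\<^sub>0>0. \<forall>\<kappa>. 0 < \<kappa> \<longrightarrow> \<kappa> \<le> \<kappa>\<^sub>0 \<longrightarrow> (\<exists>C>0. \<forall>z l S t. 0 < l \<longrightarrow> S \<in> sets \<mu> \<longrightarrow>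
    qball \<rho> z (c1 * l) \<subseteq> S \<longrightarrow> S \<subseteq> qball \<rho> z (c2 * l) \<longrightarrow>
    epowr (avg M (S \<times> half_interval (-e) t (l powr p)) (\<lambda>y. w y powr (\<kappa> + 1))) (1 / (\<kappa> + 1))
      \<le> ennreal C * avg M (S \<times> half_interval e t (l powr p)) w)"
proof -
  let ?\<nu> = "density M w" and ?B = "qball (par_dist \<rho> p)"
  obtain D where "regular_doubling (par_dist \<rho> p) (2 * K\<^sub>0) M D" using regular_doubling_par by blast
  then interpret P: regular_doubling "par_dist \<rho> p" "2 * K\<^sub>0" M D .
  define A where "A = 8 * (2 * K\<^sub>0) ^ 3"
  define T where "T = 5 * (2 * K\<^sub>0)\<^sup>2"
  have "1 \<le> (2 * K\<^sub>0) ^ n" for n using K0_ge_1 by (intro one_le_power) simp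
  from this[of 3] this[of 2] have AT: "1 \<le> A" "1 \<le> T" by (auto simp: A_def T_def)
  have b: "0 \<le> b" using ab by simp
  obtain \<Lambda> \<beta> where dense: "1 \<le> \<Lambda>" "0 < \<beta>" "\<beta> \<le> 1"
    "\<And>Y r s. 0 < r \<Longrightarrow> 0 < s \<Longrightarrow> ennreal s * emeasure M (?B Y r) < emeasure ?\<nu> (?B Y r) \<Longrightarrow>
      ennreal (1 / 2) * emeasure M (?B Y r) \<le> emeasure M ({y. \<beta> * s < w y} \<inter> ?B Y (\<Lambda> * r))"
    using shift_dense_imp_dense[OF w sd e ab(1,3) b] by metis
  define local_rh where "local_rh \<kappa> C \<longleftrightarrow> (\<forall>Y R X. 0 < R \<longrightarrow> 0 < X \<longrightarrow>
    emeasure ?\<nu> (?B Y (A * R)) \<le> ennreal X * emeasure M (?B Y R) \<longrightarrow>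
    (\<integral>\<^sup>+y\<in>?B Y R. ennreal (w y powr (\<kappa> + 1)) \<partial>M) \<le> ennreal (C * X powr (\<kappa> + 1)) * emeasure M (?B Y R))" for \<kappa> C
  have "\<exists>\<kappa>\<^sub>0>0. \<forall>\<kappa>. 0 < \<kappa> \<longrightarrow> \<kappa> \<le> \<kappa>\<^sub>0 \<longrightarrow> (\<exists>C>0. local_rh \<kappa> C)"
    unfolding A_def local_rh_def by (rule P.reverse_holder[OF w w0 dense(1) _ dense(2,3,4)]) simp_all
  then obtain \<kappa>0 where \<kappa>0: "0 < \<kappa>0" and rh: "\<And>\<kappa>. 0 < \<kappa> \<Longrightarrow> \<kappa> \<le> \<kappa>0 \<Longrightarrow> \<exists>C>0. local_rh \<kappa> C"
    by blast
  obtain \<sigma> Cr where \<sigma>: "0 < \<sigma>" "1 \<le> Cr" "\<sigma> \<le> c1" "\<sigma> \<le> 1"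
    and reach: "\<And>x z l t \<tau>. 0 < l \<Longrightarrow> \<rho> x z \<le> c2 * l \<Longrightarrow> e * (\<tau> - t) \<le> 0 \<Longrightarrow> - (l powr p) \<le> e * (\<tau> - t) \<Longrightarrow>
      emeasure ?\<nu> (tbox \<rho> x (\<sigma> * l) \<tau> (a * (\<sigma> * l) powr p)) \<le>
      ennreal Cr * emeasure ?\<nu> (qball \<rho> z (c1 * l) \<times> half_interval e t (l powr p))"
    by (rule shift_reach[OF w sd e ab mg c, folded half_interval_def]) (rule that)
  \<comment> \<open>With \<open>A * \<eta> = a powr (1 / p) * \<sigma>\<close>, a ball of radius
    \<open>A * \<eta> * l\<close> has half-height \<open>a * (\<sigma> * l) powr p\<close> and
    radius at most \<open>\<sigma> * l\<close>, so it fits into the box that can be carried to the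
    other half.\<close>
  define \<eta> where "\<eta> = a powr (1 / p) * \<sigma> / A"
  have \<eta>: "0 < \<eta>" using ab \<sigma> AT by (simp add: \<eta>_def)
  have A\<eta>: "A * \<eta> = a powr (1 / p) * \<sigma>" using AT by (simp add: \<eta>_def)
  have a1: "a powr (1 / p) \<le> 1" using ab p_gt_1 powr_mono2[of "1 / p" a 1] by simp
  then have A\<eta>\<sigma>: "A * \<eta> \<le> \<sigma>" using mult_right_mono[OF a1, of \<sigma>] \<sigma> A\<eta> by simp
  have "1 * \<eta> \<le> A * \<eta>" using AT \<eta> by (intro mult_right_mono) auto
  then have \<eta>1: "\<eta> \<le> 1" using A\<eta>\<sigma> \<sigma> by simp
  obtain DT where DT: "1 \<le> DT" "\<And>Y r. 0 < r \<Longrightarrow> emeasure M (?B Y (T * r)) \<le> ennreal DT * emeasure M (?B Y r)"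
    using P.doubling_factor by metis
  obtain Cq where Cq: "1 \<le> Cq" "\<And>x r. 0 < r \<Longrightarrow> emeasure \<mu> (qball \<rho> x (2 * K\<^sub>0 * c2 / \<eta> * r)) \<le> ennreal Cq * emeasure \<mu> (qball \<rho> x r)"
    using mu_doubling by metis
  obtain Cw where Cw: "1 \<le> Cw" "\<And>x r. 0 < r \<Longrightarrow> emeasure \<mu> (qball \<rho> x (K\<^sub>0 * (c2 + 1) / c1 * r)) \<le> ennreal Cw * emeasure \<mu> (qball \<rho> x r)"
    using mu_doubling by metis
  \<comment> \<open>The measure of a half rectangle is at most \<open>Cb\<close> times that of any
    ball of radius \<open>\<eta> * l\<close> centred in the half \<open>-e\<close>.\<close>
  define Cb where "Cb = Cq / (2 * \<eta> powr p)"
  have Cb: "0 < Cb" using Cq(1) \<eta> by (simp add: Cb_def)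
  show ?thesis
  proof (rule exI[of _ \<kappa>0], intro conjI allI impI)
    fix \<kappa> assume \<kappa>: "0 < \<kappa>" "\<kappa> \<le> \<kappa>0"
    obtain Ck where Ck0: "0 < Ck" "local_rh \<kappa> Ck" using rh[OF \<kappa>] by blast
    note Ck = Ck0(1) Ck0(2)[unfolded local_rh_def, rule_format]
    define E where "E = Ck * DT * 4 * Cw"
    have E: "0 < E" using Ck(1) DT(1) Cw(1) by (simp add: E_def)
    define C where "C = E powr (1 / (\<kappa> + 1)) * Cr * Cb"
    have C: "0 < C" using E \<sigma> Cb by (simp add: C_def)
    show "\<exists>C>0. \<forall>z l S t. 0 < l \<longrightarrow> S \<in> sets \<mu> \<longrightarrow>
      qball \<rho> z (c1 * l) \<subseteq> S \<longrightarrow> S \<subseteq> qball \<rho> z (c2 * l) \<longrightarrow>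
      epowr (avg M (S \<times> half_interval (-e) t (l powr p)) (\<lambda>y. w y powr (\<kappa> + 1))) (1 / (\<kappa> + 1))
        \<le> ennreal C * avg M (S \<times> half_interval e t (l powr p)) w"
    proof (rule exI[of _ C], intro conjI allI impI)
      fix z l S t assume l: "0 < l" and S[measurable]: "S \<in> sets \<mu>"
        and inner: "qball \<rho> z (c1 * l) \<subseteq> S" and outer: "S \<subseteq> qball \<rho> z (c2 * l)"
      define L where "L = l powr p"
      have L: "0 < L" using l by (simp add: L_def)
      let ?P = "S \<times> half_interval (-e) t L" and ?Q = "S \<times> half_interval e t L"
      have e': "- e = 1 \<or> - e = -1" using e by auto
      have PQ[measurable]: "?P \<in> sets M" "?Q \<in> sets M"
        using half_interval_sets(1)[OF e S] half_interval_sets(1)[OF e' S] by auto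
      have "emeasure \<mu> S \<le> emeasure \<mu> (qball \<rho> z (c2 * l))" using outer by (rule emeasure_mono) simp
      also have "\<dots> < \<infinity>" using c l by (intro mu_finite) simp
      finally have "emeasure \<mu> S < \<infinity>" .
      moreover have "0 < emeasure \<mu> (qball \<rho> z (c1 * l))" using c l by (intro mu_pos) simp
      then have "0 < emeasure \<mu> S" using emeasure_mono[OF inner S] by (rule less_le_trans)
      ultimately obtain m where m: "emeasure \<mu> S = ennreal m" "0 < m" by (cases "emeasure \<mu> S") auto
      have MP: "emeasure M ?P = ennreal (m * L)" "emeasure M ?Q = ennreal (m * L)"
        using half_interval_sets(2)[OF e S, of L t] half_interval_sets(2)[OF e' S, of L t] L m
        by (simp_all add: ennreal_mult)
      have mL: "0 < m * L" using m L by simp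
      have avgQ: "avg M ?Q w = emeasure ?\<nu> ?Q / ennreal (m * L)"
        by (simp add: avg_def MP emeasure_density)
      have "epowr (avg M ?P (\<lambda>y. w y powr (\<kappa> + 1))) (1 / (\<kappa> + 1)) \<le> ennreal C * avg M ?Q w"
      proof (cases "emeasure ?\<nu> ?Q = \<infinity>")
        case True
        then have "ennreal C * avg M ?Q w = \<infinity>"
          using C mL by (simp add: avgQ ennreal_top_divide ennreal_mult_eq_top_iff)
        then show ?thesis by simp
      next
        case False
        have "emeasure ?\<nu> ?Q \<noteq> 0"
        proof
          assume "emeasure ?\<nu> ?Q = 0"
          then have "AE y in M. ennreal (w y) * indicator ?Q y = 0"
            by (simp add: emeasure_density nn_integral_0_iff_AE)
          with wpos have "AE y in M. y \<notin> ?Q" by eventually_elim (auto simp: indicator_def split: if_splits)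
          then have "emeasure M ?Q = 0" by (subst (asm) AE_iff_measurable[OF PQ(2)]) (auto simp: space_M)
          then show False using MP m(2) L by simp
        qed
        then obtain v where v: "emeasure ?\<nu> ?Q = ennreal v" "0 < v"
          using False by (cases "emeasure ?\<nu> ?Q") (auto simp: less_le)
        \<comment> \<open>\<open>Cr * v\<close> bounds the mass of the enlarged ball about each
          point of \<open>?P\<close>, and \<open>Cb / (m * L)\<close> makes this bound relative to
          the measure of the ball.\<close>
        define X where "X = Cr * Cb * v / (m * L)"
        have X: "0 < X" using \<sigma> Cb v mL by (simp add: X_def)
        define R where "R = \<eta> * l"
        have R: "0 < R" "R \<le> l" using \<eta> \<eta>1 l by (auto simp: R_def)
        have "R powr p = \<eta> powr p * L" using \<eta> l by (simp add: R_def L_def powr_mult)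
        moreover have "R powr p \<le> L" unfolding L_def using R p_gt_1 by (intro powr_mono2) auto
        ultimately have RL: "R powr p = \<eta> powr p * L" "R powr p \<le> L" .
        have local: "(\<integral>\<^sup>+y\<in>?B Y R. ennreal (w y powr (\<kappa> + 1)) \<partial>M) \<le> ennreal (Ck * X powr (\<kappa> + 1)) * emeasure M (?B Y R)"
          if Y: "Y \<in> ?P" for Y
        proof (rule Ck(2)[OF R(1) X])
          obtain x \<tau> where xt: "Y = (x, \<tau>)" by (cases Y)
          have xS: "x \<in> S" and \<tau>: "- L < e * (\<tau> - t)" "e * (\<tau> - t) < 0"
            using Y by (auto simp: xt half_interval_def)
          have zx: "\<rho> z x < c2 * l" using xS outer by (auto simp: qball_def)
          have "emeasure ?\<nu> (?B Y (A * R)) \<le> emeasure ?\<nu> (tbox \<rho> x (\<sigma> * l) \<tau> (a * (\<sigma> * l) powr p))"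
          proof (rule emeasure_mono)
            have AR: "A * R = a powr (1 / p) * (\<sigma> * l)" using A\<eta> by (simp add: R_def mult.assoc[symmetric])
            have "0 < A * R" using AT R by simp
            moreover have "(A * R) powr p = a * (\<sigma> * l) powr p"
              unfolding AR using ab \<sigma> l p_gt_1 by (simp add: powr_mult powr_powr)
            moreover have "A * R \<le> \<sigma> * l" unfolding AR using mult_right_mono[OF a1, of "\<sigma> * l"] \<sigma> l by simp
            ultimately show "?B Y (A * R) \<subseteq> tbox \<rho> x (\<sigma> * l) \<tau> (a * (\<sigma> * l) powr p)"
              unfolding xt by (subst qball_par_dist) (auto simp: tbox_def qball_def)
          qed simp
          also have "\<dots> \<le> ennreal Cr * emeasure ?\<nu> (qball \<rho> z (c1 * l) \<times> half_interval e t L)"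
            unfolding L_def using zx sym[of x z] \<tau> l by (intro reach) (auto simp: L_def)
          also have "\<dots> \<le> ennreal Cr * emeasure ?\<nu> ?Q"
            using inner by (intro mult_left_mono emeasure_mono) auto
          also have "\<dots> = ennreal (Cr * v)" using v \<sigma> by (simp add: ennreal_mult)
          finally have 1: "emeasure ?\<nu> (?B Y (A * R)) \<le> ennreal (Cr * v)" .
          obtain n where n: "emeasure \<mu> (qball \<rho> x R) = ennreal n" "0 < n"
            using mu_pos[OF R(1), of x] mu_finite[OF R(1), of x] by (cases "emeasure \<mu> (qball \<rho> x R)") auto
          have BR: "emeasure M (?B Y R) = ennreal (n * (2 * R powr p))"
            using R n by (simp add: xt qball_par_dist emeasure_tbox ennreal_mult)
          have "S \<subseteq> qball \<rho> x (2 * K\<^sub>0 * c2 / \<eta> * R)"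
            using \<eta> zx sym[of x z]
            by (intro order.trans[OF outer] qball_subset[of _ _ "c2 * l"]) (auto simp: R_def algebra_simps)
          then have "emeasure \<mu> S \<le> emeasure \<mu> (qball \<rho> x (2 * K\<^sub>0 * c2 / \<eta> * R))"
            by (rule emeasure_mono) simp
          also have "\<dots> \<le> ennreal Cq * emeasure \<mu> (qball \<rho> x R)" using R by (intro Cq(2))
          also have "\<dots> = ennreal (Cq * n)" unfolding n(1) using Cq(1) n(2) by (intro ennreal_mult[symmetric]) auto
          finally have "m \<le> Cq * n" unfolding m(1) using Cq(1) n(2) by (subst (asm) ennreal_le_iff) auto
          then have "m * L \<le> Cq * n * L" using L by (intro mult_right_mono) auto
          also have "\<dots> = Cb * (n * (2 * R powr p))" using \<eta> by (simp add: RL Cb_def)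
          finally have mLn: "m * L \<le> Cb * (n * (2 * R powr p))" .
          have "Cr * v = X / Cb * (m * L)" using Cb m(2) L by (simp add: X_def)
          also have "\<dots> \<le> X / Cb * (Cb * (n * (2 * R powr p)))" using mLn X Cb by (intro mult_left_mono) auto
          also have "\<dots> = X * (n * (2 * R powr p))" using Cb by simp
          finally have "ennreal (Cr * v) \<le> ennreal (X * (n * (2 * R powr p)))" by (rule ennreal_leI)
          also have "\<dots> = ennreal X * emeasure M (?B Y R)"
            unfolding BR using X n(2) by (intro ennreal_mult) auto
          finally show "emeasure ?\<nu> (?B Y (A * R)) \<le> ennreal X * emeasure M (?B Y R)" using 1 by (rule order.trans[rotated])
        qed
        let ?k = "ennreal (Ck * X powr (\<kappa> + 1) * DT)"
        define V where "V = tbox \<rho> z (K\<^sub>0 * (c2 + 1) * l) t (2 * L)"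
        let ?\<nu>' = "density M (\<lambda>y. ennreal (w y powr (\<kappa> + 1)))"
        have "emeasure ?\<nu>' ?P \<le> ?k * emeasure M (UNIV \<inter> V)"
        \<comment> \<open>The radius is \<open>R / T\<close> at every centre: dilation by
          \<open>T\<close> then returns to \<open>R\<close>, the radius for which the local
          inequality is known.\<close>
        proof (rule P.vitali_compare[where I = "(\<lambda>Y. (Y, R / T)) ` ?P" and R = R])
          fix Y r assume "(Y, r) \<in> (\<lambda>Y. (Y, R / T)) ` ?P"
          then have Y: "Y \<in> ?P" and r: "r = R / T" by auto
          have r0: "0 < r" using R AT by (simp add: r)
          have rR: "r \<le> R" using R AT divide_left_mono[of 1 T R] by (simp add: r)
          obtain x \<tau> where xt: "Y = (x, \<tau>)" by (cases Y)
          have xS: "x \<in> S" and "- L < e * (\<tau> - t)" "e * (\<tau> - t) < 0"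
            using Y by (auto simp: xt half_interval_def)
          then have \<tau>: "\<bar>\<tau> - t\<bar> < L" using e by auto
          have zx: "\<rho> z x < c2 * l" using xS outer by (auto simp: qball_def)
          have "?B Y R \<subseteq> V"
          proof -
            have "K\<^sub>0 * (c2 * l + R) \<le> K\<^sub>0 * (c2 * l + l)" using R K0_ge_1 by (intro mult_left_mono) auto
            then have "qball \<rho> x R \<subseteq> qball \<rho> z (K\<^sub>0 * (c2 + 1) * l)"
              using zx by (intro qball_subset[of _ _ "c2 * l"]) (auto simp: algebra_simps)
            then show ?thesis using \<tau> RL(2) unfolding xt qball_par_dist[OF R(1)] by (auto simp: V_def tbox_def)
          qed
          then show "0 < r \<and> r \<le> R \<and> ?B Y r \<subseteq> V" using r0 rR P.qball_mono[OF rR, of Y] by auto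
          have "emeasure ?\<nu>' (?B Y (5 * (2 * K\<^sub>0)\<^sup>2 * r)) = emeasure ?\<nu>' (?B Y R)"
            using AT unfolding T_def[symmetric] r by simp
          also have "\<dots> = (\<integral>\<^sup>+y\<in>?B Y R. ennreal (w y powr (\<kappa> + 1)) \<partial>M)" by (simp add: emeasure_density)
          also have "\<dots> \<le> ennreal (Ck * X powr (\<kappa> + 1)) * emeasure M (?B Y R)" by (rule local[OF Y])
          also have "R = T * r" using AT by (simp add: r)
          also have "ennreal (Ck * X powr (\<kappa> + 1)) * emeasure M (?B Y (T * r)) \<le> ennreal (Ck * X powr (\<kappa> + 1)) * (ennreal DT * emeasure M (?B Y r))"
            using r0 by (intro mult_left_mono DT(2)) auto
          also have "\<dots> = ?k * emeasure M (UNIV \<inter> ?B Y r)"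
            using Ck(1) DT(1) ennreal_mult[of "Ck * X powr (\<kappa> + 1)" DT] by (simp add: mult.assoc)
          finally show "emeasure ?\<nu>' (?B Y (5 * (2 * K\<^sub>0)\<^sup>2 * r)) \<le> ?k * emeasure M (UNIV \<inter> ?B Y r)" .
        next
          show "emeasure M V < \<infinity>" unfolding V_def using K0_ge_1 c l L by (intro tbox_finite) auto
          show "UNIV \<in> sets M" using sets.top[of M] by (simp add: space_M)
          have "Y \<in> ?B Y (R / T)" for Y using R AT by (intro P.centre_in_qball) simp
          then show "?P \<subseteq> (\<Union>(Y, r)\<in>(\<lambda>Y. (Y, R / T)) ` ?P. ?B Y r)" by auto
        qed (auto simp: V_def)
        also have "emeasure M (UNIV \<inter> V) = emeasure \<mu> (qball \<rho> z (K\<^sub>0 * (c2 + 1) / c1 * (c1 * l))) * ennreal (4 * L)"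
          using L c by (simp add: V_def emeasure_tbox mult.assoc)
        also have "emeasure \<mu> (qball \<rho> z (K\<^sub>0 * (c2 + 1) / c1 * (c1 * l))) \<le> ennreal Cw * emeasure \<mu> (qball \<rho> z (c1 * l))"
          using c l by (intro Cw(2)) simp
        also have "\<dots> \<le> ennreal Cw * emeasure \<mu> S" using inner by (intro mult_left_mono emeasure_mono) auto
        also have "?k * (ennreal Cw * emeasure \<mu> S * ennreal (4 * L)) = ennreal (E * X powr (\<kappa> + 1) * (m * L))"
        proof -
          have "ennreal Cw * ennreal m * ennreal (4 * L) = ennreal (Cw * m * (4 * L))"
            using Cw(1) m(2) L by (simp add: ennreal_mult[symmetric])
          moreover have "?k * ennreal (Cw * m * (4 * L)) = ennreal (Ck * X powr (\<kappa> + 1) * DT * (Cw * m * (4 * L)))"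
            using Ck(1) DT(1) Cw(1) m(2) L by (intro ennreal_mult[symmetric]) auto
          ultimately show ?thesis by (simp add: m(1) E_def mult_ac)
        qed
        finally have int: "emeasure ?\<nu>' ?P \<le> ennreal (E * X powr (\<kappa> + 1) * (m * L))"
          by (simp add: mult_left_mono mult_right_mono)
        have "avg M ?P (\<lambda>y. w y powr (\<kappa> + 1)) = emeasure ?\<nu>' ?P / ennreal (m * L)"
          by (simp add: avg_def MP emeasure_density)
        also have "\<dots> \<le> ennreal (E * X powr (\<kappa> + 1) * (m * L)) / ennreal (m * L)"
          using int by (rule divide_right_mono_ennreal)
        also have "\<dots> = ennreal (E * X powr (\<kappa> + 1))" using E mL m(2) L by (subst divide_ennreal) auto
        finally have "epowr (avg M ?P (\<lambda>y. w y powr (\<kappa> + 1))) (1 / (\<kappa> + 1)) \<le> ennreal ((E * X powr (\<kappa> + 1)) powr (1 / (\<kappa> + 1)))"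
          using E \<kappa> by (intro epowr_le_ennreal) auto
        also have "(E * X powr (\<kappa> + 1)) powr (1 / (\<kappa> + 1)) = E powr (1 / (\<kappa> + 1)) * X"
          using E X \<kappa> by (simp add: powr_mult powr_powr)
        also have "\<dots> = C * (v / (m * L))" by (simp add: C_def X_def)
        also have "ennreal (C * (v / (m * L))) = ennreal C * avg M ?Q w"
          unfolding avgQ v(1) using C v(2) mL ennreal_mult[of C "v / (m * L)"] by (simp add: divide_ennreal)
        finally show ?thesis .
      qed
      then show "epowr (avg M (S \<times> half_interval (-e) t (l powr p)) (\<lambda>y. w y powr (\<kappa> + 1))) (1 / (\<kappa> + 1))
        \<le> ennreal C * avg M (S \<times> half_interval e t (l powr p)) w" by (simp add: L_def)
    qed (rule C)
  qed (rule \<kappa>0)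
qed

end

section \<open>Parabolic Muckenhoupt weights\<close>

lemma avg_times_emeasure:
  assumes "0 < emeasure M E" "emeasure M E < \<infinity>"
  shows "avg M E f * emeasure M E = (\<integral>\<^sup>+z\<in>E. ennreal (f z) \<partial>M)"
  using assms unfolding avg_def
  by (simp add: mult.commute[of _ "emeasure M E"] ennreal_times_divide)
     (simp add: mult.commute[of "emeasure M E"] mult_divide_eq_ennreal)

lemma avg_cong_AE: "AE z in M. f z = g z \<Longrightarrow> avg M E f = avg M E g"
  unfolding avg_def by (intro arg_cong2[of _ _ _ _ "(/)"] nn_integral_cong_AE) auto

context parabolic
begin

text \<open>Chebyshev's inequality for \<open>v\<close>, which is at least
  \<open>(\<beta> * s) powr (- r)\<close> where \<open>u <= \<beta> * s\<close>. It is stated for an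
  abstract pair because it serves twice: with \<open>r = 1 / (q - 1)\<close> for
  \<open>\<omega>\<close> and, the roles exchanged, with \<open>r = q - 1\<close> for the dual
  weight.\<close>

lemma shift_denseI:
  fixes u v :: "'a \<times> real \<Rightarrow> real"
  assumes u[measurable]: "u \<in> borel_measurable M" and v[measurable]: "v \<in> borel_measurable M"
    and pos: "0 < r" "0 < A" "0 < a"
    and rel: "AE y in M. 0 < u y \<and> v y = u y powr (- r)"
    and bound: "\<And>x \<tau> l s. 0 < l \<Longrightarrow> 0 < s \<Longrightarrow>
      ennreal s * emeasure M (tbox \<rho> x l \<tau> (a * l powr p)) < (\<integral>\<^sup>+y\<in>tbox \<rho> x l \<tau> (a * l powr p). ennreal (u y) \<partial>M) \<Longrightarrow>
      (\<integral>\<^sup>+y\<in>tbox \<rho> x l (\<tau> + e * b * l powr p) (a * l powr p). ennreal (v y) \<partial>M) \<le>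
        ennreal ((A / s) powr r) * emeasure M (tbox \<rho> x l (\<tau> + e * b * l powr p) (a * l powr p))"
  shows "shift_dense e a b u"
  unfolding shift_dense_def
proof (intro allI impI)
  fix \<theta> :: real assume \<theta>: "0 < \<theta>"
  \<comment> \<open>Solves \<open>(\<beta> * A) powr r = \<theta>\<close>, the factor that
    Chebyshev's inequality leaves.\<close>
  define \<beta> where "\<beta> = \<theta> powr (1 / r) / A"
  have \<beta>: "0 < \<beta>" using \<theta> pos by (simp add: \<beta>_def)
  show "\<exists>\<beta>>0. \<forall>x \<tau> l s. 0 < l \<longrightarrow> 0 < s \<longrightarrow>
     ennreal s * emeasure M (tbox \<rho> x l \<tau> (a * l powr p)) < emeasure (density M u) (tbox \<rho> x l \<tau> (a * l powr p)) \<longrightarrow>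
     emeasure M ({y. u y \<le> \<beta> * s} \<inter> tbox \<rho> x l (\<tau> + e * b * l powr p) (a * l powr p))
       \<le> ennreal \<theta> * emeasure M (tbox \<rho> x l (\<tau> + e * b * l powr p) (a * l powr p))"
  proof (rule exI[of _ \<beta>], intro conjI allI impI)
    fix x \<tau> and l s :: real assume l: "0 < l" and s: "0 < s"
      and big: "ennreal s * emeasure M (tbox \<rho> x l \<tau> (a * l powr p)) < emeasure (density M u) (tbox \<rho> x l \<tau> (a * l powr p))"
    let ?S = "tbox \<rho> x l (\<tau> + e * b * l powr p) (a * l powr p)"
    let ?N = "{y. u y \<le> \<beta> * s} \<inter> ?S"
    have [measurable]: "{y. u y \<le> c} \<in> sets M" for c
      using measurable_sets[OF u, of "{..c}"] by (simp add: space_M vimage_def)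
    have bs: "0 < \<beta> * s" using \<beta> s by simp
    have "ennreal ((\<beta> * s) powr (- r)) * emeasure M ?N = (\<integral>\<^sup>+y. ennreal ((\<beta> * s) powr (- r)) * indicator ?N y \<partial>M)"
      by (simp add: nn_integral_cmult_indicator)
    also have "\<dots> \<le> (\<integral>\<^sup>+y\<in>?S. ennreal (v y) \<partial>M)"
    proof (rule nn_integral_mono_AE)
      show "AE y in M. ennreal ((\<beta> * s) powr (- r)) * indicator ?N y \<le> ennreal (v y) * indicator ?S y"
        using rel
      proof eventually_elim
        case (elim y)
        then show ?case
          using pos by (auto simp: indicator_def intro!: ennreal_leI powr_mono2')
      qed
    qed
    also have "\<dots> \<le> ennreal ((A / s) powr r) * emeasure M ?S"
      using big l s by (intro bound) (simp_all add: emeasure_density)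
    finally have *: "ennreal ((\<beta> * s) powr (- r)) * emeasure M ?N \<le> ennreal ((A / s) powr r) * emeasure M ?S" .
    have one: "(\<beta> * s) powr r * (\<beta> * s) powr (- r) = 1"
      using \<beta> s by (simp add: powr_add[symmetric])
    have "emeasure M ?N = ennreal ((\<beta> * s) powr r) * (ennreal ((\<beta> * s) powr (- r)) * emeasure M ?N)"
      by (simp add: mult.assoc[symmetric] ennreal_mult[symmetric] one)
    also have "\<dots> \<le> ennreal ((\<beta> * s) powr r) * (ennreal ((A / s) powr r) * emeasure M ?S)"
      using * by (rule mult_left_mono) simp
    also have "\<dots> = ennreal ((\<beta> * s) powr r * (A / s) powr r) * emeasure M ?S"
      by (simp add: mult.assoc[symmetric] ennreal_mult[symmetric])
    also have "(\<beta> * s) powr r * (A / s) powr r = \<theta>"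
    proof -
      have "(\<beta> * s) powr r * (A / s) powr r = (\<beta> * s * (A / s)) powr r" by (rule powr_mult[symmetric])
      also have "\<beta> * s * (A / s) = \<theta> powr (1 / r)" using s pos by (simp add: \<beta>_def)
      finally show ?thesis using pos \<theta> by (simp add: powr_powr)
    qed
    finally show "emeasure M ?N \<le> ennreal \<theta> * emeasure M ?S" .
  qed (rule \<beta>)
qed

text \<open>The two halves of a cylinder are boxes of half-height
  \<open>(1 - \<gamma>) / 2 * l powr p\<close> with centres \<open>(1 + \<gamma>) * l powr p\<close>
  apart. For the dual weight the upper half is the source and the lower half the target, hence the
  sign -1. The absolute value makes the weight nonnegative everywhere, as the good-lambda part
  requires, and alters it only on a null set.\<close>

lemma A_plus_shift_dense:
  assumes q: "1 < q" and \<gamma>: "0 \<le> \<gamma>" "\<gamma> < 1" and \<omega>: "\<omega> \<in> A_plus \<rho> \<mu> p q \<gamma>"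
  shows "shift_dense 1 ((1 - \<gamma>) / 2) (1 + \<gamma>) (\<lambda>y. \<bar>\<omega> y\<bar>)"
    and "shift_dense (-1) ((1 - \<gamma>) / 2) (1 + \<gamma>) (\<lambda>y. \<omega> y powr (1 - conj_exponent q))"
proof -
  have wt: "weight \<rho> \<mu> p \<omega>" using \<omega> by (simp add: A_plus_def)
  have [measurable]: "\<omega> \<in> borel_measurable M" and \<omega>_pos: "AE y in M. 0 < \<omega> y"
    using wt by (auto simp: weight_def)
  define a where "a = (1 - \<gamma>) / 2"
  have a: "0 < a" using \<gamma> by (simp add: a_def)
  define \<sigma> where "\<sigma> = (\<lambda>y. \<omega> y powr (1 - conj_exponent q))"
  have [measurable]: "\<sigma> \<in> borel_measurable M" unfolding \<sigma>_def by measurable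
  have conj: "1 - conj_exponent q = - (1 / (q - 1))" using q by (simp add: conj_exponent_def field_simps)
  define Y where "Y = (SUP (x, t, l) \<in> UNIV \<times> UNIV \<times> {0<..}.
       avg M (cyl_minus \<rho> p \<gamma> x t l) \<omega> * epowr (avg M (cyl_plus \<rho> p \<gamma> x t l) \<sigma>) (q - 1))"
  have "Y < \<infinity>" using \<omega> by (simp add: A_plus_def Y_def \<sigma>_def)
  define A where "A = max 1 (enn2real Y)"
  have A: "0 < A" by (simp add: A_def)
  have "Y = ennreal (enn2real Y)" using \<open>Y < \<infinity>\<close> by simp
  also have "\<dots> \<le> ennreal A" unfolding A_def by (rule ennreal_leI) simp
  finally have YA: "Y \<le> ennreal A" .
  have ends: "t - (1 + \<gamma>) / 2 * L - a * L = t - L" "t - (1 + \<gamma>) / 2 * L + a * L = t - \<gamma> * L"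
    "t + (1 + \<gamma>) / 2 * L - a * L = t + \<gamma> * L" "t + (1 + \<gamma>) / 2 * L + a * L = t + L" for t L
    by (simp_all add: a_def field_simps)
  have minus: "cyl_minus \<rho> p \<gamma> x t l = tbox \<rho> x l (t - (1 + \<gamma>) / 2 * l powr p) (a * l powr p)" for x t l
    unfolding cyl_minus_def tbox_def ends ..
  have plus: "cyl_plus \<rho> p \<gamma> x t l = tbox \<rho> x l (t + (1 + \<gamma>) / 2 * l powr p) (a * l powr p)" for x t l
    unfolding cyl_plus_def tbox_def ends ..
  have bound: "avg M (tbox \<rho> x l \<tau> (a * l powr p)) \<omega> * epowr (avg M (tbox \<rho> x l (\<tau> + (1 + \<gamma>) * l powr p) (a * l powr p)) \<sigma>) (q - 1) \<le> ennreal A"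
    if l: "0 < l" for x \<tau> l
  proof -
    define t where "t = \<tau> + (1 + \<gamma>) / 2 * l powr p"
    have t: "t - (1 + \<gamma>) / 2 * l powr p = \<tau>" "t + (1 + \<gamma>) / 2 * l powr p = \<tau> + (1 + \<gamma>) * l powr p"
      by (simp_all add: t_def field_simps)
    have "(x, t, l) \<in> UNIV \<times> UNIV \<times> {0<..}" using l by simp
    then have "(case (x, t, l) of (x, t, l) \<Rightarrow> avg M (cyl_minus \<rho> p \<gamma> x t l) \<omega> * epowr (avg M (cyl_plus \<rho> p \<gamma> x t l) \<sigma>) (q - 1)) \<le> Y"
      unfolding Y_def by (rule SUP_upper)
    then show ?thesis using YA unfolding prod.case minus plus t by (rule order.trans)
  qed
  have box: "0 < emeasure M (tbox \<rho> x l \<tau> (a * l powr p))" "emeasure M (tbox \<rho> x l \<tau> (a * l powr p)) < \<infinity>"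
    if "0 < l" for x \<tau> l
    using that a tbox_pos[of l "a * l powr p"] tbox_finite[of l "a * l powr p"] by auto
  have avg_gt: "ennreal s \<le> avg M (tbox \<rho> x l \<tau> (a * l powr p)) f"
    if "0 < l" "ennreal s * emeasure M (tbox \<rho> x l \<tau> (a * l powr p)) < (\<integral>\<^sup>+y\<in>tbox \<rho> x l \<tau> (a * l powr p). ennreal (f y) \<partial>M)"
    for x l \<tau> s f
  proof (rule ccontr)
    assume "\<not> ?thesis"
    then have "avg M (tbox \<rho> x l \<tau> (a * l powr p)) f * emeasure M (tbox \<rho> x l \<tau> (a * l powr p)) \<le> ennreal s * emeasure M (tbox \<rho> x l \<tau> (a * l powr p))"
      by (intro mult_right_mono) auto
    then show False using that box[of l x \<tau>] by (simp add: avg_times_emeasure)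
  qed
  show "shift_dense 1 ((1 - \<gamma>) / 2) (1 + \<gamma>) (\<lambda>y. \<bar>\<omega> y\<bar>)"
    unfolding a_def[symmetric]
  proof (rule shift_denseI[where v = \<sigma> and r = "1 / (q - 1)" and A = A])
    show "AE y in M. 0 < \<bar>\<omega> y\<bar> \<and> \<sigma> y = \<bar>\<omega> y\<bar> powr - (1 / (q - 1))"
      using \<omega>_pos by eventually_elim (simp add: \<sigma>_def conj)
    fix x \<tau> and l s :: real assume l: "0 < l" and s: "0 < s"
    let ?S = "tbox \<rho> x l \<tau> (a * l powr p)" and ?S' = "tbox \<rho> x l (\<tau> + 1 * (1 + \<gamma>) * l powr p) (a * l powr p)"
    assume "ennreal s * emeasure M ?S < (\<integral>\<^sup>+y\<in>?S. ennreal \<bar>\<omega> y\<bar> \<partial>M)"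
    also have "(\<integral>\<^sup>+y\<in>?S. ennreal \<bar>\<omega> y\<bar> \<partial>M) = (\<integral>\<^sup>+y\<in>?S. ennreal (\<omega> y) \<partial>M)"
      using \<omega>_pos by (intro nn_integral_cong_AE) auto
    finally have "ennreal s \<le> avg M ?S \<omega>" using l by (intro avg_gt)
    then have "ennreal s * epowr (avg M ?S' \<sigma>) (q - 1) \<le> avg M ?S \<omega> * epowr (avg M ?S' \<sigma>) (q - 1)"
      by (rule mult_right_mono) simp
    also have "\<dots> \<le> ennreal A" using bound[OF l] by simp
    finally have le: "ennreal s * epowr (avg M ?S' \<sigma>) (q - 1) \<le> ennreal A" .
    \<comment> \<open>An infinite average would make \<open>epowr\<close> infinite, and with
      \<open>s > 0\<close> the product as well.\<close>
    have "avg M ?S' \<sigma> \<noteq> \<infinity>"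
      using le s by (auto simp: epowr_def ennreal_mult_top top_unique)
    then obtain j where j: "avg M ?S' \<sigma> = ennreal j" "0 \<le> j" by (cases "avg M ?S' \<sigma>") auto
    have "ennreal (s * j powr (q - 1)) \<le> ennreal A"
      using le s j by (simp add: epowr_def ennreal_mult)
    then have "s * j powr (q - 1) \<le> A" using A by (subst (asm) ennreal_le_iff) auto
    then have "j powr (q - 1) \<le> A / s" using s by (simp add: field_simps)
    then have "(j powr (q - 1)) powr (1 / (q - 1)) \<le> (A / s) powr (1 / (q - 1))"
      using q by (intro powr_mono2) auto
    then have "j \<le> (A / s) powr (1 / (q - 1))" using q j(2) by (simp add: powr_powr)
    then have "avg M ?S' \<sigma> * emeasure M ?S' \<le> ennreal ((A / s) powr (1 / (q - 1))) * emeasure M ?S'"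
      unfolding j(1) by (intro mult_right_mono ennreal_leI) auto
    then show "(\<integral>\<^sup>+y\<in>?S'. ennreal (\<sigma> y) \<partial>M) \<le> ennreal ((A / s) powr (1 / (q - 1))) * emeasure M ?S'"
      using box[OF l] by (simp add: avg_times_emeasure)
  qed (use q A a in auto)
  show "shift_dense (-1) ((1 - \<gamma>) / 2) (1 + \<gamma>) (\<lambda>y. \<omega> y powr (1 - conj_exponent q))"
    unfolding a_def[symmetric] \<sigma>_def[symmetric]
  proof (rule shift_denseI[where v = \<omega> and r = "q - 1" and A = "A powr (1 / (q - 1))"])
    show "AE y in M. 0 < \<sigma> y \<and> \<omega> y = \<sigma> y powr - (q - 1)"
      using \<omega>_pos
    proof eventually_elim
      case (elim y)
      have "\<sigma> y powr - (q - 1) = \<omega> y powr ((1 / (q - 1)) * (q - 1))"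
        unfolding \<sigma>_def conj powr_powr by (simp only: minus_mult_minus)
      also have "(1 / (q - 1)) * (q - 1) = 1" using q by simp
      also have "\<omega> y powr 1 = \<omega> y" using elim by simp
      finally show ?case using elim by (simp add: \<sigma>_def)
    qed
    fix x \<tau> and l s :: real assume l: "0 < l" and s: "0 < s"
    let ?S = "tbox \<rho> x l \<tau> (a * l powr p)" and ?S' = "tbox \<rho> x l (\<tau> + -1 * (1 + \<gamma>) * l powr p) (a * l powr p)"
    assume "ennreal s * emeasure M ?S < (\<integral>\<^sup>+y\<in>?S. ennreal (\<sigma> y) \<partial>M)"
    then have "ennreal s \<le> avg M ?S \<sigma>" using l by (intro avg_gt)
    then have "ennreal (s powr (q - 1)) \<le> epowr (avg M ?S \<sigma>) (q - 1)"
      using s q by (cases "avg M ?S \<sigma>") (auto simp: epowr_def intro!: ennreal_leI powr_mono2)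
    then have "avg M ?S' \<omega> * ennreal (s powr (q - 1)) \<le> avg M ?S' \<omega> * epowr (avg M ?S \<sigma>) (q - 1)"
      by (rule mult_left_mono) simp
    also have "\<dots> \<le> ennreal A"
      using bound[OF l, of x "\<tau> + -1 * (1 + \<gamma>) * l powr p"] by (simp add: algebra_simps)
    finally have "avg M ?S' \<omega> * ennreal (s powr (q - 1)) * ennreal (1 / s powr (q - 1)) \<le> ennreal A * ennreal (1 / s powr (q - 1))"
      by (rule mult_right_mono) simp
    also have "avg M ?S' \<omega> * ennreal (s powr (q - 1)) * ennreal (1 / s powr (q - 1)) = avg M ?S' \<omega>"
      using s by (simp add: mult.assoc ennreal_mult[symmetric])
    also have "ennreal A * ennreal (1 / s powr (q - 1)) = ennreal ((A powr (1 / (q - 1)) / s) powr (q - 1))"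
      using s A q by (simp add: ennreal_mult[symmetric] powr_divide powr_powr)
    finally have "avg M ?S' \<omega> * emeasure M ?S' \<le> ennreal ((A powr (1 / (q - 1)) / s) powr (q - 1)) * emeasure M ?S'"
      by (rule mult_right_mono) simp
    then show "(\<integral>\<^sup>+y\<in>?S'. ennreal (\<omega> y) \<partial>M) \<le> ennreal ((A powr (1 / (q - 1)) / s) powr (q - 1)) * emeasure M ?S'"
      using box[OF l] by (simp add: avg_times_emeasure)
  qed (use q A a in auto)
qed

end

theorem theorem6p1:
  fixes \<rho> :: "'a \<Rightarrow> 'a \<Rightarrow> real"
    and \<mu> :: "'a measure"
    and K\<^sub>0 p q \<gamma> \<delta> c\<^sub>0 C\<^sub>0 :: real
    and K :: nat
    and Idx :: "nat \<Rightarrow> int \<Rightarrow> 'i set"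
    and z :: "nat \<Rightarrow> int \<Rightarrow> 'i \<Rightarrow> 'a"
    and Q :: "nat \<Rightarrow> int \<Rightarrow> 'i \<Rightarrow> 'a set"
    and \<omega> :: "'a \<times> real \<Rightarrow> real"
  assumes "homogeneous_type \<rho> K\<^sub>0 \<mu>"
    and "basic_assumptions \<rho> \<mu>"
    and "monotone_geodesic \<rho>"
    and "1 < p"
    and "basic_assumptions (par_dist \<rho> p) (par_measure \<mu>)"
    and "adjacent_dyadic \<rho> K\<^sub>0 \<mu> \<delta> c\<^sub>0 C\<^sub>0 K Idx z Q"
    and "1 < q"
    and "0 \<le> \<gamma>" and "\<gamma> < 1"
    and "\<omega> \<in> A_plus \<rho> \<mu> p q \<gamma>"
  shows "\<exists>\<kappa> C. 0 < \<kappa> \<and> 0 < C \<and>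
    (\<forall>\<tau>\<in>{1..K}. \<forall>k. \<forall>\<alpha>\<in>Idx \<tau> k. \<forall>t.
      epowr (avg (par_measure \<mu>) (rect_minus \<delta> p k (Q \<tau> k \<alpha>) t)
               (\<lambda>y. \<omega> y powr (\<kappa> + 1))) (1 / (\<kappa> + 1))
        \<le> ennreal C * avg (par_measure \<mu>) (rect_plus \<delta> p k (Q \<tau> k \<alpha>) t) \<omega> \<and>
      epowr (avg (par_measure \<mu>) (rect_plus \<delta> p k (Q \<tau> k \<alpha>) t)
               (\<lambda>y. \<omega> y powr ((1 - conj_exponent q) * (\<kappa> + 1)))) (1 / (\<kappa> + 1))
        \<le> ennreal C * avg (par_measure \<mu>) (rect_minus \<delta> p k (Q \<tau> k \<alpha>) t)
               (\<lambda>y. \<omega> y powr (1 - conj_exponent q)))"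
proof -
  interpret parabolic \<rho> K\<^sub>0 \<mu> p
    using assms(1,2,4,5) by (simp add: parabolic_def parabolic_axioms_def)
  interpret dyadic: adjacent_dyadic \<rho> K\<^sub>0 \<mu> \<delta> c\<^sub>0 C\<^sub>0 K Idx z Q by (rule assms(6))
  define a where "a = (1 - \<gamma>) / 2"
  define b where "b = 1 + \<gamma>"
  have ab: "0 < a" "a \<le> b" "a \<le> 1" using assms(8,9) by (auto simp: a_def b_def)
  define c1 where "c1 = c\<^sub>0 / (3 * K\<^sub>0\<^sup>2)"
  define c2 where "c2 = 2 * K\<^sub>0 * C\<^sub>0"
  have c: "0 < c1" "0 < c2" using K0_ge_1 dyadic.c0_C0 by (auto simp: c1_def c2_def)
  define u where "u = (\<lambda>y. \<bar>\<omega> y\<bar>)"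
  define \<sigma> where "\<sigma> = (\<lambda>y. \<omega> y powr (1 - conj_exponent q))"
  have \<omega>[measurable]: "\<omega> \<in> borel_measurable M" and \<omega>_pos: "AE y in M. 0 < \<omega> y"
    using assms(10) by (auto simp: A_plus_def weight_def)
  have meas: "u \<in> borel_measurable M" "\<sigma> \<in> borel_measurable M" by (simp_all add: u_def \<sigma>_def)
  have nonneg': "0 \<le> u y" "0 \<le> \<sigma> y" for y by (auto simp: u_def \<sigma>_def)
  have pos: "AE y in M. 0 < u y" "AE y in M. 0 < \<sigma> y"
    using \<omega>_pos by (auto simp: u_def \<sigma>_def elim: eventually_mono)
  define RH where "RH e w \<kappa> C \<longleftrightarrow> (\<forall>z l S t. 0 < l \<longrightarrow> S \<in> sets \<mu> \<longrightarrow>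
    qball \<rho> z (c1 * l) \<subseteq> S \<longrightarrow> S \<subseteq> qball \<rho> z (c2 * l) \<longrightarrow>
    epowr (avg M (S \<times> half_interval (-e) t (l powr p)) (\<lambda>y. w y powr (\<kappa> + 1))) (1 / (\<kappa> + 1))
      \<le> ennreal C * avg M (S \<times> half_interval e t (l powr p)) w)" for e w \<kappa> C
  have "\<exists>\<kappa>\<^sub>0>0. \<forall>\<kappa>. 0 < \<kappa> \<longrightarrow> \<kappa> \<le> \<kappa>\<^sub>0 \<longrightarrow> (\<exists>C>0. RH 1 u \<kappa> C)"
    unfolding RH_def u_def a_def b_def
    by (rule reverse_holder_half[OF meas(1)[unfolded u_def] nonneg'(1)[unfolded u_def] pos(1)[unfolded u_def]
        A_plus_shift_dense(1)[OF assms(7-10)] _ ab[unfolded a_def b_def] assms(3) c]) simp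
  moreover have "\<exists>\<kappa>\<^sub>0>0. \<forall>\<kappa>. 0 < \<kappa> \<longrightarrow> \<kappa> \<le> \<kappa>\<^sub>0 \<longrightarrow> (\<exists>C>0. RH (-1) \<sigma> \<kappa> C)"
    unfolding RH_def \<sigma>_def a_def b_def
    by (rule reverse_holder_half[OF meas(2)[unfolded \<sigma>_def] nonneg'(2)[unfolded \<sigma>_def] pos(2)[unfolded \<sigma>_def]
        A_plus_shift_dense(2)[OF assms(7-10)] _ ab[unfolded a_def b_def] assms(3) c]) simp
  ultimately obtain \<kappa>1 \<kappa>2 where \<kappa>12: "0 < \<kappa>1" "0 < \<kappa>2"
    "\<And>\<kappa>. 0 < \<kappa> \<Longrightarrow> \<kappa> \<le> \<kappa>1 \<Longrightarrow> \<exists>C>0. RH 1 u \<kappa> C"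
    "\<And>\<kappa>. 0 < \<kappa> \<Longrightarrow> \<kappa> \<le> \<kappa>2 \<Longrightarrow> \<exists>C>0. RH (-1) \<sigma> \<kappa> C" by blast
  \<comment> \<open>Each inequality holds for all exponents up to its threshold, so the minimum
    serves both; the constants may still differ.\<close>
  define \<kappa> where "\<kappa> = min \<kappa>1 \<kappa>2"
  have \<kappa>: "0 < \<kappa>" "\<kappa> \<le> \<kappa>1" "\<kappa> \<le> \<kappa>2" using \<kappa>12(1,2) by (auto simp: \<kappa>_def)
  obtain C1 C2 where C: "0 < C1" "RH 1 u \<kappa> C1" "0 < C2" "RH (-1) \<sigma> \<kappa> C2"
    using \<kappa>12(3)[OF \<kappa>(1,2)] \<kappa>12(4)[OF \<kappa>(1,3)] by blast
  show ?thesis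
  proof (rule exI[of _ \<kappa>], rule exI[of _ "max C1 C2"], intro conjI ballI allI)
    show "0 < max C1 C2" using C by simp
    fix \<tau> k \<alpha> t assume \<tau>: "\<tau> \<in> {1..K}" and \<alpha>: "\<alpha> \<in> Idx \<tau> k"
    \<comment> \<open>At this scale the inner and outer balls of the cube have radii
      \<open>c1 * l\<close> and \<open>c2 * l\<close>, and the time intervals of both halves have
      length \<open>l powr p\<close>.\<close>
    define l where "l = \<delta> powi k"
    have l: "0 < l" using dyadic.delta(1) by (simp add: l_def)
    have lp: "l powr p = \<delta> powr (of_int k * p)"
      using dyadic.delta(1) by (simp add: l_def powr_powr flip: powr_real_of_int')
    have S: "Q \<tau> k \<alpha> \<in> sets \<mu>" "qball \<rho> (z \<tau> k \<alpha>) (c1 * l) \<subseteq> Q \<tau> k \<alpha>" "Q \<tau> k \<alpha> \<subseteq> qball \<rho> (z \<tau> k \<alpha>) (c2 * l)"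
      using dyadic.cubes_measurable[OF \<tau> \<alpha>] dyadic.inner_ball[OF \<tau> \<alpha>] dyadic.outer_ball[OF \<tau> \<alpha>]
      by (simp_all add: c1_def c2_def l_def)
    have minus: "Q \<tau> k \<alpha> \<times> half_interval (-1) t (l powr p) = rect_minus \<delta> p k (Q \<tau> k \<alpha>) t"
      and plus: "Q \<tau> k \<alpha> \<times> half_interval 1 t (l powr p) = rect_plus \<delta> p k (Q \<tau> k \<alpha>) t"
      by (simp_all add: half_interval_eq rect_minus_def rect_plus_def lp)
    have le: "ennreal C1 * x \<le> ennreal (max C1 C2) * x" "ennreal C2 * x \<le> ennreal (max C1 C2) * x" for x
      by (auto intro!: mult_right_mono ennreal_leI)
    have "epowr (avg M (rect_minus \<delta> p k (Q \<tau> k \<alpha>) t) (\<lambda>y. \<omega> y powr (\<kappa> + 1))) (1 / (\<kappa> + 1)) =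
      epowr (avg M (rect_minus \<delta> p k (Q \<tau> k \<alpha>) t) (\<lambda>y. u y powr (\<kappa> + 1))) (1 / (\<kappa> + 1))"
      using \<omega>_pos by (intro arg_cong2[of _ _ _ _ epowr] avg_cong_AE) (auto simp: u_def elim: eventually_mono)
    also have "\<dots> \<le> ennreal C1 * avg M (rect_plus \<delta> p k (Q \<tau> k \<alpha>) t) u"
      using C(2)[unfolded RH_def, rule_format, OF l S, of t] by (simp only: minus plus)
    also have "avg M (rect_plus \<delta> p k (Q \<tau> k \<alpha>) t) u = avg M (rect_plus \<delta> p k (Q \<tau> k \<alpha>) t) \<omega>"
      using \<omega>_pos by (intro avg_cong_AE) (auto simp: u_def elim: eventually_mono)
    finally show "epowr (avg M (rect_minus \<delta> p k (Q \<tau> k \<alpha>) t) (\<lambda>y. \<omega> y powr (\<kappa> + 1))) (1 / (\<kappa> + 1))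
      \<le> ennreal (max C1 C2) * avg M (rect_plus \<delta> p k (Q \<tau> k \<alpha>) t) \<omega>"
      using le(1) by (rule order.trans)
    have "epowr (avg M (rect_plus \<delta> p k (Q \<tau> k \<alpha>) t) (\<lambda>y. \<sigma> y powr (\<kappa> + 1))) (1 / (\<kappa> + 1))
        \<le> ennreal C2 * avg M (rect_minus \<delta> p k (Q \<tau> k \<alpha>) t) \<sigma>"
      using C(4)[unfolded RH_def, rule_format, OF l S, of t] by (simp only: minus plus minus_minus)
    then have "epowr (avg M (rect_plus \<delta> p k (Q \<tau> k \<alpha>) t) (\<lambda>y. \<sigma> y powr (\<kappa> + 1))) (1 / (\<kappa> + 1))
        \<le> ennreal (max C1 C2) * avg M (rect_minus \<delta> p k (Q \<tau> k \<alpha>) t) \<sigma>"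
      using le(2) by (rule order.trans)
    then show "epowr (avg M (rect_plus \<delta> p k (Q \<tau> k \<alpha>) t) (\<lambda>y. \<omega> y powr ((1 - conj_exponent q) * (\<kappa> + 1)))) (1 / (\<kappa> + 1))
      \<le> ennreal (max C1 C2) * avg M (rect_minus \<delta> p k (Q \<tau> k \<alpha>) t) (\<lambda>y. \<omega> y powr (1 - conj_exponent q))"
      by (simp add: \<sigma>_def powr_powr)
  qed (rule \<kappa>)
qed

end
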